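(* Let $f\in V^*_+$ and let $u\in\mathbf Q(f)$ be arbitrary with $0\le u\le\bar u$ a.e. Assume (A1), (A3), (A4), (A5) (stated in the context, the last two for this $u$), and let either (A2a) hold and $d\in V^*_+$ be arbitrary, or (A2b) hold, $f\in L^\infty_+(\Omega)$ and $d\in L^\infty_+(\Omega)$. Then for every such direction $d$ there exist a function $t\mapsto q(t)$ with $q(t)\in\mathbf Q(f+td)$ and $u\le q(t)\le\bar q(t)$ a.e., and an element $\alpha=\alpha(d)\in V_+$, such that $$q(t)=u+t\alpha+o(t)\qquad\forall t>0,$$ where $t^{-1}o(t)\to0$ in $V$ as $t\to0^+$, and $\alpha$ satisfies the quasi-variational inequality $$\alpha\in\mathcal K^u(\alpha):\quad\langle A\alpha-d,\alpha-v\rangle\le0\quad\forall v\in\mathcal K^u(\alpha),$$ $$\mathcal K^u(w):=\{\varphi\in V:\varphi\le\Phi'(u)(w)\text{ q.e. on }\mathcal A(u)\text{ and }\langle Au-f,\varphi-\Phi'(u)(w)\rangle=0\}.$$ Moreover, the directional derivative $\alpha=\alpha(d)$ is positively homogeneous in $d$: $\alpha(cd)=c\,\alpha(d)$ for $c>0$.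
   Context: Setting: $X$ is a locally compact topological space that is countable at infinity, $\xi$ is a Radon measure on $X$, $H:=L^2(X;\xi)$ (real-valued), and $V$ is a real Hilbert space with $V\subset H$ continuously and densely such that $|u|\in V$ and $\|u^+\|_V\le\kappa\|u\|_V$ for all $u\in V$, for some constant $\kappa>0$ (convention $u=u^+-u^-$). $V\cap C_c(X)$ is dense in $C_c(X)$ in the supremum norm and dense in $V$ in the $V$-norm. $A\colon V\to V^*$ is linear and, for all $u,v\in V$, $\langle Au,v\rangle\le C_b\|u\|_V\|v\|_V$, $\langle Au,u\rangle\ge C_a\|u\|_V^2$ with $C_a>0$, and $\langle Au^+,u^-\rangle\le0$. The map $\Phi\colon H\to V$ (possibly nonlinear) satisfies $\Phi(0)\ge0$ a.e. and is increasing: $u\ge v$ a.e. implies $\Phi(u)\ge\Phi(v)$ a.e. Notation: $V_+:=\{v\in V:v\ge0\text{ a.e.}\}$, $V^*_+:=\{g\in V^*:\langle g,v\rangle\ge0\ \forall v\in V_+\}$; $L^\infty_+(\Omega)$ is the set of a.e. non-negative elements of $L^\infty(\Omega)$. $\mathbf K(\varphi):=\{v\in V:v\le\Phi(\varphi)\text{ a.e.}\}$. For $f\in V^*$, $\mathbf Q(f)$ is the set of all $u\in V$ with $u\in\mathbf K(u)$ and $\langle Au-f,u-v\rangle\le0$ for all $v\in\mathbf K(u)$. $\bar u,\bar q(t)\in V$ are the solutions of $A\bar u=f$ and $A\bar q(t)=f+td$. Elements of $V$ are represented by quasi-continuous representatives, and q.e. means outside a set of capacity zero, for the usual capacity associated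 with $V$: $\mathrm{cap}(E)=\inf\{\|v\|_V^2: v\in V,\ v\ge1\text{ a.e. on an open neighbourhood of }E\}$. $\mathcal A(u):=\{x\in X:u(x)=\Phi(u)(x)\}$ is the coincidence set. $B_R(z)$ is the closed ball of radius $R$ around $z$ in $V$. Completely continuous means mapping weakly convergent sequences to strongly convergent ones. Assumptions: (A1) $\Phi\colon V\to V$ is Hadamard directionally differentiable: for all $v,h\in V$ the limit $\Phi'(v)(h):=\lim_{h'\to h,\,t\to0^+}(\Phi(v+th')-\Phi(v))/t$ exists in $V$. (A2a) $\Phi\colon V\to V$ is completely continuous. (A2b) $V=H^1(\Omega)$, $X=\overline\Omega$ with $\Omega$ a bounded Lipschitz domain, $\Phi\colon V\cap L^\infty_+(\Omega)\to L^\infty_+(\Omega)$ is concave, and $\Phi(0)\ge c>0$ for a constant $c$. (A3) For fixed $v\in V$, $\Phi'(v)\colon V\to V$ is completely continuous. (A4) For any $b\in V$, $h\colon(0,T)\to V$ and $\lambda\in[0,1]$: $\|\Phi'(u+tb+\lambda h(t))h(t)\|_V/t\to0$ as $t\to0^+$ whenever $h(t)/t\to0$ as $t\to0^+$. (A5) There are $\epsilon>0$ and a constant $C_\Phi<\frac1{1+C_a^{-1}C_b}$ with $\|\Phi'(z)(v)\|_V\le C_\Phi\|v\|_V$ for all $z\in B_\epsilon(u)$ and all $v\in V$. *)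

theory Defs
  imports "HOL-Analysis.Analysis"
begin

section \<open>Function spaces\<close>

definition square_integrable :: "'x measure \<Rightarrow> ('x \<Rightarrow> 'b::euclidean_space) \<Rightarrow> bool" where
  "square_integrable M g \<longleftrightarrow> g \<in> borel_measurable M \<and> integrable M (\<lambda>x. (norm (g x))\<^sup>2)"

definition Linf_plus :: "'x measure \<Rightarrow> ('x \<Rightarrow> real) set" where
  "Linf_plus M = {g \<in> borel_measurable M. (AE x in M. 0 \<le> g x) \<and> (\<exists>C. AE x in M. \<bar>g x\<bar> \<le> C)}"

text \<open>Continuous functions with compact support on the subspace \<open>X\<close>; values outside \<open>X\<close> are
  irrelevant.\<close>

definition Cc :: "'x::topological_space set \<Rightarrow> ('x \<Rightarrow> real) set" where
  "Cc X = {g. continuous_on X g \<and> (\<exists>K. compact K \<and> K \<subseteq> X \<and> (\<forall>x\<in>X - K. g x = 0))}"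

definition radon_measure_on :: "'x::topological_space set \<Rightarrow> 'x measure \<Rightarrow> bool" where
  "radon_measure_on X M \<longleftrightarrow>
     sets M = sets (restrict_space borel X) \<and>
     (\<forall>K. compact K \<and> K \<subseteq> X \<longrightarrow> emeasure M K < \<infinity>) \<and>
     (\<forall>E\<in>sets M. emeasure M E =
        (INF U\<in>{U. openin (top_of_set X) U \<and> E \<subseteq> U}. emeasure M U)) \<and>
     (\<forall>U. openin (top_of_set X) U \<longrightarrow>
        emeasure M U = (SUP K\<in>{K. compact K \<and> K \<subseteq> U}. emeasure M K))"


section \<open>The abstract setting\<close>

text \<open>
  The Hilbert space \<open>V\<close> is a type, and its inclusion into \<open>L\<^sup>2(X; \<xi>)\<close> is a map \<open>rep\<close>
  choosing for each \<open>v\<close> some member \<open>rep v\<close> of its class of almost everywhere equal functions,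
  so that identities between functions \<open>rep v\<close> are only meaningful almost everywhere.
  The space \<open>L\<^sup>2(X; \<xi>)\<close>, the domain of \<open>\<Phi>\<close>, is likewise represented by the square integrable functions;
  \<open>\<Phi>\<close> respects equality almost everywhere because it is increasing and \<open>rep\<close> is injective.
\<close>

locale qvi_setting =
  fixes X :: "'x::t2_space set"
    and \<xi> :: "'x measure"
    and rep :: "'v::{real_inner, banach} \<Rightarrow> 'x \<Rightarrow> real"
    and \<kappa> C\<^sub>a C\<^sub>b :: real
    and A :: "'v \<Rightarrow> 'v \<Rightarrow>\<^sub>L real"
    and \<Phi> :: "('x \<Rightarrow> real) \<Rightarrow> 'v"
  assumes locally_compact: "locally compact X"
    and countable_at_infinity: "\<exists>K :: nat \<Rightarrow> 'x set. (\<forall>n. compact (K n)) \<and> X = (\<Union>n. K n)"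
    and radon: "radon_measure_on X \<xi>"
    and rep_L2: "square_integrable \<xi> (rep v)"
    and rep_linear: "AE x in \<xi>. rep (a *\<^sub>R v + b *\<^sub>R w) x = a * rep v x + b * rep w x"
    and rep_inj: "(AE x in \<xi>. rep v x = 0) \<Longrightarrow> v = 0"
    and rep_continuous: "\<exists>C. \<forall>v. sqrt (\<integral>x. (rep v x)\<^sup>2 \<partial>\<xi>) \<le> C * norm v"
    and rep_dense: "\<And>h e. square_integrable \<xi> h \<Longrightarrow> e > 0 \<Longrightarrow>
                      \<exists>v. sqrt (\<integral>x. (rep v x - h x)\<^sup>2 \<partial>\<xi>) < e"
    and abs_in_V: "\<exists>w. AE x in \<xi>. rep w x = \<bar>rep v x\<bar>"
    and kappa_pos: "\<kappa> > 0"
    and pos_part_bound: "(AE x in \<xi>. rep p x = max (rep v x) 0) \<Longrightarrow> norm p \<le> \<kappa> * norm v"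
    and Cc_dense_sup: "\<And>g e. g \<in> Cc X \<Longrightarrow> e > 0 \<Longrightarrow>
          \<exists>v. \<exists>h\<in>Cc X. (AE x in \<xi>. rep v x = h x) \<and> (\<forall>x\<in>X. \<bar>h x - g x\<bar> < e)"
    and Cc_dense_V: "closure {v. \<exists>h\<in>Cc X. AE x in \<xi>. rep v x = h x} = UNIV"
    and A_linear: "linear A"
    and A_bounded: "A v w \<le> C\<^sub>b * norm v * norm w"
    and A_coercive: "A v v \<ge> C\<^sub>a * (norm v)\<^sup>2"
    and Ca_pos: "C\<^sub>a > 0"
    and A_T_monotone: "\<And>v p m. (AE x in \<xi>. rep p x = max (rep v x) 0) \<Longrightarrow>
          (AE x in \<xi>. rep m x = max (- rep v x) 0) \<Longrightarrow> A p m \<le> 0"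
    and Phi_zero: "AE x in \<xi>. 0 \<le> rep (\<Phi> (\<lambda>_. 0)) x"
    and Phi_mono: "\<And>g h. square_integrable \<xi> g \<Longrightarrow> square_integrable \<xi> h \<Longrightarrow>
          (AE x in \<xi>. g x \<ge> h x) \<Longrightarrow> (AE x in \<xi>. rep (\<Phi> g) x \<ge> rep (\<Phi> h) x)"

definition V_plus :: "'x measure \<Rightarrow> ('v \<Rightarrow> 'x \<Rightarrow> real) \<Rightarrow> 'v set" where
  "V_plus \<xi> rep = {v. AE x in \<xi>. 0 \<le> rep v x}"

definition dual_plus ::
  "'x measure \<Rightarrow> ('v::real_normed_vector \<Rightarrow> 'x \<Rightarrow> real) \<Rightarrow> ('v \<Rightarrow>\<^sub>L real) set" where
  "dual_plus \<xi> rep = {g :: 'v \<Rightarrow>\<^sub>L real. \<forall>v\<in>V_plus \<xi> rep. 0 \<le> g v}"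

text \<open>The non-negative bounded functions, as functionals via the \<open>L\<^sup>2\<close> inner product.\<close>

definition Linf_dual_plus ::
  "'x measure \<Rightarrow> ('v::real_normed_vector \<Rightarrow> 'x \<Rightarrow> real) \<Rightarrow> ('v \<Rightarrow>\<^sub>L real) set" where
  "Linf_dual_plus \<xi> rep =
     {g :: 'v \<Rightarrow>\<^sub>L real. \<exists>g0\<in>Linf_plus \<xi>. \<forall>v. g v = (\<integral>x. g0 x * rep v x \<partial>\<xi>)}"

definition constraint_set ::
  "'x measure \<Rightarrow> ('v \<Rightarrow> 'x \<Rightarrow> real) \<Rightarrow> (('x \<Rightarrow> real) \<Rightarrow> 'v) \<Rightarrow> ('x \<Rightarrow> real) \<Rightarrow> 'v set" where
  "constraint_set \<xi> rep \<Phi> g = {v. AE x in \<xi>. rep v x \<le> rep (\<Phi> g) x}"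

definition QVI ::
  "'x measure \<Rightarrow> ('v::real_normed_vector \<Rightarrow> 'x \<Rightarrow> real) \<Rightarrow> ('v \<Rightarrow> 'v \<Rightarrow>\<^sub>L real)
    \<Rightarrow> (('x \<Rightarrow> real) \<Rightarrow> 'v) \<Rightarrow> ('v \<Rightarrow>\<^sub>L real) \<Rightarrow> 'v set" where
  "QVI \<xi> rep A \<Phi> f =
     {u. u \<in> constraint_set \<xi> rep \<Phi> (rep u) \<and>
         (\<forall>v\<in>constraint_set \<xi> rep \<Phi> (rep u). (A u - f) (u - v) \<le> 0)}"

definition linear_solution ::
  "('v::real_normed_vector \<Rightarrow> 'v \<Rightarrow>\<^sub>L real) \<Rightarrow> ('v \<Rightarrow>\<^sub>L real) \<Rightarrow> 'v" where
  "linear_solution A g = (THE w. A w = g)"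


section \<open>Capacity and quasi-continuous representatives\<close>

text \<open>Extended values, so that a set without admissible \<open>v\<close> has infinite capacity.\<close>

definition capacity ::
  "'x::topological_space set \<Rightarrow> 'x measure \<Rightarrow> ('v::real_normed_vector \<Rightarrow> 'x \<Rightarrow> real)
    \<Rightarrow> 'x set \<Rightarrow> ennreal" where
  "capacity X \<xi> rep E =
     (INF v\<in>{v. \<exists>U. openin (top_of_set X) U \<and> E \<subseteq> U \<and> (AE x in \<xi>. x \<in> U \<longrightarrow> 1 \<le> rep v x)}.
        ennreal ((norm v)\<^sup>2))"

definition quasi_continuous ::
  "'x::topological_space set \<Rightarrow> 'x measure \<Rightarrow> ('v::real_normed_vector \<Rightarrow> 'x \<Rightarrow> real)
    \<Rightarrow> ('x \<Rightarrow> real) \<Rightarrow> bool" where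
  "quasi_continuous X \<xi> rep g \<longleftrightarrow>
     (\<forall>e>0. \<exists>G. openin (top_of_set X) G \<and> capacity X \<xi> rep G < ennreal e \<and>
                 continuous_on (X - G) g)"

text \<open>Some quasi-continuous representative; two of them differ on a set of capacity zero only.\<close>

definition qc_rep ::
  "'x::topological_space set \<Rightarrow> 'x measure \<Rightarrow> ('v::real_normed_vector \<Rightarrow> 'x \<Rightarrow> real)
    \<Rightarrow> 'v \<Rightarrow> 'x \<Rightarrow> real" where
  "qc_rep X \<xi> rep v = (SOME g. quasi_continuous X \<xi> rep g \<and> (AE x in \<xi>. g x = rep v x))"

definition qe_on ::
  "'x::topological_space set \<Rightarrow> 'x measure \<Rightarrow> ('v::real_normed_vector \<Rightarrow> 'x \<Rightarrow> real)
    \<Rightarrow> 'x set \<Rightarrow> ('x \<Rightarrow> bool) \<Rightarrow> bool" where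
  "qe_on X \<xi> rep E P \<longleftrightarrow> capacity X \<xi> rep {x \<in> E. \<not> P x} = 0"

definition coincidence_set ::
  "'x::topological_space set \<Rightarrow> 'x measure \<Rightarrow> ('v::real_normed_vector \<Rightarrow> 'x \<Rightarrow> real)
    \<Rightarrow> (('x \<Rightarrow> real) \<Rightarrow> 'v) \<Rightarrow> 'v \<Rightarrow> 'x set" where
  "coincidence_set X \<xi> rep \<Phi> u =
     {x \<in> X. qc_rep X \<xi> rep u x = qc_rep X \<xi> rep (\<Phi> (rep u)) x}"

definition critical_set ::
  "'x::topological_space set \<Rightarrow> 'x measure \<Rightarrow> ('v::real_normed_vector \<Rightarrow> 'x \<Rightarrow> real)
    \<Rightarrow> ('v \<Rightarrow> 'v \<Rightarrow>\<^sub>L real) \<Rightarrow> (('x \<Rightarrow> real) \<Rightarrow> 'v) \<Rightarrow> ('v \<Rightarrow> 'v \<Rightarrow> 'v)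
    \<Rightarrow> ('v \<Rightarrow>\<^sub>L real) \<Rightarrow> 'v \<Rightarrow> 'v \<Rightarrow> 'v set" where
  "critical_set X \<xi> rep A \<Phi> \<Phi>' f u w =
     {\<phi>. qe_on X \<xi> rep (coincidence_set X \<xi> rep \<Phi> u)
            (\<lambda>x. qc_rep X \<xi> rep \<phi> x \<le> qc_rep X \<xi> rep (\<Phi>' u w) x) \<and>
         (A u - f) (\<phi> - \<Phi>' u w) = 0}"


section \<open>Differentiability and complete continuity\<close>

definition has_hadamard_derivative ::
  "('v::real_normed_vector \<Rightarrow> 'w::real_normed_vector) \<Rightarrow> 'v \<Rightarrow> 'v \<Rightarrow> 'w \<Rightarrow> bool" where
  "has_hadamard_derivative F v h L \<longleftrightarrow>
     ((\<lambda>(t, h'). (1 / t) *\<^sub>R (F (v + t *\<^sub>R h') - F v)) \<longlongrightarrow> L) (at_right (0::real) \<times>\<^sub>F nhds h)"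

definition weakly_converges :: "(nat \<Rightarrow> 'v::real_normed_vector) \<Rightarrow> 'v \<Rightarrow> bool" where
  "weakly_converges s l \<longleftrightarrow> (\<forall>g :: 'v \<Rightarrow>\<^sub>L real. (\<lambda>n. g (s n)) \<longlonglongrightarrow> g l)"

definition completely_continuous ::
  "('v::real_normed_vector \<Rightarrow> 'w::real_normed_vector) \<Rightarrow> bool" where
  "completely_continuous F \<longleftrightarrow>
     (\<forall>s l. weakly_converges s l \<longrightarrow> (\<lambda>n. F (s n)) \<longlonglongrightarrow> F l)"


section \<open>Lipschitz domains and the Sobolev space \<open>H\<^sup>1\<close>\<close>

text \<open>Near each boundary point the domain is the epigraph, in some direction \<open>e\<close>, of a Lipschitz
  function on the hyperplane orthogonal to \<open>e\<close>.\<close>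

definition bounded_lipschitz_domain :: "'n::euclidean_space set \<Rightarrow> bool" where
  "bounded_lipschitz_domain \<Omega> \<longleftrightarrow>
     open \<Omega> \<and> connected \<Omega> \<and> \<Omega> \<noteq> {} \<and> bounded \<Omega> \<and>
     (\<forall>z\<in>frontier \<Omega>. \<exists>e \<gamma> L U. norm e = 1 \<and> L-lipschitz_on {y. y \<bullet> e = 0} \<gamma> \<and> open U \<and> z \<in> U \<and>
        \<Omega> \<inter> U = {y \<in> U. \<gamma> (y - (y \<bullet> e) *\<^sub>R e) < y \<bullet> e})"

primrec Ck :: "nat \<Rightarrow> ('n::euclidean_space \<Rightarrow> real) \<Rightarrow> bool" where
  "Ck 0 g \<longleftrightarrow> continuous_on UNIV g"
| "Ck (Suc k) g \<longleftrightarrow> (\<forall>x. g differentiable (at x)) \<and>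
     (\<forall>i\<in>Basis. Ck k (\<lambda>x. frechet_derivative g (at x) i))"

definition test_functions :: "'n::euclidean_space set \<Rightarrow> ('n \<Rightarrow> real) set" where
  "test_functions \<Omega> =
     {\<phi>. (\<forall>k. Ck k \<phi>) \<and> compact (closure {x. \<phi> x \<noteq> 0}) \<and> closure {x. \<phi> x \<noteq> 0} \<subseteq> \<Omega>}"

definition has_L2_weak_gradient ::
  "'n::euclidean_space set \<Rightarrow> ('n \<Rightarrow> real) \<Rightarrow> ('n \<Rightarrow> 'n) \<Rightarrow> bool" where
  "has_L2_weak_gradient \<Omega> g G \<longleftrightarrow>
     square_integrable (restrict_space lborel \<Omega>) G \<and>
     (\<forall>\<phi>\<in>test_functions \<Omega>. \<forall>i\<in>Basis.
        (\<integral>x. g x * frechet_derivative \<phi> (at x) i \<partial>restrict_space lborel \<Omega>) =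
        - (\<integral>x. (G x \<bullet> i) * \<phi> x \<partial>restrict_space lborel \<Omega>))"

definition H1 :: "'n::euclidean_space set \<Rightarrow> ('n \<Rightarrow> real) set" where
  "H1 \<Omega> = {g. square_integrable (restrict_space lborel \<Omega>) g \<and> (\<exists>G. has_L2_weak_gradient \<Omega> g G)}"

definition H1_norm :: "'n::euclidean_space set \<Rightarrow> ('n \<Rightarrow> real) \<Rightarrow> real" where
  "H1_norm \<Omega> g =
     sqrt ((\<integral>x. (g x)\<^sup>2 \<partial>restrict_space lborel \<Omega>) +
           (\<integral>x. (norm ((SOME G. has_L2_weak_gradient \<Omega> g G) x))\<^sup>2 \<partial>restrict_space lborel \<Omega>))"

text \<open>
  The identities \<open>X = closure \<Omega>\<close> and \<open>V = H\<^sup>1(\<Omega>)\<close> are expressed by a homeomorphism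
  \<open>\<iota>\<close> from \<open>closure \<Omega>\<close> onto \<open>X\<close> that transports Lebesgue measure to \<open>\<xi>\<close>, because \<open>X\<close> lives in an arbitrary
  Hausdorff type. The literal equality is the case where \<open>\<iota>\<close> is the identity.
\<close>

definition is_H1_setting ::
  "'n::euclidean_space set \<Rightarrow> ('n \<Rightarrow> 'x) \<Rightarrow> 'x::topological_space set \<Rightarrow> 'x measure
    \<Rightarrow> ('v::real_normed_vector \<Rightarrow> 'x \<Rightarrow> real) \<Rightarrow> bool" where
  "is_H1_setting \<Omega> \<iota> X \<xi> rep \<longleftrightarrow>
     bounded_lipschitz_domain \<Omega> \<and>
     (\<exists>\<iota>'. homeomorphism (closure \<Omega>) X \<iota> \<iota>') \<and>
     \<xi> = distr (restrict_space lborel (closure \<Omega>)) (restrict_space borel X) \<iota> \<and>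
     (\<forall>v. rep v \<circ> \<iota> \<in> H1 \<Omega> \<and> norm v = H1_norm \<Omega> (rep v \<circ> \<iota>)) \<and>
     (\<forall>g\<in>H1 \<Omega>. \<exists>v. AE x in restrict_space lborel \<Omega>. rep v (\<iota> x) = g x)"

text \<open>Since \<open>\<xi>\<close> is Lebesgue measure on \<open>closure \<Omega>\<close>, whose boundary part is a null set,
  \<open>L\<^sup>\<infinity>(\<Omega>)\<close> is \<open>L\<^sup>\<infinity>(\<xi>)\<close>.\<close>

definition concave_obstacle_map ::
  "'x measure \<Rightarrow> ('v::real_normed_vector \<Rightarrow> 'x \<Rightarrow> real) \<Rightarrow> (('x \<Rightarrow> real) \<Rightarrow> 'v) \<Rightarrow> bool" where
  "concave_obstacle_map \<xi> rep \<Phi> \<longleftrightarrow>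
     (\<forall>v. rep v \<in> Linf_plus \<xi> \<longrightarrow> rep (\<Phi> (rep v)) \<in> Linf_plus \<xi>) \<and>
     (\<forall>v w s. rep v \<in> Linf_plus \<xi> \<and> rep w \<in> Linf_plus \<xi> \<and> 0 \<le> s \<and> s \<le> 1 \<longrightarrow>
        (AE x in \<xi>. s * rep (\<Phi> (rep v)) x + (1 - s) * rep (\<Phi> (rep w)) x
                     \<le> rep (\<Phi> (rep (s *\<^sub>R v + (1 - s) *\<^sub>R w))) x)) \<and>
     (\<exists>c>0. AE x in \<xi>. c \<le> rep (\<Phi> (\<lambda>_. 0)) x)"

end

theory Submission
  imports Defs
begin

text \<open>
  Write \<open>S\<^sub>g(\<psi>)\<close> for the solution of the variational inequality with source \<open>g\<close> and obstacle \<open>\<psi>\<close>, so that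
  solutions of the quasi-variational inequality are the fixed points of \<open>w \<mapsto> S\<^sub>g(\<Phi> w)\<close>. Since
  \<open>S\<^sub>g\<close> is \<open>C\<^sub>b/C\<^sub>a\<close>-Lipschitz and, by (A5), \<open>\<Phi>\<close> is \<open>C\<^sub>\<Phi>\<close>-Lipschitz near \<open>u\<close>, this map is
  a contraction near \<open>u\<close>; it is also increasing, so the fixed point for a source near \<open>f\<close> lies above \<open>u\<close>.
  For large \<open>t\<close> the Birkhoff--Tartar theorem takes over.

  The cone of non-positive functions is polyhedric, so \<open>S\<^bsub>f+td\<^esub>(\<Phi> u + t \<eta>) = u + t \<alpha> + o(t)\<close>, where \<open>\<alpha>\<close>
  solves a variational inequality over \<open>\<eta>\<close> plus the critical cone. The choice \<open>\<eta> = \<Phi>'(u)(\<alpha>)\<close> is again a contractive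
  fixed point problem for \<open>\<alpha>\<close>, and comparing the two fixed points transfers the expansion to \<open>q(t)\<close>.

  The tangent cone at \<open>u\<close> is described through capacity by an explicit approximation from below, without
  representing positive functionals by measures.
\<close>

text \<open>The form is not assumed symmetric and no weak topology is set up. Compactness enters
  only as the statement that a decreasing sequence of non-empty bounded closed convex sets in
  Hilbert space has a common point, which follows from the parallelogram law. The positive part is
  bounded on V, but its continuity in the norm of V is not assumed. Pointwise truncations are
  therefore controlled only in L2, and convex combinations turn this into approximation in V. For
  this reason the sets of admissible directions are shown to be convex before closures are taken.
  Polyhedricity rests on order: a positive functional that vanishes at \<open>y\<close> vanishes on
  everything between 0 and a multiple of \<open>y\<close>, so it is enough to approximate the
  positive part of a tangent direction from inside such intervals. Solutions of the
  quasi-variational inequality need not be unique. A solution \<open>Q g\<close> is therefore chosen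
  once for each source \<open>g\<close>, not for each pair of direction and parameter, and
  homogeneity of the derivative becomes a reparametrisation of the same curve.\<close>

section \<open>Variational inequalities in Hilbert space\<close>

text \<open>Points of nearly minimal norm in the sets form a Cauchy sequence, because the minimal
  norms increase and stay bounded. This replaces weak compactness throughout.\<close>

lemma Cantor_convex_intersection:
  fixes S :: "nat \<Rightarrow> 'v::{real_inner, banach} set"
  assumes closed: "\<And>n. closed (S n)" and convex: "\<And>n. convex (S n)"
    and ne: "\<And>n. S n \<noteq> {}" and dec: "\<And>n. S (Suc n) \<subseteq> S n" and bdd: "bounded (S 0)"
  shows "\<exists>x. \<forall>n. x \<in> S n"
proof -
  have dec': "S m \<subseteq> S n" if "n \<le> m" for m n
    using lift_Suc_antimono_le[of S, OF dec that] .
  obtain B where B: "\<And>x. x \<in> S 0 \<Longrightarrow> norm x \<le> B"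
    using bdd unfolding bounded_iff by blast
  define d where "d n = (INF x\<in>S n. norm x)" for n
  have bb: "bdd_below (norm ` S n)" for n
    by (intro bdd_belowI[where m = 0]) auto
  have d_le: "d n \<le> norm x" if "x \<in> S n" for x n
    unfolding d_def using bb that by (rule cINF_lower)
  have d_nonneg: "0 \<le> d n" for n
    unfolding d_def using ne by (intro cINF_greatest) auto
  have d_mono: "d n \<le> d m" if "n \<le> m" for n m
    unfolding d_def using dec'[OF that] ne bb by (intro cINF_superset_mono) auto
  have d_B: "d n \<le> B" for n
  proof -
    obtain x where "x \<in> S n" using ne by blast
    moreover have "x \<in> S 0" using calculation dec'[of 0 n] by auto
    ultimately show ?thesis using d_le[of x n] B[of x] by linarith
  qed
  have "convergent d"
    using d_mono d_B by (intro Bseq_mono_convergent) (auto simp: Bseq_def intro!: exI[of _ "max B 1"]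
        simp: d_nonneg le_max_iff_disj)
  then obtain L where L: "d \<longlonglongrightarrow> L" unfolding convergent_def by blast
  have "\<exists>x\<in>S n. norm x < d n + 1 / real (Suc n)" for n
    unfolding d_def using ne[of n] bb[of n]
    by (metis (no_types, lifting) cINF_less_iff less_add_same_cancel1 of_nat_0_less_iff zero_less_Suc zero_less_divide_1_iff)
  then obtain x where x: "\<And>n. x n \<in> S n" "\<And>n. norm (x n) < d n + 1 / real (Suc n)" by metis
  have dL: "d n \<le> L" for n
    using L d_mono by (intro Lim_bounded2[of d L n]) auto
  \<comment> \<open>Parallelogram law: the midpoint of \<open>x n\<close> and \<open>x m\<close>
    lies in \<open>S n\<close>, so its norm is at least \<open>d n\<close>, while both norms are at
    most \<open>L + 1 / real (Suc n)\<close>.\<close>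
  define e where "e n = 4 * (L + 1 / real (Suc n))\<^sup>2 - 4 * (d n)\<^sup>2" for n
  have est: "(norm (x n - x m))\<^sup>2 \<le> e n" if "n \<le> m" for n m
  proof -
    have "x m \<in> S n" using x(1)[of m] dec'[OF that] by auto
    then have "(1/2) *\<^sub>R x n + (1/2) *\<^sub>R x m \<in> S n"
      using x(1)[of n] convex[of n] by (intro convexD) auto
    then have "d n \<le> norm ((1/2) *\<^sub>R (x n + x m))" using d_le by (simp add: algebra_simps)
    then have 1: "(2 * d n)\<^sup>2 \<le> (norm (x n + x m))\<^sup>2"
      using d_nonneg[of n] by (intro power_mono) auto
    have "1 / real (Suc m) \<le> 1 / real (Suc n)" using that by (simp add: frac_le)
    then have "norm (x m) \<le> L + 1 / real (Suc n)" using x(2)[of m] dL[of m] by linarith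
    then have 2: "(norm (x m))\<^sup>2 \<le> (L + 1 / real (Suc n))\<^sup>2" by (intro power_mono) auto
    have "norm (x n) \<le> L + 1 / real (Suc n)" using x(2)[of n] dL[of n] by linarith
    then have 3: "(norm (x n))\<^sup>2 \<le> (L + 1 / real (Suc n))\<^sup>2" by (intro power_mono) auto
    have "(norm (x n - x m))\<^sup>2 = 2 * (norm (x n))\<^sup>2 + 2 * (norm (x m))\<^sup>2 - (norm (x n + x m))\<^sup>2"
      by (simp add: power2_norm_eq_inner inner_diff inner_add inner_commute algebra_simps)
    then show ?thesis using 1 2 3 unfolding e_def by (simp add: power_mult_distrib)
  qed
  have "e \<longlonglongrightarrow> 4 * (L + 0)\<^sup>2 - 4 * L\<^sup>2"
    unfolding e_def by (intro tendsto_intros L LIMSEQ_Suc[OF lim_1_over_n])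
  then have e0: "e \<longlonglongrightarrow> 0" by simp
  have "Cauchy x"
  proof (rule CauchyI')
    fix r :: real assume "r > 0"
    then have "\<forall>\<^sub>F n in sequentially. e n < r\<^sup>2" using e0 by (intro order_tendstoD(2)) auto
    then obtain N where N: "\<And>n. n \<ge> N \<Longrightarrow> e n < r\<^sup>2" unfolding eventually_sequentially by auto
    have "dist (x m) (x n) < r" if "m \<ge> N" "n > m" for m n
    proof -
      have "(dist (x m) (x n))\<^sup>2 < r\<^sup>2" using est[of m n] N[of m] that by (simp add: dist_norm)
      then show ?thesis using \<open>r > 0\<close> by (simp add: power_less_imp_less_base)
    qed
    then show "\<exists>M. \<forall>m\<ge>M. \<forall>n>m. dist (x m) (x n) < r" by blast
  qed
  then obtain l where l: "x \<longlonglongrightarrow> l" using Cauchy_convergent convergent_def by blast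
  have "l \<in> S n" for n
  proof (rule closed_sequentially[OF closed])
    show "x (m + n) \<in> S n" for m using x(1) dec' le_add2 by blast
    show "(\<lambda>m. x (m + n)) \<longlonglongrightarrow> l" using l by (rule LIMSEQ_ignore_initial_segment)
  qed
  then show ?thesis by blast
qed

text \<open>The sets of points of K within distance \<open>r n\<close> of \<open>w\<close> are
  nested, and a common point attains the distance because \<open>r n\<close> tends to it. A failing
  inequality would give a closer point on a segment in K.\<close>

lemma exists_projection:
  fixes K :: "'v::{real_inner, banach} set"
  assumes K: "closed K" "convex K" "K \<noteq> {}"
  shows "\<exists>p\<in>K. \<forall>v\<in>K. (w - p) \<bullet> (v - p) \<le> 0"
proof -
  define r where "r n = infdist w K + 1 / real (Suc n)" for n
  have "\<exists>x. \<forall>n. x \<in> K \<inter> cball w (r n)"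
  proof (rule Cantor_convex_intersection)
    show "closed (K \<inter> cball w (r n))" "convex (K \<inter> cball w (r n))" for n
      using K by (auto intro: convex_Int)
    show "K \<inter> cball w (r (Suc n)) \<subseteq> K \<inter> cball w (r n)" for n
      unfolding r_def by (intro Int_mono subset_cball order_refl add_left_mono) (simp add: frac_le)
    show "bounded (K \<inter> cball w (r 0))" by (simp add: bounded_Int)
    show "K \<inter> cball w (r n) \<noteq> {}" for n
    proof -
      have "infdist w K < r n" by (simp add: r_def)
      then obtain a where "a \<in> K" "dist w a < r n"
        using K(3) cINF_less_iff[of K "dist w" "r n"] by (auto simp: infdist_def)
      then show ?thesis by (auto simp: less_imp_le)
    qed
  qed
  then obtain p where p: "p \<in> K" "\<And>n. dist w p \<le> r n" by auto
  have "r \<longlonglongrightarrow> infdist w K + 0"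
    unfolding r_def by (intro tendsto_intros LIMSEQ_Suc[OF lim_1_over_n])
  then have le: "dist w p \<le> infdist w K"
    using p(2) by (intro LIMSEQ_le_const[of r]) auto
  have "(w - p) \<bullet> (v - p) \<le> 0" if "v \<in> K" for v
  proof (rule ccontr)
    assume "\<not> ?thesis"
    then obtain t where t: "t > 0" "t \<le> 1" "dist (p + t *\<^sub>R (v - p)) w < dist p w"
      using closer_point_lemma[of w p v] by auto
    have "p + t *\<^sub>R (v - p) \<in> K"
      using convexD_alt[OF K(2) p(1) that, of t] t by (auto simp: algebra_simps)
    then have "infdist w K \<le> dist w (p + t *\<^sub>R (v - p))" by (rule infdist_le)
    then show False using t(3) le by (simp add: dist_commute)
  qed
  then show ?thesis using p by blast
qed

text \<open>The point of least norm on the hyperplane where \<open>l\<close> equals 1 is orthogonal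
  to the kernel of \<open>l\<close>; rescaling it gives the representing vector.\<close>

lemma Riesz_representation:
  fixes l :: "'v::{real_inner, banach} \<Rightarrow>\<^sub>L real"
  shows "\<exists>r. \<forall>v. l v = r \<bullet> v"
proof (cases "\<forall>v. l v = 0")
  case True
  then show ?thesis by (intro exI[of _ 0]) auto
next
  case False
  then obtain z where z: "l z \<noteq> 0" by blast
  define K where "K = {v. l v = 1}"
  have "closed K" unfolding K_def by (intro closed_Collect_eq continuous_intros)
  moreover have "convex K"
    unfolding K_def convex_def by (auto simp: blinfun.add_right blinfun.scaleR_right)
  moreover have "K \<noteq> {}" using z by (auto simp: K_def blinfun.scaleR_right intro!: exI[of _ "(1 / l z) *\<^sub>R z"])
  ultimately obtain p where p: "p \<in> K" "\<And>v. v \<in> K \<Longrightarrow> (0 - p) \<bullet> (v - p) \<le> 0"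
    using exists_projection[of K 0] by blast
  have perp: "p \<bullet> v = 0" if "l v = 0" for v
  proof -
    have "p + v \<in> K" "p - v \<in> K" using p(1) that by (auto simp: K_def blinfun.add_right blinfun.diff_right)
    then show ?thesis using p(2)[of "p + v"] p(2)[of "p - v"] by auto
  qed
  have "p \<noteq> 0" using p(1) by (auto simp: K_def)
  have "l v = (inverse (p \<bullet> p) *\<^sub>R p) \<bullet> v" for v
  proof -
    have "l (v - l v *\<^sub>R p) = 0" using p(1) by (simp add: K_def blinfun.diff_right blinfun.scaleR_right)
    from perp[OF this] show ?thesis using \<open>p \<noteq> 0\<close> by (simp add: inner_diff_right field_simps)
  qed
  then show ?thesis by blast
qed

section \<open>Coercive forms and variational inequalities over convex sets\<close>

locale coercive_form =
  fixes A :: "'v::{real_inner, banach} \<Rightarrow> 'v \<Rightarrow>\<^sub>L real" and c M :: real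
  assumes form_linear: "linear A"
    and form_bounded: "\<bar>A v w\<bar> \<le> M * norm v * norm w"
    and form_coercive: "A v v \<ge> c * (norm v)\<^sup>2"
    and c_pos: "c > 0" and M_nonneg: "M \<ge> 0"
begin

lemma A_diff: "A (v - w) = A v - A w" and A_add: "A (v + w) = A v + A w"
  and A_scale: "A (t *\<^sub>R v) = t *\<^sub>R A v" and A_zero: "A 0 = 0" and A_minus: "A (- v) = - A v"
  by (simp_all add: linear_diff linear_add linear_scale linear_0 linear_neg form_linear)

lemmas form_simps = A_diff A_add A_scale A_zero A_minus blinfun.diff_left blinfun.diff_right
  blinfun.add_left blinfun.add_right blinfun.scaleR_left blinfun.scaleR_right
  blinfun.minus_left blinfun.minus_right blinfun.zero_left blinfun.zero_right

lemma norm_A_le: "norm (A v) \<le> M * norm v"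
  using form_bounded M_nonneg by (intro norm_blinfun_bound) auto

text \<open>Without symmetry there is no energy to minimise. The inequality says that
  \<open>u\<close> is the projection of \<open>u - \<rho> *\<^sub>R R (A u - g)\<close>, and for a
  suitable step \<rho> this map is a contraction.\<close>

lemma Lions_Stampacchia:
  assumes K: "closed K" "convex K" "K \<noteq> {}"
  shows "\<exists>u\<in>K. \<forall>v\<in>K. (A u - g) (u - v) \<le> 0"
proof -
  obtain R :: "('v \<Rightarrow>\<^sub>L real) \<Rightarrow> 'v" where R: "\<And>l v. blinfun_apply l v = R l \<bullet> v"
    using Riesz_representation by metis
  obtain P where P: "\<And>w. P w \<in> K" "\<And>w v. v \<in> K \<Longrightarrow> (w - P w) \<bullet> (v - P w) \<le> 0"
    using exists_projection[OF K] by metis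
  have P_lip: "norm (P v - P w) \<le> norm (v - w)" for v w
  proof -
    have "(v - P v) \<bullet> (P w - P v) \<le> 0" "(w - P w) \<bullet> (P v - P w) \<le> 0" using P by auto
    then have "(norm (P v - P w))\<^sup>2 \<le> (v - w) \<bullet> (P v - P w)"
      by (simp add: power2_norm_eq_inner inner_diff inner_commute algebra_simps)
    also have "\<dots> \<le> norm (v - w) * norm (P v - P w)" by (rule norm_cauchy_schwarz)
    finally show ?thesis
      by (cases "P v = P w") (auto simp: power2_eq_square)
  qed
  have R_norm: "norm (R (A v)) \<le> M * norm v" for v
  proof -
    have "norm (R (A v)) * norm (R (A v)) = A v (R (A v))"
      by (simp add: R power2_norm_eq_inner flip: power2_eq_square)
    also have "\<dots> \<le> M * norm v * norm (R (A v))" using form_bounded[of v "R (A v)"] by linarith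
    finally show ?thesis using M_nonneg by (cases "R (A v) = 0") auto
  qed
  \<comment> \<open>The maximum keeps the constant positive and at least \<open>c\<close> even on
    the trivial space, so that the root defining \<open>k\<close> makes sense.\<close>
  define M' where "M' = max M c"
  \<comment> \<open>This step minimises
    \<open>1 - 2 * \<rho> * c + \<rho>\<^sup>2 * M'\<^sup>2\<close>, the squared Lipschitz bound;
    the minimum is the square of \<open>k\<close>.\<close>
  define \<rho> where "\<rho> = c / M'\<^sup>2"
  define k where "k = sqrt (1 - c\<^sup>2 / M'\<^sup>2)"
  have M': "M' > 0" "c \<le> M'" "M \<le> M'" using c_pos by (auto simp: M'_def)
  have k2: "0 \<le> 1 - c\<^sup>2 / M'\<^sup>2" "1 - c\<^sup>2 / M'\<^sup>2 < 1"
    using M' c_pos by (auto simp: field_simps power_mono)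
  have norm_sq: "(norm (a - \<rho> *\<^sub>R b))\<^sup>2 = (norm a)\<^sup>2 - 2 * \<rho> * (b \<bullet> a) + \<rho>\<^sup>2 * (norm b)\<^sup>2" for a b :: 'v
    unfolding power2_norm_eq_inner
    by (simp add: inner_diff_left inner_diff_right inner_commute power2_eq_square)
  define T where "T w = P (w - \<rho> *\<^sub>R (R (A w - g)))" for w
  have "\<exists>!x\<in>UNIV. T x = x"
  proof (rule Banach_fix)
    show "0 \<le> k" "k < 1" using k2 by (auto simp: k_def)
    fix v w :: 'v
    have RA: "R (A v - g) - R (A w - g) = R (A (v - w))"
    proof (rule vector_eq_ldot[THEN iffD1], rule allI)
      fix z
      show "z \<bullet> (R (A v - g) - R (A w - g)) = z \<bullet> R (A (v - w))"
        using R[of "A v - g" z] R[of "A w - g" z] R[of "A (v - w)" z]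
        by (simp add: inner_diff inner_commute form_simps)
    qed
    let ?e = "v - w"
    have R_norm': "norm (R (A ?e)) \<le> M' * norm ?e"
      using R_norm[of ?e] M'(3) by (meson mult_right_mono norm_ge_zero order_trans)
    have "(norm (?e - \<rho> *\<^sub>R R (A ?e)))\<^sup>2 = (norm ?e)\<^sup>2 - 2 * \<rho> * A ?e ?e + \<rho>\<^sup>2 * (norm (R (A ?e)))\<^sup>2"
      by (simp add: R[of "A ?e" ?e] norm_sq)
    also have "\<dots> \<le> (norm ?e)\<^sup>2 - 2 * \<rho> * (c * (norm ?e)\<^sup>2) + \<rho>\<^sup>2 * (M' * norm ?e)\<^sup>2"
      using form_coercive[of ?e] R_norm' M' c_pos
      by (intro add_mono diff_mono mult_left_mono power_mono) (auto simp: \<rho>_def)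
    also have "\<dots> = (1 - c\<^sup>2 / M'\<^sup>2) * (norm ?e)\<^sup>2"
      using M' unfolding \<rho>_def by (simp add: field_simps power2_eq_square)
    also have "\<dots> = (k * norm ?e)\<^sup>2" using k2 by (simp add: k_def power_mult_distrib)
    finally have "norm (?e - \<rho> *\<^sub>R R (A ?e)) \<le> k * norm ?e"
      using \<open>0 \<le> k\<close> by (auto intro: power2_le_imp_le)
    moreover have "norm (T v - T w) \<le> norm (?e - \<rho> *\<^sub>R R (A ?e))"
      unfolding T_def RA[symmetric]
      using P_lip[of "v - \<rho> *\<^sub>R R (A v - g)" "w - \<rho> *\<^sub>R R (A w - g)"] by (simp add: algebra_simps)
    ultimately show "dist (T v) (T w) \<le> k * dist v w" by (simp add: dist_norm)
  qed (auto simp: complete_UNIV)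
  then obtain u where u: "T u = u" by blast
  have \<rho>: "\<rho> > 0" using M' c_pos by (simp add: \<rho>_def)
  have "(A u - g) (u - v) \<le> 0" if "v \<in> K" for v
  proof -
    have "- (\<rho> *\<^sub>R R (A u - g)) \<bullet> (v - u) \<le> 0"
      using P(2)[OF that, of "u - \<rho> *\<^sub>R R (A u - g)"] u unfolding T_def by simp
    then have "\<rho> * (R (A u - g) \<bullet> (u - v)) \<le> 0" by (simp add: inner_diff algebra_simps)
    then show ?thesis using \<rho> unfolding R[of "A u - g"] by (simp add: mult_le_0_iff)
  qed
  moreover have "u \<in> K" using u P(1) unfolding T_def by metis
  ultimately show ?thesis by blast
qed

text \<open>The constraint set is \<open>\<psi> + K\<close>: for the cone \<open>K\<close> of non-positive functions this is the problem with
  obstacle \<open>\<psi>\<close>, for a critical cone \<open>K\<close> it is the linearised problem.\<close>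

definition vi_solves :: "'v set \<Rightarrow> ('v \<Rightarrow>\<^sub>L real) \<Rightarrow> 'v \<Rightarrow> 'v \<Rightarrow> bool" where
  "vi_solves K g \<psi> w \<longleftrightarrow> w - \<psi> \<in> K \<and> (\<forall>k\<in>K. (A w - g) (w - \<psi> - k) \<le> 0)"

definition vi :: "'v set \<Rightarrow> ('v \<Rightarrow>\<^sub>L real) \<Rightarrow> 'v \<Rightarrow> 'v" where
  "vi K g \<psi> = (SOME w. vi_solves K g \<psi> w)"

lemma vi_solves_vi:
  assumes "closed K" "convex K" "K \<noteq> {}"
  shows "vi_solves K g \<psi> (vi K g \<psi>)"
proof -
  obtain u where "u \<in> K" "\<forall>v\<in>K. (A u - (g - A \<psi>)) (u - v) \<le> 0"
    using Lions_Stampacchia[OF assms] by blast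
  then have "vi_solves K g \<psi> (u + \<psi>)"
    by (auto simp: vi_solves_def form_simps algebra_simps)
  then show ?thesis unfolding vi_def by (rule someI)
qed

text \<open>Each inequality is tested with the deviation of the other solution from its own
  obstacle. In the sum the source cancels, and only the obstacle difference remains on the
  right.\<close>

lemma vi_solves_lipschitz_obstacle:
  assumes "vi_solves K g \<psi>1 w1" "vi_solves K g \<psi>2 w2"
  shows "c * norm (w1 - w2) \<le> M * norm (\<psi>1 - \<psi>2)"
proof -
  have "(A w1 - g) (w1 - \<psi>1 - (w2 - \<psi>2)) \<le> 0" "(A w2 - g) (w2 - \<psi>2 - (w1 - \<psi>1)) \<le> 0"
    using assms unfolding vi_solves_def by auto
  then have "A (w1 - w2) (w1 - w2) \<le> A (w1 - w2) (\<psi>1 - \<psi>2)"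
    by (simp add: form_simps algebra_simps)
  also have "\<dots> \<le> M * norm (w1 - w2) * norm (\<psi>1 - \<psi>2)"
    using form_bounded[of "w1 - w2" "\<psi>1 - \<psi>2"] by linarith
  finally have "c * norm (w1 - w2) * norm (w1 - w2) \<le> M * norm (\<psi>1 - \<psi>2) * norm (w1 - w2)"
    using form_coercive[of "w1 - w2"] by (simp add: power2_eq_square mult.assoc mult.commute mult.left_commute)
  then show ?thesis using M_nonneg by (cases "w1 = w2") auto
qed

lemma vi_solves_lipschitz_source:
  assumes "vi_solves K g1 \<psi> w1" "vi_solves K g2 \<psi> w2"
  shows "c * norm (w1 - w2) \<le> norm (g1 - g2)"
proof -
  have "(A w1 - g1) (w1 - \<psi> - (w2 - \<psi>)) \<le> 0" "(A w2 - g2) (w2 - \<psi> - (w1 - \<psi>)) \<le> 0"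
    using assms unfolding vi_solves_def by auto
  then have "A (w1 - w2) (w1 - w2) \<le> (g1 - g2) (w1 - w2)"
    by (simp add: form_simps algebra_simps)
  also have "\<dots> \<le> norm (g1 - g2) * norm (w1 - w2)"
    using norm_blinfun[of "g1 - g2" "w1 - w2"] by simp
  finally have "c * norm (w1 - w2) * norm (w1 - w2) \<le> norm (g1 - g2) * norm (w1 - w2)"
    using form_coercive[of "w1 - w2"] by (simp add: power2_eq_square mult.assoc)
  then show ?thesis by (cases "w1 = w2") auto
qed

lemma vi_solves_unique:
  assumes "vi_solves K g \<psi> w1" "vi_solves K g \<psi> w2"
  shows "w1 = w2"
  using vi_solves_lipschitz_source[OF assms] c_pos by (simp add: mult_le_0_iff)

text \<open>Lax-Milgram as the unconstrained case: over \<open>UNIV\<close> the test vectors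
  \<open>w - v\<close> and \<open>w + v\<close> are both allowed and turn the inequality into an
  equation.\<close>

lemma linear_equation: "\<exists>!w. A w = g"
proof -
  have *: "A w = g \<longleftrightarrow> vi_solves UNIV g 0 w" for w
  proof
    assume w: "vi_solves UNIV g 0 w"
    have "(A w - g) v \<le> 0" for v
      using w[unfolded vi_solves_def, THEN conjunct2, rule_format, of "w - v"] by simp
    from this this[of "- v" for v] have "(A w - g) v = 0" for v
      by (metis blinfun.minus_right neg_le_0_iff_le order_antisym)
    then show "A w = g" by (metis blinfun_eqI blinfun.zero_left eq_iff_diff_eq_0)
  qed (simp add: vi_solves_def)
  show ?thesis
    unfolding * using vi_solves_vi[of UNIV g 0] vi_solves_unique by auto
qed

lemma A_linear_solution: "A (linear_solution A g) = g"
  unfolding linear_solution_def using linear_equation by (rule theI')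

end

section \<open>Order and lattice structure of \<open>V\<close>\<close>

context qvi_setting
begin

definition le :: "'v \<Rightarrow> 'v \<Rightarrow> bool" (infix "\<preceq>" 50) where
  "v \<preceq> w \<longleftrightarrow> (AE x in \<xi>. rep v x \<le> rep w x)"

lemma rep_add: "AE x in \<xi>. rep (v + w) x = rep v x + rep w x"
  using rep_linear[of 1 v 1 w] by simp

lemma rep_diff: "AE x in \<xi>. rep (v - w) x = rep v x - rep w x"
  using rep_linear[of 1 v "-1" w] by simp

lemma rep_scale: "AE x in \<xi>. rep (a *\<^sub>R v) x = a * rep v x"
  using rep_linear[of a v 0 v] by simp

lemma rep_zero: "AE x in \<xi>. rep 0 x = 0"
  using rep_linear[of 0 0 0 0] by simp

lemma rep_minus: "AE x in \<xi>. rep (- v) x = - rep v x"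
  using rep_scale[of "-1" v] by simp

lemma rep_eqI: "(AE x in \<xi>. rep v x = rep w x) \<Longrightarrow> v = w"
proof -
  assume "AE x in \<xi>. rep v x = rep w x"
  then have "AE x in \<xi>. rep (v - w) x = 0" using rep_diff[of v w] by eventually_elim auto
  then show "v = w" using rep_inj[of "v - w"] by simp
qed

definition pos :: "'v \<Rightarrow> 'v" where
  "pos v = (SOME p. AE x in \<xi>. rep p x = max (rep v x) 0)"

text \<open>Only absolute values are assumed to stay in V; the positive part is half the sum of
  \<open>v\<close> and its absolute value.\<close>

lemma rep_pos: "AE x in \<xi>. rep (pos v) x = max (rep v x) 0"
proof -
  obtain w where w: "AE x in \<xi>. rep w x = \<bar>rep v x\<bar>" using abs_in_V by blast
  have "AE x in \<xi>. rep ((1/2) *\<^sub>R v + (1/2) *\<^sub>R w) x = max (rep v x) 0"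
    using w rep_linear[of "1/2" v "1/2" w] by eventually_elim (auto simp: max_def)
  then show ?thesis unfolding pos_def by (rule someI)
qed

lemma norm_pos: "norm (pos v) \<le> \<kappa> * norm v"
  using rep_pos by (rule pos_part_bound)

lemma le_refl [simp]: "v \<preceq> v"
  by (simp add: le_def)

lemma le_trans: "u \<preceq> v \<Longrightarrow> v \<preceq> w \<Longrightarrow> u \<preceq> w"
  unfolding le_def by (auto elim: eventually_elim2)

lemma le_iff_diff_le: "v \<preceq> w \<longleftrightarrow> v - w \<preceq> 0"
proof -
  have "AE x in \<xi>. rep v x \<le> rep w x \<longleftrightarrow> rep (v - w) x \<le> rep 0 x"
    using rep_diff[of v w] rep_zero by eventually_elim auto
  then show ?thesis unfolding le_def by (rule eventually_subst)
qed

lemma le_iff_diff_ge: "v \<preceq> w \<longleftrightarrow> 0 \<preceq> w - v"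
proof -
  have "AE x in \<xi>. rep v x \<le> rep w x \<longleftrightarrow> rep 0 x \<le> rep (w - v) x"
    using rep_diff[of w v] rep_zero by eventually_elim auto
  then show ?thesis unfolding le_def by (rule eventually_subst)
qed

lemma nonneg_iff: "0 \<preceq> v \<longleftrightarrow> v \<in> V_plus \<xi> rep"
proof -
  have "AE x in \<xi>. rep 0 x \<le> rep v x \<longleftrightarrow> 0 \<le> rep v x"
    using rep_zero by eventually_elim auto
  then show ?thesis unfolding le_def V_plus_def mem_Collect_eq by (rule eventually_subst)
qed

lemma nonneg_AE: "0 \<preceq> v \<longleftrightarrow> (AE x in \<xi>. 0 \<le> rep v x)"
  by (simp add: nonneg_iff V_plus_def)

lemma nonneg_add:
  assumes "0 \<preceq> v" "0 \<preceq> w"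
  shows "0 \<preceq> v + w"
  using assms rep_add[of v w] unfolding nonneg_AE by eventually_elim auto

lemma nonneg_scale:
  assumes "0 \<preceq> v" "0 \<le> a"
  shows "0 \<preceq> a *\<^sub>R v"
  using assms(1) rep_scale[of a v] unfolding nonneg_AE by eventually_elim (simp add: assms(2))

lemma le_add_mono: "u \<preceq> v \<Longrightarrow> w \<preceq> z \<Longrightarrow> u + w \<preceq> v + z"
  using nonneg_add[of "v - u" "z - w"] by (simp add: le_iff_diff_ge[of u] le_iff_diff_ge[of w]
      le_iff_diff_ge[of "u + w"] algebra_simps)

lemma le_scale_mono: "v \<preceq> w \<Longrightarrow> 0 \<le> a \<Longrightarrow> a *\<^sub>R v \<preceq> a *\<^sub>R w"
  using nonneg_scale[of "w - v" a] by (simp add: le_iff_diff_ge[of v] le_iff_diff_ge[of "a *\<^sub>R v"]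
      algebra_simps)

lemma neg_le_zero_iff: "- v \<preceq> 0 \<longleftrightarrow> 0 \<preceq> v"
  using le_iff_diff_le[of 0 v] by simp

lemma pos_nonneg: "0 \<preceq> pos v"
  unfolding nonneg_AE using rep_pos[of v] by eventually_elim auto

lemma le_pos: "v \<preceq> pos v"
  unfolding le_def using rep_pos[of v] by eventually_elim auto

lemma pos_leI:
  assumes "v \<preceq> w" "0 \<preceq> w"
  shows "pos v \<preceq> w"
  using assms(1)[unfolded le_def] assms(2)[unfolded nonneg_AE] rep_pos[of v]
  unfolding le_def by eventually_elim auto

lemma pos_minus_pos: "pos v - pos (- v) = v"
proof (rule rep_eqI)
  show "AE x in \<xi>. rep (pos v - pos (- v)) x = rep v x"
    using rep_pos[of v] rep_pos[of "- v"] rep_diff[of "pos v" "pos (- v)"] rep_minus[of v]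
    by eventually_elim (auto simp: max_def)
qed

definition vabs :: "'v \<Rightarrow> 'v" where
  "vabs v = pos v + pos (- v)"

lemma rep_vabs: "AE x in \<xi>. rep (vabs v) x = \<bar>rep v x\<bar>"
  unfolding vabs_def
  using rep_pos[of v] rep_pos[of "- v"] rep_add[of "pos v" "pos (- v)"] rep_minus[of v]
  by eventually_elim (auto simp: max_def)

lemma norm_vabs: "norm (vabs v) \<le> 2 * \<kappa> * norm v"
  unfolding vabs_def using norm_triangle_ineq[of "pos v" "pos (- v)"] norm_pos[of v] norm_pos[of "- v"]
  by simp

definition vmax :: "'v \<Rightarrow> 'v \<Rightarrow> 'v" where
  "vmax v w = w + pos (v - w)"

lemma vmax_ge1: "v \<preceq> vmax v w" and vmax_ge2: "w \<preceq> vmax v w"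
  unfolding vmax_def using le_add_mono[OF le_refl[of w] le_pos[of "v - w"]]
    le_add_mono[OF le_refl[of w] pos_nonneg[of "v - w"]] by simp_all

lemma vmax_leI: "v \<preceq> z \<Longrightarrow> w \<preceq> z \<Longrightarrow> vmax v w \<preceq> z"
  unfolding vmax_def using pos_leI[of "v - w" "z - w"]
    le_iff_diff_ge[of w z] le_iff_diff_le[of v z] le_iff_diff_le[of "v - w" "z - w"]
    le_iff_diff_le[of "pos (v - w)" "z - w"] le_iff_diff_le[of "w + pos (v - w)" z]
  by (simp add: algebra_simps)

section \<open>Comparison in L2 and closedness of the order cone\<close>

definition sq_int :: "'v \<Rightarrow> real" where
  "sq_int v = (\<integral>x. (rep v x)\<^sup>2 \<partial>\<xi>)"

lemma integrable_rep_sq: "integrable \<xi> (\<lambda>x. (rep v x)\<^sup>2)"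
  using rep_L2[of v] unfolding square_integrable_def by simp

lemma sq_int_nonneg: "0 \<le> sq_int v"
  unfolding sq_int_def by (rule integral_nonneg_AE) auto

lemma sq_int_mono: "(AE x in \<xi>. \<bar>rep v x\<bar> \<le> \<bar>rep w x\<bar>) \<Longrightarrow> sq_int v \<le> sq_int w"
  unfolding sq_int_def
  by (intro integral_mono_AE integrable_rep_sq) (auto elim!: eventually_mono simp: abs_le_square_iff)

lemma sq_int_bound: "\<exists>C\<ge>0. \<forall>v. sq_int v \<le> C * (norm v)\<^sup>2"
proof -
  obtain C where C: "\<And>v. sqrt (sq_int v) \<le> C * norm v"
    using rep_continuous unfolding sq_int_def by blast
  have "sq_int v \<le> C\<^sup>2 * (norm v)\<^sup>2" for v
    using power_mono[OF C[of v], of 2] sq_int_nonneg[of v] by (simp add: power_mult_distrib)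
  then show ?thesis by (intro exI[of _ "C\<^sup>2"]) auto
qed

lemma sq_int_eq_0: "sq_int v = 0 \<Longrightarrow> v = 0"
  unfolding sq_int_def
  by (rule rep_inj) (use integral_nonneg_eq_0_iff_AE[OF integrable_rep_sq] in auto)

lemma sq_int_add: "sq_int (v + w) \<le> 2 * sq_int v + 2 * sq_int w"
proof -
  have "sq_int (v + w) \<le> (\<integral>x. 2 * (rep v x)\<^sup>2 + 2 * (rep w x)\<^sup>2 \<partial>\<xi>)"
    unfolding sq_int_def
  proof (rule integral_mono_AE)
    show "AE x in \<xi>. (rep (v + w) x)\<^sup>2 \<le> 2 * (rep v x)\<^sup>2 + 2 * (rep w x)\<^sup>2"
      using rep_add[of v w]
    proof eventually_elim
      case (elim x)
      have "0 \<le> (rep v x - rep w x)\<^sup>2" by simp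
      then show ?case unfolding elim by (simp add: power2_eq_square algebra_simps)
    qed
  qed (intro integrable_rep_sq Bochner_Integration.integrable_add integrable_mult_right)+
  also have "\<dots> = 2 * sq_int v + 2 * sq_int w"
    unfolding sq_int_def by (simp add: integrable_rep_sq)
  finally show ?thesis .
qed

text \<open>The difference of the squares is non-negative and has integral zero. This strict
  monotonicity is what makes a maximiser of \<open>sq_int\<close> a fixed point later.\<close>

lemma sq_int_le_eq:
  assumes "0 \<preceq> v" "v \<preceq> w" "sq_int w \<le> sq_int v"
  shows "v = w"
proof -
  have "AE x in \<xi>. (rep w x)\<^sup>2 - (rep v x)\<^sup>2 \<ge> 0"
    using assms(1)[unfolded nonneg_AE] assms(2)[unfolded le_def]
    by eventually_elim (auto intro: power_mono)
  moreover have "(\<integral>x. (rep w x)\<^sup>2 - (rep v x)\<^sup>2 \<partial>\<xi>) = 0"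
  proof -
    have "(\<integral>x. (rep w x)\<^sup>2 - (rep v x)\<^sup>2 \<partial>\<xi>) = sq_int w - sq_int v"
      unfolding sq_int_def by (simp add: integrable_rep_sq)
    moreover have "0 \<le> (\<integral>x. (rep w x)\<^sup>2 - (rep v x)\<^sup>2 \<partial>\<xi>)"
      using calculation \<open>AE x in \<xi>. _\<close> by (intro integral_nonneg_AE) auto
    ultimately show ?thesis using assms(3) by linarith
  qed
  ultimately have "AE x in \<xi>. (rep w x)\<^sup>2 - (rep v x)\<^sup>2 = 0"
    using integral_nonneg_eq_0_iff_AE[of \<xi> "\<lambda>x. (rep w x)\<^sup>2 - (rep v x)\<^sup>2"]
      Bochner_Integration.integrable_diff[OF integrable_rep_sq integrable_rep_sq] by blast
  then have "AE x in \<xi>. rep v x = rep w x"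
    using assms(1)[unfolded nonneg_AE] assms(2)[unfolded le_def]
    by eventually_elim (auto simp: power2_eq_iff)
  then show ?thesis by (rule rep_eqI)
qed

text \<open>Pointwise domination gives no bound in the norm of V, but it does in L2, and the
  inclusion into L2 is injective.\<close>

lemma zero_by_squeeze:
  assumes "\<And>e. e > 0 \<Longrightarrow> \<exists>w. (AE x in \<xi>. \<bar>rep v x\<bar> \<le> \<bar>rep w x\<bar>) \<and> norm w < e"
  shows "v = 0"
proof -
  obtain C where C: "C \<ge> 0" "\<And>v. sq_int v \<le> C * (norm v)\<^sup>2" using sq_int_bound by blast
  have "sq_int v \<le> 0"
  proof (rule field_le_epsilon)
    fix e :: real assume "e > 0"
    define r where "r = sqrt (e / (C + 1))"
    have "r > 0" using \<open>e > 0\<close> C by (simp add: r_def)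
    then obtain w where w: "AE x in \<xi>. \<bar>rep v x\<bar> \<le> \<bar>rep w x\<bar>" "norm w < r" using assms by blast
    have "sq_int v \<le> C * (norm w)\<^sup>2" using sq_int_mono[OF w(1)] C(2)[of w] by linarith
    also have "\<dots> \<le> (C + 1) * r\<^sup>2" using w C by (intro mult_mono power_mono) auto
    also have "\<dots> = e" using \<open>e > 0\<close> C by (simp add: r_def)
    finally show "sq_int v \<le> 0 + e" by simp
  qed
  then show ?thesis using sq_int_nonneg[of v] by (intro sq_int_eq_0) auto
qed

text \<open>For non-negative \<open>v n\<close> the negative part of the limit is pointwise at most
  the absolute value of \<open>v n - l\<close>, so the squeeze in L2 applies without continuity of
  the positive part.\<close>

lemma closed_nonneg: "closed {v. 0 \<preceq> v}"
  unfolding closed_sequential_limits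
proof (intro allI impI)
  fix v l assume "(\<forall>n. v n \<in> {v. 0 \<preceq> v}) \<and> v \<longlonglongrightarrow> l"
  then have v: "\<And>n. 0 \<preceq> v n" "v \<longlonglongrightarrow> l" by auto
  have "pos (- l) = 0"
  proof (rule zero_by_squeeze)
    fix e :: real assume "e > 0"
    then obtain n where "norm (v n - l) < e"
      using v(2) unfolding LIMSEQ_iff by blast
    moreover have "AE x in \<xi>. \<bar>rep (pos (- l)) x\<bar> \<le> \<bar>rep (v n - l) x\<bar>"
      using v(1)[of n, unfolded nonneg_AE] rep_pos[of "- l"] rep_minus[of l]
        rep_diff[of "v n" l]
      by eventually_elim (auto simp: max_def)
    ultimately show "\<exists>w. (AE x in \<xi>. \<bar>rep (pos (- l)) x\<bar> \<le> \<bar>rep w x\<bar>) \<and> norm w < e" by blast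
  qed
  then have "- l \<preceq> 0" using le_pos[of "- l"] by simp
  then show "l \<in> {v. 0 \<preceq> v}" by (simp add: neg_le_zero_iff)
qed

lemma closed_ge: "closed {w. v \<preceq> w}"
proof -
  have "{w. v \<preceq> w} = (\<lambda>w. w - v) -` {w. 0 \<preceq> w}" by (auto simp: le_iff_diff_ge[of v])
  then show ?thesis using closed_vimage[OF closed_nonneg, of "\<lambda>w. w - v"]
    by (simp add: continuous_on_diff)
qed

lemma closed_le: "closed {w. w \<preceq> v}"
proof -
  have "{w. w \<preceq> v} = (\<lambda>w. v - w) -` {w. 0 \<preceq> w}" by (auto simp: le_iff_diff_ge[of _ v])
  then show ?thesis using closed_vimage[OF closed_nonneg, of "\<lambda>w. v - w"]
    by (simp add: continuous_on_diff)
qed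

lemma convex_comb_const: "0 \<le> a \<Longrightarrow> 0 \<le> b \<Longrightarrow> a + b = 1 \<Longrightarrow> (a::real) *\<^sub>R v + b *\<^sub>R v = (v::'v)"
  by (metis scaleR_left.add scaleR_one)

lemma convex_ge: "convex {w. v \<preceq> w}"
  unfolding convex_def using le_add_mono[OF le_scale_mono le_scale_mono]
  by (auto, metis convex_comb_const)

lemma convex_le: "convex {w. w \<preceq> v}"
  unfolding convex_def using le_add_mono[OF le_scale_mono le_scale_mono]
  by (auto, metis convex_comb_const)

lemma closure_hull_subset:
  fixes S :: "'v set"
  assumes "S \<subseteq> C" "convex C" "closed C"
  shows "closure (convex hull S) \<subseteq> C"
  using assms by (meson closure_minimal hull_minimal)

text \<open>Substitutes for weak sequential compactness: the intersection of the closed convex hulls of the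
  tails of a bounded sequence is non-empty, and its members inherit every closed convex property.\<close>

lemma exists_tail_hull_point:
  fixes v :: "nat \<Rightarrow> 'v"
  assumes "bounded (range v)"
  shows "\<exists>z. \<forall>n. z \<in> closure (convex hull (v ` {n..}))"
proof (rule Cantor_convex_intersection)
  show "closure (convex hull (v ` {Suc n..})) \<subseteq> closure (convex hull (v ` {n..}))" for n
    by (intro closure_mono hull_mono image_mono) auto
  show "bounded (closure (convex hull (v ` {0..})))"
    using assms by (intro bounded_closure bounded_convex_hull) (auto elim: bounded_subset)
qed auto

text \<open>A common point \<open>y\<close> of the closed hulls of the tails exists by boundedness
  in V. Domination by \<open>z n\<close> makes the sequence converge to \<open>l\<close> in L2,
  which identifies \<open>y\<close> with \<open>l\<close>.\<close>

lemma closure_hull_of_squeeze: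
  fixes v z :: "nat \<Rightarrow> 'v"
  assumes bdd: "bounded (range v)" and z: "z \<longlonglongrightarrow> 0"
    and le: "\<And>n. AE x in \<xi>. \<bar>rep (v n - l) x\<bar> \<le> \<bar>rep (z n) x\<bar>"
  shows "l \<in> closure (convex hull (range v))"
proof -
  obtain C where C: "C \<ge> 0" "\<And>v. sq_int v \<le> C * (norm v)\<^sup>2" using sq_int_bound by blast
  obtain y where y: "\<And>n. y \<in> closure (convex hull (v ` {n..}))"
    using exists_tail_hull_point[OF bdd] by blast
  have "sq_int (y - l) \<le> 0 + e" if "e > 0" for e
  proof -
    have "(\<lambda>n. C * (norm (z n))\<^sup>2) \<longlonglongrightarrow> C * (norm (0::'v))\<^sup>2"
      by (intro tendsto_intros z)
    then have "(\<lambda>n. C * (norm (z n))\<^sup>2) \<longlonglongrightarrow> 0" by simp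
    then have "\<forall>\<^sub>F n in sequentially. C * (norm (z n))\<^sup>2 < e / 4"
      using that by (intro order_tendstoD(2)) auto
    then obtain N where N: "\<And>n. n \<ge> N \<Longrightarrow> C * (norm (z n))\<^sup>2 < e / 4"
      unfolding eventually_sequentially by auto
    \<comment> \<open>A convex L2 ball containing a whole tail. The quarter is chosen because
      \<open>sq_int_add\<close> doubles each of the two errors below.\<close>
    define E where "E = {w. sq_int (w - l) \<le> e / 4}"
    have "v ` {N..} \<subseteq> E"
    proof
      fix w assume "w \<in> v ` {N..}"
      then obtain n where "n \<ge> N" "w = v n" by auto
      then show "w \<in> E" using sq_int_mono[OF le[of n]] C(2)[of "z n"] N[of n] by (auto simp: E_def)
    qed
    moreover have "convex E"
      unfolding convex_def
    proof (intro ballI allI impI)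
      fix w1 w2 a b assume w: "w1 \<in> E" "w2 \<in> E" and ab: "0 \<le> (a::real)" "0 \<le> b" "a + b = 1"
      let ?w = "a *\<^sub>R w1 + b *\<^sub>R w2"
      have "sq_int (?w - l) \<le> (\<integral>x. a * (rep (w1 - l) x)\<^sup>2 + b * (rep (w2 - l) x)\<^sup>2 \<partial>\<xi>)"
        unfolding sq_int_def
      proof (rule integral_mono_AE)
        show "AE x in \<xi>. (rep (?w - l) x)\<^sup>2 \<le> a * (rep (w1 - l) x)\<^sup>2 + b * (rep (w2 - l) x)\<^sup>2"
          using rep_diff[of ?w l] rep_linear[of a w1 b w2] rep_diff[of w1 l] rep_diff[of w2 l]
        proof eventually_elim
          case (elim x)
          let ?s = "rep w1 x - rep l x" and ?t = "rep w2 x - rep l x"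
          have b: "b = 1 - a" using ab by simp
          have "a * rep w1 x + b * rep w2 x - rep l x = a * ?s + b * ?t"
            unfolding b by (simp add: algebra_simps)
          moreover have "(a * ?s + b * ?t)\<^sup>2 + a * b * (?s - ?t)\<^sup>2 = a * ?s\<^sup>2 + b * ?t\<^sup>2"
            unfolding b by (simp add: algebra_simps power2_eq_square)
          moreover have "0 \<le> a * b * (?s - ?t)\<^sup>2" using ab by simp
          ultimately show ?case unfolding elim by (metis le_add_same_cancel1)
        qed
      qed (intro integrable_rep_sq Bochner_Integration.integrable_add integrable_mult_right)+
      also have "\<dots> = a * sq_int (w1 - l) + b * sq_int (w2 - l)"
        unfolding sq_int_def by (simp add: integrable_rep_sq)
      also have "\<dots> \<le> a * (e / 4) + b * (e / 4)"
        using w ab unfolding E_def by (intro add_mono mult_left_mono) auto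
      also have "\<dots> = e / 4" using ab by (metis distrib_right mult_1)
      finally show "?w \<in> E" by (simp add: E_def)
    qed
    ultimately have "convex hull (v ` {N..}) \<subseteq> E" by (rule hull_minimal)
    \<comment> \<open>The closure is taken in V, so \<open>y\<close> is replaced by a nearby
      \<open>w\<close> in \<open>E\<close> and the second error is
      \<open>sq_int (y - w)\<close>.\<close>
    then have "y \<in> closure E" using y[of N] closure_mono by blast
    moreover have "sqrt (e / (4 * (C + 1))) > 0" using that C by simp
    ultimately obtain w where w: "w \<in> E" "dist w y < sqrt (e / (4 * (C + 1)))"
      unfolding closure_approachable by blast
    have cancel: "D * (e / (4 * D)) = e / 4" if "D > 0" for D :: real using that by simp
    have "(norm (y - w))\<^sup>2 \<le> (sqrt (e / (4 * (C + 1))))\<^sup>2"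
      using w(2) by (intro power_mono) (auto simp: dist_norm norm_minus_commute)
    then have "C * (norm (y - w))\<^sup>2 \<le> (C + 1) * (e / (4 * (C + 1)))"
      using C that by (intro mult_mono) auto
    also have "\<dots> = e / 4" using C by (intro cancel) auto
    finally have "sq_int (y - w) \<le> e / 4" using C(2)[of "y - w"] by linarith
    moreover have "sq_int (w - l) \<le> e / 4" using w by (simp add: E_def)
    ultimately show ?thesis using sq_int_add[of "y - w" "w - l"] by simp
  qed
  then have "sq_int (y - l) \<le> 0" by (rule field_le_epsilon)
  then have "sq_int (y - l) = 0" using sq_int_nonneg[of "y - l"] by linarith
  then have "y = l" using sq_int_eq_0 by force
  then show ?thesis using y[of 0] by (simp add: atLeast_0)
qed

text \<open>Order half-spaces are closed and convex, so a common point of the closed tail hulls lies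
  above every term and below every upper bound.\<close>

lemma increasing_bounded_sup:
  fixes y :: "nat \<Rightarrow> 'v"
  assumes inc: "\<And>n. y n \<preceq> y (Suc n)" and bdd: "bounded (range y)"
  shows "\<exists>z. (\<forall>n. y n \<preceq> z) \<and> (\<forall>b. (\<forall>n. y n \<preceq> b) \<longrightarrow> z \<preceq> b)"
proof -
  have mono: "y n \<preceq> y m" if "n \<le> m" for n m
    using that by (induction rule: dec_induct) (auto intro: le_trans inc)
  obtain z where z: "\<And>n. z \<in> closure (convex hull (y ` {n..}))"
    using exists_tail_hull_point[OF bdd] by blast
  have "y n \<preceq> z" for n
    using closure_hull_subset[of "y ` {n..}" "{w. y n \<preceq> w}"] z[of n] convex_ge closed_ge mono by auto
  moreover have "z \<preceq> b" if "\<And>n. y n \<preceq> b" for b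
    using closure_hull_subset[of "y ` {0..}" "{w. w \<preceq> b}"] z[of 0] convex_le closed_le that by auto
  ultimately show ?thesis by blast
qed

end

section \<open>The obstacle problem\<close>

text \<open>\<open>C\<^sub>b\<close> may be negative if \<open>V\<close> is trivial.\<close>

sublocale qvi_setting \<subseteq> coercive_form A "C\<^sub>a" "max C\<^sub>b 0"
proof (rule coercive_form.intro)
  show "\<bar>A v w\<bar> \<le> max C\<^sub>b 0 * norm v * norm w" for v w
  proof -
    have "C\<^sub>b * (norm v * norm w) \<le> max C\<^sub>b 0 * (norm v * norm w)" by (intro mult_right_mono) auto
    then show ?thesis
      using A_bounded[of v w] A_bounded[of v "- w"] by (simp add: blinfun.minus_right mult.assoc abs_le_iff)
  qed
qed (rule A_linear A_coercive Ca_pos max.cobounded2)+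

context qvi_setting
begin

definition cone_neg :: "'v set" where
  "cone_neg = {v. v \<preceq> 0}"

lemma cone_neg_props: "closed cone_neg" "convex cone_neg" "cone_neg \<noteq> {}"
  unfolding cone_neg_def using closed_le convex_le by (auto intro: exI[of _ 0])

abbreviation obst :: "('v \<Rightarrow>\<^sub>L real) \<Rightarrow> 'v \<Rightarrow> 'v" where
  "obst \<equiv> vi cone_neg"

lemmas obst_solves = vi_solves_vi[OF cone_neg_props]

lemma dual_plusD: "g \<in> dual_plus \<xi> rep \<Longrightarrow> 0 \<preceq> v \<Longrightarrow> 0 \<le> g v"
  unfolding dual_plus_def nonneg_iff by auto

text \<open>A weak maximum principle: splitting \<open>v\<close> into its parts, the mixed term has
  a favourable sign by T-monotonicity, and coercivity annihilates the positive part.\<close>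

lemma le_zero_by_testing:
  assumes "A v (pos v) \<le> 0"
  shows "v \<preceq> 0"
proof -
  \<comment> \<open>T-monotonicity is used for \<open>- v\<close>, which exchanges the roles of
    positive and negative part.\<close>
  have "A (pos (- v)) (pos v) \<le> 0"
  proof (rule A_T_monotone)
    show "AE x in \<xi>. rep (pos (- v)) x = max (rep (- v) x) 0" by (rule rep_pos)
    show "AE x in \<xi>. rep (pos v) x = max (- rep (- v) x) 0"
      using rep_pos[of v] rep_minus[of v] by eventually_elim auto
  qed
  moreover have "A v (pos v) = A (pos v) (pos v) - A (pos (- v)) (pos v)"
    by (metis pos_minus_pos A_diff blinfun.diff_left)
  ultimately have "C\<^sub>a * (norm (pos v))\<^sup>2 \<le> 0" using assms form_coercive[of "pos v"] by linarith
  then have "pos v = 0" using Ca_pos by (simp add: mult_le_0_iff)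
  then show ?thesis using le_pos[of v] by simp
qed

text \<open>The competitors are the minimum of the two solutions in the lower problem and their
  maximum in the upper one; the maximum is admissible because the obstacles are ordered.\<close>

lemma obst_comparison:
  assumes w1: "vi_solves cone_neg g1 \<psi>1 w1" and w2: "vi_solves cone_neg g2 \<psi>2 w2"
    and \<psi>: "\<psi>1 \<preceq> \<psi>2" and g: "g2 - g1 \<in> dual_plus \<xi> rep"
  shows "w1 \<preceq> w2"
proof -
  define p where "p = pos (w1 - w2)"
  have "w1 - \<psi>1 \<preceq> 0" "w2 - \<psi>2 \<preceq> 0" using w1 w2 by (auto simp: vi_solves_def cone_neg_def)
  then have w: "w1 \<preceq> \<psi>1" "w2 \<preceq> \<psi>2" by (auto simp: le_iff_diff_le[symmetric])
  have "w1 - \<psi>1 + - p \<preceq> 0 + 0"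
    by (intro le_add_mono) (auto simp: p_def neg_le_zero_iff pos_nonneg \<open>w1 - \<psi>1 \<preceq> 0\<close>)
  then have "(A w1 - g1) (w1 - \<psi>1 - (w1 - \<psi>1 + - p)) \<le> 0"
    using w1 unfolding vi_solves_def cone_neg_def by auto
  then have 1: "(A w1 - g1) p \<le> 0" by simp
  have "vmax w1 w2 \<preceq> \<psi>2" using w \<psi> by (intro vmax_leI) (auto intro: le_trans)
  then have "w2 - \<psi>2 + p \<preceq> 0"
    using le_iff_diff_le[of "vmax w1 w2" \<psi>2] by (simp add: vmax_def p_def algebra_simps)
  then have "(A w2 - g2) (w2 - \<psi>2 - (w2 - \<psi>2 + p)) \<le> 0"
    using w2 unfolding vi_solves_def cone_neg_def by auto
  then have 2: "(A w2 - g2) p \<ge> 0" by (simp add: blinfun.minus_right)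
  have "0 \<le> (g2 - g1) p" using dual_plusD[OF g] pos_nonneg by (simp add: p_def)
  then have "A (w1 - w2) p \<le> 0" using 1 2 by (simp add: form_simps)
  then have "w1 - w2 \<preceq> 0" unfolding p_def by (rule le_zero_by_testing)
  then show ?thesis by (simp add: le_iff_diff_le[symmetric])
qed

text \<open>Lowering a function never violates an upper obstacle, so the excess over the
  unconstrained solution is an admissible test direction.\<close>

lemma obst_le_linear_solution:
  assumes w: "vi_solves cone_neg g \<psi> w"
  shows "w \<preceq> linear_solution A g"
proof -
  define z where "z = linear_solution A g"
  define p where "p = pos (w - z)"
  have "w - \<psi> + - p \<preceq> 0 + 0"
    using w by (intro le_add_mono) (auto simp: p_def neg_le_zero_iff pos_nonneg vi_solves_def cone_neg_def)
  then have "(A w - g) (w - \<psi> - (w - \<psi> + - p)) \<le> 0"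
    using w unfolding vi_solves_def cone_neg_def by auto
  then have "A (w - z) p \<le> 0" using A_linear_solution[of g] by (simp add: form_simps z_def)
  then have "w - z \<preceq> 0" unfolding p_def by (rule le_zero_by_testing)
  then show ?thesis by (simp add: le_iff_diff_le[symmetric] z_def)
qed

lemma QVI_iff: "w \<in> QVI \<xi> rep A \<Phi> g \<longleftrightarrow> vi_solves cone_neg g (\<Phi> (rep w)) w"
proof -
  have cs: "v \<in> constraint_set \<xi> rep \<Phi> (rep w) \<longleftrightarrow> v - \<Phi> (rep w) \<in> cone_neg" for v
    unfolding constraint_set_def cone_neg_def mem_Collect_eq le_def[symmetric]
    by (rule le_iff_diff_le)
  have "(\<forall>v. v - \<psi> \<in> cone_neg \<longrightarrow> (A w - g) (w - v) \<le> 0) \<longleftrightarrow>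
        (\<forall>k. k \<in> cone_neg \<longrightarrow> (A w - g) (w - \<psi> - k) \<le> 0)" (is "?L \<longleftrightarrow> ?R") for \<psi>
  proof (intro iffI allI impI)
    fix k assume ?L "k \<in> cone_neg"
    then show "(A w - g) (w - \<psi> - k) \<le> 0" using spec[of _ "\<psi> + k"] by (auto simp: algebra_simps)
  next
    fix v assume R: ?R "v - \<psi> \<in> cone_neg"
    have "w - v = w - \<psi> - (v - \<psi>)" by simp
    then show "(A w - g) (w - v) \<le> 0" using R by metis
  qed
  then show ?thesis unfolding QVI_def vi_solves_def mem_Collect_eq Ball_def cs by blast
qed

lemma Phi_le_mono: "v \<preceq> w \<Longrightarrow> \<Phi> (rep v) \<preceq> \<Phi> (rep w)"
  unfolding le_def by (rule Phi_mono[OF rep_L2 rep_L2])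

lemma Phi_nonneg:
  assumes "0 \<preceq> v"
  shows "0 \<preceq> \<Phi> (rep v)"
proof -
  have "square_integrable \<xi> (\<lambda>_. 0 :: real)" by (simp add: square_integrable_def)
  then have "AE x in \<xi>. rep (\<Phi> (rep v)) x \<ge> rep (\<Phi> (\<lambda>_. 0)) x"
    using assms[unfolded nonneg_iff V_plus_def] by (intro Phi_mono[OF rep_L2]) auto
  then show ?thesis using Phi_zero unfolding nonneg_AE
    by eventually_elim auto
qed

section \<open>Solutions as fixed points of an increasing map\<close>

abbreviation qvi_map :: "('v \<Rightarrow>\<^sub>L real) \<Rightarrow> 'v \<Rightarrow> 'v" where
  "qvi_map g w \<equiv> obst g (\<Phi> (rep w))"

lemma QVI_iff_fixed_point: "w \<in> QVI \<xi> rep A \<Phi> g \<longleftrightarrow> qvi_map g w = w"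
  unfolding QVI_iff using obst_solves vi_solves_unique by metis

lemma zero_dual_plus: "0 \<in> dual_plus \<xi> rep"
  by (simp add: dual_plus_def)

lemma qvi_map_mono:
  assumes "v \<preceq> w" "h - g \<in> dual_plus \<xi> rep"
  shows "qvi_map g v \<preceq> qvi_map h w"
  by (rule obst_comparison[OF obst_solves obst_solves Phi_le_mono[OF assms(1)] assms(2)])

text \<open>A non-negative obstacle admits the competitor 0, which is the cone element minus the
  obstacle. The bound does not depend on \<open>w\<close>, and this keeps the monotone iteration
  bounded.\<close>

lemma norm_qvi_map_le:
  assumes "0 \<preceq> w"
  shows "norm (qvi_map g w) \<le> norm g / C\<^sub>a"
proof -
  let ?z = "qvi_map g w" and ?\<psi> = "\<Phi> (rep w)"
  have "- ?\<psi> \<in> cone_neg" using Phi_nonneg[OF assms] by (simp add: cone_neg_def neg_le_zero_iff)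
  then have "(A ?z - g) (?z - ?\<psi> - - ?\<psi>) \<le> 0"
    using obst_solves[of g ?\<psi>] unfolding vi_solves_def by blast
  then have "C\<^sub>a * (norm ?z)\<^sup>2 \<le> norm g * norm ?z"
    using form_coercive[of ?z] norm_blinfun[of g ?z] by (simp add: form_simps)
  then have "C\<^sub>a * norm ?z \<le> norm g" by (cases "?z = 0") (auto simp: power2_eq_square)
  then show ?thesis using Ca_pos by (simp add: field_simps)
qed

text \<open>The Birkhoff--Tartar theorem: a maximiser of the \<open>L\<^sup>2\<close> norm among the subsolutions between
  \<open>u\<close> and the solution without obstacle is a solution.\<close>

lemma exists_QVI_above:
  assumes u: "u \<in> QVI \<xi> rep A \<Phi> f" and u0: "0 \<preceq> u" and g: "g - f \<in> dual_plus \<xi> rep"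
  shows "\<exists>q\<in>QVI \<xi> rep A \<Phi> g. u \<preceq> q"
proof -
  define T where "T = qvi_map g"
  define E where "E = {w. u \<preceq> w \<and> w \<preceq> T w}"
  define b where "b = linear_solution A g"
  have Tb: "T w \<preceq> b" for w
    unfolding T_def b_def by (rule obst_le_linear_solution[OF obst_solves])
  have T_mono: "T v \<preceq> T w" if "v \<preceq> w" for v w
    unfolding T_def using that zero_dual_plus by (intro qvi_map_mono) auto
  have uE: "u \<in> E"
    using qvi_map_mono[OF le_refl g, of u] u by (simp add: E_def T_def QVI_iff_fixed_point)
  have TE: "T w \<in> E" if "w \<in> E" for w
    using that T_mono unfolding E_def by (auto intro: le_trans)
  have maxE: "vmax v w \<in> E" if "v \<in> E" "w \<in> E" for v w
  proof -
    have "vmax v w \<preceq> T (vmax v w)"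
      using that T_mono[OF vmax_ge1[of v w]] T_mono[OF vmax_ge2[of w v]] unfolding E_def
      by (intro vmax_leI) (auto intro: le_trans)
    then show ?thesis using that vmax_ge1[of v w] unfolding E_def by (auto intro: le_trans)
  qed
  have nonneg: "0 \<preceq> w" if "w \<in> E" for w using that u0 unfolding E_def by (auto intro: le_trans)
  have sq_mono: "sq_int v \<le> sq_int w" if "0 \<preceq> v" "v \<preceq> w" for v w
  proof (rule sq_int_mono)
    show "AE x in \<xi>. \<bar>rep v x\<bar> \<le> \<bar>rep w x\<bar>"
      using that(1)[unfolded nonneg_AE] that(2)[unfolded le_def]
      by eventually_elim auto
  qed
  have le_b: "sq_int w \<le> sq_int b" if "w \<in> E" for w
    using that nonneg[OF that] Tb[of w] unfolding E_def by (intro sq_mono) (auto intro: le_trans)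
  then have bdd: "bdd_above (sq_int ` E)" by (intro bdd_aboveI2)
  define s where "s = Sup (sq_int ` E)"
  have "\<exists>w\<in>E. s - 1 / real (Suc n) < sq_int w" for n
    using less_cSup_iff[of "sq_int ` E" "s - 1 / real (Suc n)"] bdd uE by (auto simp: s_def)
  then obtain w where w: "\<And>n. w n \<in> E" "\<And>n. s - 1 / real (Suc n) < sq_int (w n)" by metis
  \<comment> \<open>Joining with \<open>w (Suc n)\<close> makes the sequence overtake every
    near-maximiser; applying \<open>T\<close> afterwards brings each term under the uniform norm
    bound.\<close>
  define y where "y = rec_nat (T (w 0)) (\<lambda>n z. T (vmax z (w (Suc n))))"
  have y0: "y 0 = T (w 0)" and ySuc: "y (Suc n) = T (vmax (y n) (w (Suc n)))" for n
    by (simp_all add: y_def)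
  have yE: "y n \<in> E" for n by (induction n) (simp_all add: y0 ySuc TE maxE w)
  have wT: "v \<preceq> T v" if "v \<in> E" for v using that by (simp add: E_def)
  have yinc: "y n \<preceq> y (Suc n)" for n
    unfolding ySuc using wT[OF maxE[OF yE w(1)]] vmax_ge1 by (blast intro: le_trans)
  have wy: "w n \<preceq> y n" for n
  proof (cases n)
    case (Suc m)
    then show ?thesis using wT[OF maxE[OF yE w(1), of m "Suc m"]] vmax_ge2 by (auto simp: ySuc intro: le_trans)
  qed (simp add: y0 wT w)
  have "norm (y n) \<le> norm g / C\<^sub>a" for n
  proof (cases n)
    case (Suc m)
    then show ?thesis using norm_qvi_map_le[OF nonneg[OF maxE[OF yE w(1)]]] by (simp add: ySuc T_def)
  qed (use norm_qvi_map_le[OF nonneg[OF w(1)]] in \<open>simp add: y0 T_def\<close>)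
  then have "bounded (range y)" unfolding bounded_iff by blast
  then obtain z where z: "\<And>n. y n \<preceq> z" "\<And>b. (\<And>n. y n \<preceq> b) \<Longrightarrow> z \<preceq> b"
    using increasing_bounded_sup[of y, OF yinc] by blast
  \<comment> \<open>Every \<open>y n\<close> lies below \<open>T (y n)\<close>, hence below
    \<open>T z\<close>, and \<open>z\<close> is the least upper bound: monotonicity alone passes to
    the limit.\<close>
  have "z \<preceq> T z" using z(1) T_mono wT[OF yE] by (intro z(2)) (blast intro: le_trans)
  moreover have "u \<preceq> z" using yE[of 0] z(1)[of 0] by (auto simp: E_def intro: le_trans)
  ultimately have zE: "z \<in> E" by (simp add: E_def)
  have "s \<le> sq_int z"
  proof (rule LIMSEQ_le_const2)
    have "(\<lambda>n. s - 1 / real (Suc n)) \<longlonglongrightarrow> s - 0"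
      by (intro tendsto_intros LIMSEQ_Suc[OF lim_1_over_n])
    then show "(\<lambda>n. s - 1 / real (Suc n)) \<longlonglongrightarrow> s" by simp
    have "s - 1 / real (Suc n) \<le> sq_int z" for n
      using w(2)[of n] sq_mono[OF nonneg[OF w(1)] le_trans[OF wy z(1)], of n] by linarith
    then show "\<exists>N. \<forall>n\<ge>N. s - 1 / real (Suc n) \<le> sq_int z" by blast
  qed
  \<comment> \<open>As \<open>z\<close> lies below \<open>T z\<close>, which is itself a member of
    \<open>E\<close>, maximality leaves no room for strict inequality.\<close>
  moreover have "sq_int (T z) \<le> s" unfolding s_def using TE[OF zE] bdd by (intro cSup_upper) auto
  ultimately have "z = T z" using zE nonneg[OF zE] by (intro sq_int_le_eq wT) auto
  then have "z \<in> QVI \<xi> rep A \<Phi> g" by (simp add: QVI_iff_fixed_point T_def)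
  then show ?thesis using \<open>u \<preceq> z\<close> by blast
qed

end

section \<open>Capacity\<close>

context qvi_setting
begin

text \<open>Smallness is measured by the norm, not its square, and with non-negative potentials, so
  that potentials can be added and the bounds add up over unions. Up to the factor \<kappa> this is
  smallness of the square root of the capacity.\<close>

definition cap_small :: "'x set \<Rightarrow> real \<Rightarrow> bool" where
  "cap_small E e \<longleftrightarrow> (\<exists>U v. openin (top_of_set X) U \<and> E \<subseteq> U \<and>
     (AE x in \<xi>. x \<in> U \<longrightarrow> 1 \<le> rep v x) \<and> 0 \<preceq> v \<and> norm v < e)"

definition cap_null :: "'x set \<Rightarrow> bool" where
  "cap_null E \<longleftrightarrow> capacity X \<xi> rep E = 0"

abbreviation quasi :: "('x \<Rightarrow> real) \<Rightarrow> bool" where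
  "quasi \<equiv> quasi_continuous X \<xi> rep"

lemma cap_smallI:
  assumes "openin (top_of_set X) U" "E \<subseteq> U" "AE x in \<xi>. x \<in> U \<longrightarrow> 1 \<le> rep v x" "0 \<preceq> v" "norm v < e"
  shows "cap_small E e"
  unfolding cap_small_def by (intro exI conjI) (fact assms)+

lemma cap_small_mono:
  assumes "cap_small F e" "E \<subseteq> F" "e \<le> e'"
  shows "cap_small E e'"
proof -
  obtain U v where v: "openin (top_of_set X) U" "F \<subseteq> U" "AE x in \<xi>. x \<in> U \<longrightarrow> 1 \<le> rep v x" "0 \<preceq> v" "norm v < e"
    using assms(1) unfolding cap_small_def by blast
  moreover have "E \<subseteq> U" "norm v < e'" using v assms by auto
  ultimately show ?thesis by (intro cap_smallI)
qed

text \<open>The factor \<kappa> pays for passing from an admissible function to its positive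
  part.\<close>

lemma capacity_less_imp_cap_small:
  assumes "capacity X \<xi> rep E < ennreal ((e / \<kappa>)\<^sup>2)" "e > 0"
  shows "cap_small E e"
proof -
  obtain v U where v: "openin (top_of_set X) U" "E \<subseteq> U" "AE x in \<xi>. x \<in> U \<longrightarrow> 1 \<le> rep v x"
    "ennreal ((norm v)\<^sup>2) < ennreal ((e / \<kappa>)\<^sup>2)"
    using assms(1) unfolding capacity_def INF_less_iff by auto
  then have "(norm v)\<^sup>2 < (e / \<kappa>)\<^sup>2" by (simp add: ennreal_less_iff)
  then have "norm v < e / \<kappa>"
    by (rule power_less_imp_less_base) (use assms(2) kappa_pos in auto)
  then have "norm (pos v) < e" using norm_pos[of v] kappa_pos by (simp add: field_simps)
  moreover have "AE x in \<xi>. x \<in> U \<longrightarrow> 1 \<le> rep (pos v) x"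
    using v(3) rep_pos[of v] by eventually_elim auto
  ultimately show ?thesis using v pos_nonneg by (intro cap_smallI)
qed

lemma cap_small_imp_capacity_less:
  assumes "cap_small E e"
  shows "capacity X \<xi> rep E < ennreal (e\<^sup>2)"
proof -
  obtain U v where v: "openin (top_of_set X) U" "E \<subseteq> U" "AE x in \<xi>. x \<in> U \<longrightarrow> 1 \<le> rep v x" "norm v < e"
    using assms unfolding cap_small_def by blast
  have "(norm v)\<^sup>2 < e\<^sup>2" using v(4) by (intro power_strict_mono) auto
  then have "ennreal ((norm v)\<^sup>2) < ennreal (e\<^sup>2)" by (simp add: ennreal_less_iff)
  then show ?thesis unfolding capacity_def INF_less_iff using v by blast
qed

lemma cap_null_iff: "cap_null E \<longleftrightarrow> (\<forall>e>0. cap_small E e)"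
proof
  assume "cap_null E"
  then have "capacity X \<xi> rep E < ennreal ((e / \<kappa>)\<^sup>2)" if "e > 0" for e
    using that kappa_pos by (simp add: cap_null_def)
  then show "\<forall>e>0. cap_small E e" using capacity_less_imp_cap_small by blast
next
  assume *: "\<forall>e>0. cap_small E e"
  have "capacity X \<xi> rep E \<le> 0"
  proof (rule ennreal_le_epsilon)
    fix e :: real assume "e > 0"
    then have "cap_small E (sqrt e)" using * real_sqrt_gt_zero by blast
    from cap_small_imp_capacity_less[OF this] show "capacity X \<xi> rep E \<le> 0 + ennreal e"
      using \<open>e > 0\<close> by simp
  qed
  then show "cap_null E" by (simp add: cap_null_def)
qed

lemma cap_null_mono: "cap_null F \<Longrightarrow> E \<subseteq> F \<Longrightarrow> cap_null E"
  unfolding cap_null_iff using cap_small_mono[of F _ E] by blast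

lemma quasi_iff:
  "quasi g \<longleftrightarrow> (\<forall>e>0. \<exists>G. openin (top_of_set X) G \<and> cap_small G e \<and> continuous_on (X - G) g)"
proof
  assume g: "quasi g"
  show "\<forall>e>0. \<exists>G. openin (top_of_set X) G \<and> cap_small G e \<and> continuous_on (X - G) g"
  proof (intro allI impI)
    fix e :: real assume "e > 0"
    then have "(e / \<kappa>)\<^sup>2 > 0" using kappa_pos by simp
    then obtain G where "openin (top_of_set X) G" "capacity X \<xi> rep G < ennreal ((e / \<kappa>)\<^sup>2)"
      "continuous_on (X - G) g"
      using g unfolding quasi_continuous_def by blast
    then show "\<exists>G. openin (top_of_set X) G \<and> cap_small G e \<and> continuous_on (X - G) g"
      using capacity_less_imp_cap_small[OF _ \<open>e > 0\<close>] by blast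
  qed
next
  assume g: "\<forall>e>0. \<exists>G. openin (top_of_set X) G \<and> cap_small G e \<and> continuous_on (X - G) g"
  show "quasi g"
    unfolding quasi_continuous_def
  proof (intro allI impI)
    fix e :: real assume "e > 0"
    then obtain G where "openin (top_of_set X) G" "cap_small G (sqrt e)" "continuous_on (X - G) g"
      using g real_sqrt_gt_zero by blast
    moreover have "capacity X \<xi> rep G < ennreal e"
      using cap_small_imp_capacity_less[OF \<open>cap_small G (sqrt e)\<close>] \<open>e > 0\<close> by simp
    ultimately show "\<exists>G. openin (top_of_set X) G \<and> capacity X \<xi> rep G < ennreal e \<and> continuous_on (X - G) g"
      by blast
  qed
qed

text \<open>The sum of the potentials converges absolutely in V. It dominates each summand because
  the partial sums eventually do and order half-spaces are closed.\<close>

lemma cap_small_UN: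
  assumes E: "\<And>n. cap_small (E n) (e n)" and "summable e" "suminf e < r"
  shows "cap_small (\<Union>n::nat. E n) r"
proof -
  have "\<forall>n. \<exists>U v. openin (top_of_set X) U \<and> E n \<subseteq> U \<and>
     (AE x in \<xi>. x \<in> U \<longrightarrow> 1 \<le> rep v x) \<and> 0 \<preceq> v \<and> norm v < e n"
    using E unfolding cap_small_def by blast
  from choice[OF this] obtain U where "\<forall>n. \<exists>v. openin (top_of_set X) (U n) \<and> E n \<subseteq> U n \<and>
     (AE x in \<xi>. x \<in> U n \<longrightarrow> 1 \<le> rep v x) \<and> 0 \<preceq> v \<and> norm v < e n" by blast
  from choice[OF this] obtain v where U: "\<And>n. openin (top_of_set X) (U n)" "\<And>n. E n \<subseteq> U n"
    and v: "\<And>n. AE x in \<xi>. x \<in> U n \<longrightarrow> 1 \<le> rep (v n) x" "\<And>n. 0 \<preceq> v n" "\<And>n. norm (v n) < e n"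
    by blast
  have sn: "summable (\<lambda>n. norm (v n))"
    by (rule summable_comparison_test'[OF \<open>summable e\<close>, of 0]) (use v(3) less_imp_le in auto)
  have sums: "(\<lambda>m. \<Sum>n<m. v n) \<longlonglongrightarrow> suminf v"
    using summable_norm_cancel[OF sn] by (rule summable_LIMSEQ)
  have nonneg: "0 \<preceq> (\<Sum>n\<in>F. v n)" for F :: "nat set"
    by (induction F rule: infinite_finite_induct) (auto intro: nonneg_add v)
  have ge: "v n \<preceq> suminf v" for n
  proof -
    have partial: "v n \<preceq> (\<Sum>i<m. v i)" if "m \<ge> Suc n" for m
    proof -
      have "(\<Sum>i<m. v i) = v n + (\<Sum>i\<in>{..<m} - {n}. v i)"
        using that by (subst sum.remove[of _ n]) auto
      then show ?thesis using le_add_mono[OF le_refl[of "v n"] nonneg[of "{..<m} - {n}"]] by simp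
    qed
    have "(\<Sum>i<m + Suc n. v i) \<in> {w. v n \<preceq> w}" for m using partial[of "m + Suc n"] by simp
    then have "suminf v \<in> {w. v n \<preceq> w}"
      using LIMSEQ_ignore_initial_segment[OF sums, of "Suc n"] by (rule closed_sequentially[OF closed_ge])
    then show ?thesis by simp
  qed
  show ?thesis
  proof (rule cap_smallI)
    show "openin (top_of_set X) (\<Union>n. U n)" using U by blast
    show "(\<Union>n. E n) \<subseteq> (\<Union>n. U n)" using U by blast
    have "AE x in \<xi>. \<forall>n. x \<in> U n \<longrightarrow> 1 \<le> rep (v n) x" "AE x in \<xi>. \<forall>n. rep (v n) x \<le> rep (suminf v) x"
      using v(1) ge unfolding le_def by (simp_all add: AE_all_countable)
    then show "AE x in \<xi>. x \<in> (\<Union>n. U n) \<longrightarrow> 1 \<le> rep (suminf v) x"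
      by eventually_elim (auto intro: order_trans)
    show "0 \<preceq> suminf v" using v(2)[of 0] ge[of 0] by (rule le_trans)
    have "norm (suminf v) \<le> (\<Sum>n. norm (v n))" using sn by (rule summable_norm)
    also have "\<dots> \<le> suminf e" using v(3) sn \<open>summable e\<close> by (intro suminf_le less_imp_le)
    finally show "norm (suminf v) < r" using assms(3) by simp
  qed
qed

lemma cap_null_UN:
  assumes "\<And>n. cap_null (E n)"
  shows "cap_null (\<Union>n::nat. E n)"
  unfolding cap_null_iff
proof (intro allI impI)
  fix e :: real assume "e > 0"
  show "cap_small (\<Union>n. E n) e"
  proof (rule cap_small_UN)
    show "cap_small (E n) (e / 4 * (1/2) ^ n)" for n
      using assms[of n] \<open>e > 0\<close> unfolding cap_null_iff by simp
    show "summable (\<lambda>n. e / 4 * (1/2) ^ n)" by (intro summable_mult summable_geometric) auto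
    show "(\<Sum>n. e / 4 * (1/2) ^ n) < e"
      using \<open>e > 0\<close> by (subst suminf_mult) (auto simp: suminf_geometric)
  qed
qed

lemma cap_small_Un:
  assumes "cap_small E e" "cap_small F d"
  shows "cap_small (E \<union> F) (e + d)"
proof -
  obtain U v where U: "openin (top_of_set X) U" "E \<subseteq> U" "AE x in \<xi>. x \<in> U \<longrightarrow> 1 \<le> rep v x" "0 \<preceq> v" "norm v < e"
    using assms(1) unfolding cap_small_def by blast
  obtain W w where W: "openin (top_of_set X) W" "F \<subseteq> W" "AE x in \<xi>. x \<in> W \<longrightarrow> 1 \<le> rep w x" "0 \<preceq> w" "norm w < d"
    using assms(2) unfolding cap_small_def by blast
  show ?thesis
  proof (rule cap_smallI)
    show "openin (top_of_set X) (U \<union> W)" "E \<union> F \<subseteq> U \<union> W" using U W by auto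
    show "AE x in \<xi>. x \<in> U \<union> W \<longrightarrow> 1 \<le> rep (v + w) x"
      using U(3) W(3) U(4)[unfolded nonneg_AE]
        W(4)[unfolded nonneg_AE] rep_add[of v w]
      by eventually_elim auto
    show "0 \<preceq> v + w" using U W by (intro nonneg_add)
    show "norm (v + w) < e + d" using U W norm_triangle_ineq[of v w] by linarith
  qed
qed

lemma cap_null_Un: "cap_null E \<Longrightarrow> cap_null F \<Longrightarrow> cap_null (E \<union> F)"
  unfolding cap_null_iff
proof (intro allI impI)
  fix e :: real assume "\<forall>e>0. cap_small E e" "\<forall>e>0. cap_small F e" "e > 0"
  then show "cap_small (E \<union> F) e" using cap_small_Un[of E "e/2" F "e/2"] by simp
qed

section \<open>Quasi-continuous functions\<close>

lemma quasi_combine: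
  assumes f: "quasi f" and g: "quasi g"
    and h: "\<And>S. continuous_on S f \<Longrightarrow> continuous_on S g \<Longrightarrow> continuous_on S h"
  shows "quasi h"
  unfolding quasi_iff
proof (intro allI impI)
  fix e :: real assume "e > 0"
  then obtain G where G: "openin (top_of_set X) G" "cap_small G (e/2)" "continuous_on (X - G) f"
    using f[unfolded quasi_iff, rule_format, of "e/2"] by auto
  obtain H where H: "openin (top_of_set X) H" "cap_small H (e/2)" "continuous_on (X - H) g"
    using g[unfolded quasi_iff, rule_format, of "e/2"] \<open>e > 0\<close> by auto
  have "continuous_on (X - (G \<union> H)) h"
    using G(3) H(3) by (intro h) (auto elim: continuous_on_subset)
  then show "\<exists>G. openin (top_of_set X) G \<and> cap_small G e \<and> continuous_on (X - G) h"
    using G H cap_small_Un[OF G(2) H(2)] by (intro exI[of _ "G \<union> H"]) auto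
qed

lemma quasi_max_zero: "quasi g \<Longrightarrow> quasi (\<lambda>x. max (g x) 0)"
  by (rule quasi_combine[of g g]) (auto intro: continuous_intros)

lemma quasi_diff_scaled: "quasi f \<Longrightarrow> quasi g \<Longrightarrow> quasi (\<lambda>x. f x - a * g x)"
  by (rule quasi_combine[of f g]) (assumption | intro continuous_intros)+

lemma quasi_diff: "quasi f \<Longrightarrow> quasi g \<Longrightarrow> quasi (\<lambda>x. f x - g x)"
  using quasi_diff_scaled[of f g 1] by simp

text \<open>Off \<open>G\<close> the superlevel set is relatively open, and adding the open set
  \<open>G\<close> makes it open in X, as potentials require.\<close>

lemma quasi_superlevel:
  assumes "quasi g" "e > 0"
  obtains G w where "openin (top_of_set X) (G \<union> {x\<in>X. s < g x})" "AE x in \<xi>. x \<in> G \<longrightarrow> 1 \<le> rep w x"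
    "0 \<preceq> w" "norm w < e"
proof -
  obtain G where G: "openin (top_of_set X) G" "cap_small G e" "continuous_on (X - G) g"
    using assms unfolding quasi_iff by blast
  obtain U w where w: "G \<subseteq> U" "AE x in \<xi>. x \<in> U \<longrightarrow> 1 \<le> rep w x" "0 \<preceq> w" "norm w < e"
    using G(2) unfolding cap_small_def by blast
  have "openin (top_of_set (X - G)) ((X - G) \<inter> g -` {s<..})"
    using G(3) by (rule continuous_openin_preimage_gen) auto
  then obtain T where T: "open T" "(X - G) \<inter> g -` {s<..} = (X - G) \<inter> T"
    unfolding openin_open by blast
  have "G \<union> {x\<in>X. s < g x} = G \<union> (X \<inter> T)" using T(2) by blast
  then have "openin (top_of_set X) (G \<union> {x\<in>X. s < g x})"
    using openin_Un[OF G(1) openin_open_Int[OF T(1)]] by simp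
  moreover have "AE x in \<xi>. x \<in> G \<longrightarrow> 1 \<le> rep w x" using w(2) by eventually_elim (use w(1) in auto)
  ultimately show ?thesis using w(3,4) by (rule that)
qed

text \<open>Admissibility of a potential is tested almost everywhere on an open set. Up to a null
  set, the open superlevel set is just \<open>G\<close>, so the potential of \<open>G\<close>
  already serves.\<close>

lemma quasi_le_zero:
  assumes "quasi g" "AE x in \<xi>. g x \<le> 0"
  shows "cap_null {x\<in>X. 0 < g x}"
  unfolding cap_null_iff
proof (intro allI impI)
  fix e :: real assume "e > 0"
  with assms(1) obtain G w where w: "openin (top_of_set X) (G \<union> {x\<in>X. 0 < g x})"
    "AE x in \<xi>. x \<in> G \<longrightarrow> 1 \<le> rep w x" "0 \<preceq> w" "norm w < e"
    by (rule quasi_superlevel)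
  have "AE x in \<xi>. x \<in> G \<union> {x\<in>X. 0 < g x} \<longrightarrow> 1 \<le> rep w x"
    using w(2) assms(2) by eventually_elim auto
  with w(1) show "cap_small {x\<in>X. 0 < g x} e" using w(3,4) by (rule cap_smallI[OF _ Un_upper2])
qed

lemma quasi_Chebyshev:
  assumes "quasi g" "AE x in \<xi>. g x \<le> rep v x" "0 \<preceq> v" "s > 0" "norm v / s < e"
  shows "cap_small {x\<in>X. s < g x} e"
proof -
  have "e - norm v / s > 0" using assms(5) by simp
  with assms(1) obtain G w where w: "openin (top_of_set X) (G \<union> {x\<in>X. s < g x})"
    "AE x in \<xi>. x \<in> G \<longrightarrow> 1 \<le> rep w x" "0 \<preceq> w" "norm w < e - norm v / s"
    by (rule quasi_superlevel)
  show ?thesis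
  proof (rule cap_smallI)
    show "AE x in \<xi>. x \<in> G \<union> {x\<in>X. s < g x} \<longrightarrow> 1 \<le> rep ((1/s) *\<^sub>R v + w) x"
      using w(2) assms(2) assms(3)[unfolded nonneg_AE]
        w(3)[unfolded nonneg_AE] rep_linear[of "1/s" v 1 w]
    proof eventually_elim
      case (elim x)
      have "1 < rep v x / s" if "s < g x" using that elim \<open>s > 0\<close> by simp
      moreover have "0 \<le> rep v x / s" using elim \<open>s > 0\<close> by simp
      ultimately show ?case using elim by auto
    qed
    show "0 \<preceq> (1/s) *\<^sub>R v + w" using assms w by (intro nonneg_add nonneg_scale) auto
    have "norm ((1/s) *\<^sub>R v + w) \<le> norm v / s + norm w"
      using norm_triangle_ineq[of "(1/s) *\<^sub>R v" w] \<open>s > 0\<close> by simp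
    then show "norm ((1/s) *\<^sub>R v + w) < e" using w(4) by linarith
  qed (use w in auto)
qed

text \<open>Compactly supported continuous functions approximate \<open>v\<close> at rate
  \<open>(1/4) ^ n\<close>, while consecutive ones are allowed to differ by
  \<open>(1/2) ^ n\<close>; the gap between the rates makes the exceptional sets summably
  small.\<close>

lemma exists_quasi_continuous_rep: "\<exists>g. quasi g \<and> (AE x in \<xi>. g x = rep v x)"
proof -
  obtain C where C: "C \<ge> 0" "\<And>v. sq_int v \<le> C * (norm v)\<^sup>2" using sq_int_bound by blast
  have "\<exists>w h. h \<in> Cc X \<and> (AE x in \<xi>. rep w x = h x) \<and> norm (w - v) < (1/4) ^ n" for n :: nat
  proof -
    have "v \<in> closure {v. \<exists>h\<in>Cc X. AE x in \<xi>. rep v x = h x}" using Cc_dense_V by simp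
    then obtain w where "w \<in> {v. \<exists>h\<in>Cc X. AE x in \<xi>. rep v x = h x}" "dist w v < (1/4) ^ n"
      unfolding closure_approachable by (meson zero_less_divide_1_iff zero_less_numeral zero_less_power)
    then show ?thesis by (auto simp: dist_norm)
  qed
  then obtain w h where w: "\<And>n. h n \<in> Cc X" "\<And>n. AE x in \<xi>. rep (w n) x = h n x"
    "\<And>n::nat. norm (w n - v) < (1/4) ^ n"
    by metis
  have "(\<lambda>n. sq_int (w n - v)) \<longlonglongrightarrow> 0"
  proof (rule Lim_null_comparison)
    show "\<forall>\<^sub>F n in sequentially. norm (sq_int (w n - v)) \<le> C * ((1/4) ^ n)\<^sup>2"
    proof (intro always_eventually allI)
      fix n
      have "(norm (w n - v))\<^sup>2 \<le> ((1/4) ^ n)\<^sup>2" using w(3)[of n] by (intro power_mono) auto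
      then have "C * (norm (w n - v))\<^sup>2 \<le> C * ((1/4) ^ n)\<^sup>2" using C(1) by (rule mult_left_mono)
      then show "norm (sq_int (w n - v)) \<le> C * ((1/4) ^ n)\<^sup>2"
        using C(2)[of "w n - v"] sq_int_nonneg[of "w n - v"] by simp
    qed
    have "(\<lambda>n. C * ((1/4) ^ n)\<^sup>2) \<longlonglongrightarrow> C * 0\<^sup>2"
      by (intro tendsto_intros LIMSEQ_realpow_zero) auto
    then show "(\<lambda>n. C * ((1/4) ^ n)\<^sup>2) \<longlonglongrightarrow> 0" by simp
  qed
  then have "(\<lambda>n. \<integral>x. norm ((rep (w n - v) x)\<^sup>2) \<partial>\<xi>) \<longlonglongrightarrow> 0"
    unfolding sq_int_def by simp
  then obtain r where r: "strict_mono (r :: nat \<Rightarrow> nat)"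
    "AE x in \<xi>. (\<lambda>n. (rep (w (r n) - v) x)\<^sup>2) \<longlonglongrightarrow> 0"
    using tendsto_L1_AE_subseq[of \<xi> "\<lambda>n x. (rep (w n - v) x)\<^sup>2"] integrable_rep_sq by blast
  define k where "k n = h (r n)" for n
  define z where "z n = w (r n)" for n
  \<comment> \<open>Passing to the almost everywhere convergent subsequence keeps the rate, since
    \<open>r n\<close> is at least \<open>n\<close>.\<close>
  have z: "norm (z n - v) < (1/4) ^ n" for n
  proof -
    have "(1/4 :: real) ^ r n \<le> (1/4) ^ n" using seq_suble[OF r(1)] by (intro power_decreasing) auto
    then show ?thesis using w(3)[of "r n"] unfolding z_def by linarith
  qed
  have kz: "AE x in \<xi>. rep (z n) x = k n x" for n
    unfolding z_def k_def by (rule w)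
  have "AE x in \<xi>. \<forall>n. rep (z n) x = k n x" "AE x in \<xi>. \<forall>n. rep (z n - v) x = rep (z n) x - rep v x"
    using kz rep_diff by (simp_all add: AE_all_countable)
  then have conv: "AE x in \<xi>. (\<lambda>n. k n x) \<longlonglongrightarrow> rep v x"
    using r(2)
  proof eventually_elim
    case (elim x)
    have "(\<lambda>n. sqrt ((k n x - rep v x)\<^sup>2)) \<longlonglongrightarrow> sqrt 0"
      using elim(3) unfolding z_def[symmetric] elim(1,2)[rule_format] by (rule tendsto_real_sqrt)
    then have "(\<lambda>n. k n x - rep v x) \<longlonglongrightarrow> 0" by (simp add: tendsto_rabs_zero_iff)
    then show ?case by (simp add: LIM_zero_iff)
  qed
  have k_cont: "continuous_on X (k n)" for n using w(1) unfolding k_def Cc_def by auto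
  define D where "D n = {x\<in>X. (1/2) ^ n < \<bar>k (Suc n) x - k n x\<bar>}" for n
  have D_open: "openin (top_of_set X) (D n)" for n
  proof -
    have "continuous_on X (\<lambda>x. \<bar>k (Suc n) x - k n x\<bar>)" by (intro continuous_intros k_cont)
    from continuous_openin_preimage_gen[OF this, of "{(1/2) ^ n<..}"]
    show ?thesis unfolding D_def by (simp add: Int_def conj_commute)
  qed
  \<comment> \<open>The potential is the absolute difference times \<open>2 ^ n\<close>. Of the 4,
    one factor 2 comes from \<open>norm_vabs\<close> and one from the two approximation errors; the
    added 1 makes the bound strict.\<close>
  have D_small: "cap_small (D n) ((4 * \<kappa> + 1) * (1/2) ^ n)" for n
  proof (rule cap_smallI[OF D_open order_refl])
    let ?v = "2 ^ n *\<^sub>R vabs (z (Suc n) - z n)"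
    show "AE x in \<xi>. x \<in> D n \<longrightarrow> 1 \<le> rep ?v x"
      using rep_scale[of "2 ^ n" "vabs (z (Suc n) - z n)"] rep_vabs[of "z (Suc n) - z n"]
        rep_diff[of "z (Suc n)" "z n"] kz[of n] kz[of "Suc n"]
    proof eventually_elim
      case (elim x)
      show ?case
      proof
        assume "x \<in> D n"
        then have "2 ^ n * (1/2) ^ n \<le> 2 ^ n * \<bar>k (Suc n) x - k n x\<bar>"
          unfolding D_def by (intro mult_left_mono) auto
        then show "1 \<le> rep ?v x" using elim by (simp add: power_divide)
      qed
    qed
    show "0 \<preceq> ?v" unfolding vabs_def by (intro nonneg_scale nonneg_add pos_nonneg) auto
    have "norm (z (Suc n) - z n) \<le> norm (z (Suc n) - v) + norm (z n - v)"
      using norm_triangle_ineq4[of "z (Suc n) - v" "z n - v"] by simp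
    also have "\<dots> \<le> (1/4) ^ n + (1/4) ^ n"
      using z[of "Suc n"] z[of n] power_decreasing[of n "Suc n" "1/4::real"] by linarith
    finally have "2 * \<kappa> * norm (z (Suc n) - z n) \<le> 2 * \<kappa> * (2 * (1/4) ^ n)"
      using kappa_pos by (intro mult_left_mono) auto
    then have "norm (vabs (z (Suc n) - z n)) \<le> 4 * \<kappa> * (1/4) ^ n"
      using norm_vabs[of "z (Suc n) - z n"] by linarith
    then have "norm ?v \<le> 2 ^ n * (4 * \<kappa> * (1/4) ^ n)" by simp
    also have "\<dots> = 4 * \<kappa> * (1/2) ^ n"
      by (simp add: power_mult_distrib[symmetric] mult.assoc mult.left_commute[of "2 ^ n"])
    also have "\<dots> < (4 * \<kappa> + 1) * (1/2) ^ n" by simp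
    finally show "norm ?v < (4 * \<kappa> + 1) * (1/2) ^ n" .
  qed
  \<comment> \<open>Where the sequence diverges the value is arbitrary; inside X such points belong
    to every exceptional set \<open>G\<close> below.\<close>
  define g where "g x = lim (\<lambda>n. k n x)" for x
  have "AE x in \<xi>. g x = rep v x" using conv by eventually_elim (auto simp: g_def limI)
  moreover have "quasi g"
    unfolding quasi_iff
  proof (intro allI impI)
    fix e :: real assume "e > 0"
    have "(\<lambda>N. 2 * (4 * \<kappa> + 1) * (1/2::real) ^ N) \<longlonglongrightarrow> 2 * (4 * \<kappa> + 1) * 0"
      by (intro tendsto_intros LIMSEQ_realpow_zero) auto
    then have "\<forall>\<^sub>F N in sequentially. 2 * (4 * \<kappa> + 1) * (1/2::real) ^ N < e"
      using \<open>e > 0\<close> by (intro order_tendstoD(2)) auto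
    then obtain N where N: "2 * (4 * \<kappa> + 1) * (1/2::real) ^ N < e"
      unfolding eventually_sequentially by auto
    define G where "G = (\<Union>n. D (n + N))"
    have "cap_small G e"
      unfolding G_def
    proof (rule cap_small_UN[OF D_small])
      have eq: "(\<lambda>n. (4 * \<kappa> + 1) * (1/2::real) ^ (n + N)) = (\<lambda>n. (4 * \<kappa> + 1) * (1/2) ^ N * (1/2) ^ n)"
        by (simp add: power_add mult_ac)
      show "summable (\<lambda>n. (4 * \<kappa> + 1) * (1/2::real) ^ (n + N))"
        unfolding eq by (intro summable_mult summable_geometric) auto
      show "(\<Sum>n. (4 * \<kappa> + 1) * (1/2::real) ^ (n + N)) < e"
        unfolding eq using N by (subst suminf_mult) (auto simp: suminf_geometric algebra_simps)
    qed
    moreover have "openin (top_of_set X) G" unfolding G_def using D_open by blast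
    moreover have "continuous_on (X - G) g"
    proof -
      define a where "a i x = k (Suc (i + N)) x - k (i + N) x" for i x
      have "uniform_limit (X - G) (\<lambda>m x. \<Sum>i<m. a i x) (\<lambda>x. suminf (\<lambda>i. a i x)) sequentially"
      proof (rule Weierstrass_m_test)
        show "norm (a i x) \<le> (1/2) ^ (i + N)" if "x \<in> X - G" for i x
          using that unfolding G_def D_def a_def by (force simp: not_less)
        show "summable (\<lambda>i. (1/2::real) ^ (i + N))"
          unfolding power_add by (intro summable_mult2 summable_geometric) auto
      qed
      moreover have tele: "(\<Sum>i<m. a i x) = k (m + N) x - k N x" for m x
        unfolding a_def using sum_lessThan_telescope[of "\<lambda>i. k (i + N) x" m] by simp
      ultimately have ul: "uniform_limit (X - G) (\<lambda>m x. k (m + N) x - k N x) (\<lambda>x. suminf (\<lambda>i. a i x)) sequentially"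
        by simp
      have "continuous_on (X - G) (\<lambda>x. suminf (\<lambda>i. a i x))"
        by (rule uniform_limit_theorem[OF _ ul])
          (auto intro!: always_eventually continuous_intros continuous_on_subset[OF k_cont])
      then have "continuous_on (X - G) (\<lambda>x. suminf (\<lambda>i. a i x) + k N x)"
        by (intro continuous_intros continuous_on_subset[OF k_cont]) auto
      moreover have "g x = suminf (\<lambda>i. a i x) + k N x" if "x \<in> X - G" for x
      proof -
        have "(\<lambda>m. k (m + N) x - k N x) \<longlonglongrightarrow> suminf (\<lambda>i. a i x)"
          using ul that by (rule tendsto_uniform_limitI)
        then have "(\<lambda>m. k (m + N) x - k N x + k N x) \<longlonglongrightarrow> suminf (\<lambda>i. a i x) + k N x"
          by (intro tendsto_intros)
        then have "(\<lambda>m. k m x) \<longlonglongrightarrow> suminf (\<lambda>i. a i x) + k N x" by (simp add: LIMSEQ_offset)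
        then show ?thesis unfolding g_def by (rule limI)
      qed
      ultimately show ?thesis by (subst continuous_on_cong[OF refl]) auto
    qed
    ultimately show "\<exists>G. openin (top_of_set X) G \<and> cap_small G e \<and> continuous_on (X - G) g" by blast
  qed
  ultimately show ?thesis by blast
qed

lemma qc_rep: "quasi (qc_rep X \<xi> rep v)" "AE x in \<xi>. qc_rep X \<xi> rep v x = rep v x"
  using someI_ex[OF exists_quasi_continuous_rep[of v]] unfolding qc_rep_def by auto

section \<open>The tangent cone of an obstacle constraint\<close>

lemma AE_in_X: "AE x in \<xi>. x \<in> X"
proof -
  have "sets \<xi> = sets (restrict_space borel X)" using radon unfolding radon_measure_on_def by blast
  then have "space \<xi> = X" by (metis sets_eq_imp_space_eq space_restrict_space space_borel Int_UNIV_right)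
  then show ?thesis by (metis AE_space)
qed

text \<open>Urysohn's lemma is applied inside a compact \<open>L\<close> covering a relative
  neighbourhood of \<open>K\<close>, where normality holds. Vanishing on \<open>L - W\<close> makes
  the extension by zero continuous, since \<open>L\<close> and \<open>X - W\<close> are relatively
  closed and cover X.\<close>

lemma exists_Cc_one_on_compact:
  assumes K: "compact K" "K \<subseteq> X"
  shows "\<exists>g\<in>Cc X. \<forall>x\<in>K. g x = 1"
proof -
  have "\<exists>u v. openin (top_of_set X) u \<and> compact v \<and> x \<in> u \<and> u \<subseteq> v \<and> v \<subseteq> X" if "x \<in> K" for x
    using locally_compact that K(2) unfolding locally_def by (meson openin_subtopology_self subsetD)
  then obtain u v where uv: "\<And>x. x \<in> K \<Longrightarrow> openin (top_of_set X) (u x) \<and> compact (v x) \<and> x \<in> u x \<and> u x \<subseteq> v x \<and> v x \<subseteq> X"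
    by metis
  then have "\<exists>o'. open o' \<and> u x = X \<inter> o'" if "x \<in> K" for x using that by (meson openin_open)
  then obtain w where w: "\<And>x. x \<in> K \<Longrightarrow> open (w x) \<and> u x = X \<inter> w x" by metis
  obtain F where F: "F \<subseteq> K" "finite F" "K \<subseteq> (\<Union>x\<in>F. w x)"
    using compactE_image[OF K(1), of K w] w uv by (metis IntD2 UN_I subsetI)
  define W where "W = (\<Union>x\<in>F. w x)"
  define L where "L = (\<Union>x\<in>F. v x)"
  have wv: "X \<inter> w x \<subseteq> v x" if "x \<in> F" for x
    using uv[of x] w[of x] F(1) that by blast
  have W: "open W" "K \<subseteq> W" "X \<inter> W \<subseteq> L"
    unfolding W_def L_def using w F(1) by (intro open_UN ballI, blast) (rule F(3), use wv in blast)
  have "compact L" unfolding L_def using uv F(1) by (intro compact_UN F(2)) blast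
  moreover have "L \<subseteq> X" unfolding L_def using uv F(1) by blast
  ultimately have L: "compact L" "L \<subseteq> X" by blast+
  have "Hausdorff_space (euclidean :: 'x topology)"
    unfolding Hausdorff_space_def disjnt_def using hausdorff by (metis open_openin)
  then have "normal_space (top_of_set L)"
    using L(1) by (intro compact_Hausdorff_or_regular_imp_normal_space compact_space_subtopology disjI1
        Hausdorff_space_subtopology) (simp_all add: compactin_euclidean_iff)
  moreover have "closedin (top_of_set L) (L - W)"
    using W(1) by (metis Diff_eq closedin_closed_Int closed_Compl)
  moreover have "closedin (top_of_set L) K"
    using K W L by (metis Int_absorb1 closedin_closed_Int compact_imp_closed le_inf_iff subset_trans)
  moreover have "disjnt (L - W) K" using W(2) by (auto simp: disjnt_def)
  ultimately obtain g where g: "continuous_map (top_of_set L) (top_of_set {0..1::real}) g"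
    "g ` (L - W) \<subseteq> {0}" "g ` K \<subseteq> {1}"
    by (rule Urysohn_lemma[where a = 0 and b = 1]) auto
  have gc: "continuous_on L g" using g(1) by (simp add: continuous_map_in_subtopology)
  define G where "G x = (if x \<in> L then g x else 0)" for x
  have "continuous_on (L \<union> (X - W)) (\<lambda>x. if x \<in> L then g x else 0)"
  proof (rule continuous_on_Un_local)
    have LX: "L \<union> (X - W) = X" using W(3) L(2) by blast
    show "closedin (top_of_set (L \<union> (X - W))) L"
      unfolding LX using L by (metis Int_absorb1 closedin_closed_Int compact_imp_closed inf.commute)
    show "closedin (top_of_set (L \<union> (X - W))) (X - W)"
      unfolding LX using W(1) by (metis Diff_eq closedin_closed_Int closed_Compl)
    show "continuous_on L (\<lambda>x. if x \<in> L then g x else 0)"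
      using gc by (rule continuous_on_eq) auto
    show "continuous_on (X - W) (\<lambda>x. if x \<in> L then g x else 0)"
      using continuous_on_const[of _ 0] by (rule continuous_on_eq) (use g(2) in force)
  qed
  moreover have "L \<union> (X - W) = X" using W(3) L(2) by blast
  ultimately have "G \<in> Cc X" unfolding Cc_def G_def using L by auto
  moreover have "\<forall>x\<in>K. G x = 1" using g(3) W K unfolding G_def by fastforce
  ultimately show ?thesis by blast
qed

lemma exists_cutoff:
  assumes K: "compact K" "K \<subseteq> X"
  shows "\<exists>\<zeta>. 0 \<preceq> \<zeta> \<and> (AE x in \<xi>. x \<in> K \<longrightarrow> 1 \<le> rep \<zeta> x)"
proof -
  obtain g where g: "g \<in> Cc X" "\<forall>x\<in>K. g x = 1" using exists_Cc_one_on_compact[OF K] by blast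
  \<comment> \<open>Doubling leaves room for a uniform error of 1 in the approximation from
    V.\<close>
  have "(\<lambda>x. 2 * g x) \<in> Cc X" using g(1) unfolding Cc_def by (auto intro!: continuous_intros)
  then obtain v h where v: "AE x in \<xi>. rep v x = h x" "\<forall>x\<in>X. \<bar>h x - 2 * g x\<bar> < 1"
    using Cc_dense_sup[of "\<lambda>x. 2 * g x" 1] by auto
  have "AE x in \<xi>. x \<in> K \<longrightarrow> 1 \<le> rep (pos v) x"
    using v(1) rep_pos[of v]
  proof eventually_elim
    case (elim x)
    show ?case
    proof
      assume "x \<in> K"
      then have "\<bar>h x - 2 * g x\<bar> < 1" "g x = 1"
        using bspec[OF v(2), of x] bspec[OF g(2), of x] K(2) by blast+
      then show "1 \<le> rep (pos v) x" using elim by auto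
    qed
  qed
  then show ?thesis using pos_nonneg by blast
qed

text \<open>Radial directions kept between 0 and \<open>p\<close>; non-negativity later forces
  positive functionals vanishing at \<open>y\<close> to vanish on them.\<close>

definition below_multiple :: "'v \<Rightarrow> 'v \<Rightarrow> 'v set" where
  "below_multiple y p = {\<psi>. 0 \<preceq> \<psi> \<and> \<psi> \<preceq> p \<and> (\<exists>n::nat. \<psi> \<preceq> real n *\<^sub>R y)}"

lemma multiple_mono: "0 \<preceq> y \<Longrightarrow> a \<le> b \<Longrightarrow> a *\<^sub>R y \<preceq> b *\<^sub>R y"
  using nonneg_scale[of y "b - a"] by (simp add: le_iff_diff_ge[of "a *\<^sub>R y"] algebra_simps)

text \<open>For \<open>y\<close> non-negative these are the feasible directions of the cone of
  non-positive functions at \<open>- y\<close>; the closure is the tangent cone there.\<close>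

definition radial_cone :: "'v \<Rightarrow> 'v set" where
  "radial_cone y = {\<psi>. \<exists>n::nat. \<psi> \<preceq> real n *\<^sub>R y}"

lemma convex_radial_cone:
  assumes y: "0 \<preceq> y"
  shows "convex (radial_cone y)"
  unfolding convex_def
proof (intro ballI allI impI)
  fix v w a b assume v: "v \<in> radial_cone y" and w: "w \<in> radial_cone y"
    and ab: "0 \<le> (a::real)" "0 \<le> b" "a + b = 1"
  obtain n m :: nat where n: "v \<preceq> real n *\<^sub>R y" and m: "w \<preceq> real m *\<^sub>R y"
    using v w unfolding radial_cone_def by blast
  let ?k = "max n m"
  have "v \<preceq> real ?k *\<^sub>R y" "w \<preceq> real ?k *\<^sub>R y"
    by (rule le_trans[OF n multiple_mono[OF y]] le_trans[OF m multiple_mono[OF y]]; simp)+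
  then have "a *\<^sub>R v + b *\<^sub>R w \<in> {z. z \<preceq> real ?k *\<^sub>R y}"
    using ab convexD[OF convex_le] by blast
  then show "a *\<^sub>R v + b *\<^sub>R w \<in> radial_cone y" unfolding radial_cone_def by blast
qed

lemma convex_below_multiple:
  assumes "0 \<preceq> y"
  shows "convex (below_multiple y p)"
proof -
  have "below_multiple y p = radial_cone y \<inter> ({\<psi>. 0 \<preceq> \<psi>} \<inter> {\<psi>. \<psi> \<preceq> p})"
    by (auto simp: below_multiple_def radial_cone_def)
  then show ?thesis using convex_radial_cone[OF assms] convex_ge convex_le by (simp add: convex_Int)
qed

text \<open>With \<open>\<zeta> \<ge> 1\<close> on \<open>K\<close> and a capacitary potential \<open>w\<close> of a small open set \<open>G\<close> off which \<open>P\<close> and \<open>Y\<close> are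
  continuous, \<open>(p - e \<zeta> - M w)\<^sup>+\<close> vanishes outside the compact set \<open>{x \<in> K - G. e \<le> P x}\<close>, on which
  \<open>Y\<close> has a positive minimum. No truncation at constants is used, since \<open>V\<close> need not be stable under it.\<close>

lemma approx_by_multiples_bounded:
  assumes y: "0 \<preceq> y" and Y: "quasi Y" "AE x in \<xi>. Y x = rep y x"
    and p: "0 \<preceq> p" and P: "quasi P" "AE x in \<xi>. P x = rep p x"
    and null: "cap_null {x\<in>X. Y x = 0 \<and> 0 < P x}"
    and K: "compact K" "K \<subseteq> X" and off: "AE x in \<xi>. x \<notin> K \<longrightarrow> rep p x \<le> 0"
    and M: "M > 0" "AE x in \<xi>. rep p x \<le> M"
  shows "p \<in> closure (below_multiple y p)"
proof -
  obtain \<zeta> where \<zeta>: "0 \<preceq> \<zeta>" "AE x in \<xi>. x \<in> K \<longrightarrow> 1 \<le> rep \<zeta> x"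
    using exists_cutoff[OF K] by blast
  have "AE x in \<xi>. - Y x \<le> 0"
    using Y(2) y[unfolded nonneg_AE] by eventually_elim auto
  moreover have "quasi (\<lambda>x. - Y x)" by (rule quasi_combine[OF Y(1) Y(1)]) (auto intro: continuous_intros)
  ultimately have "cap_null {x\<in>X. 0 < - Y x}" by (intro quasi_le_zero)
  \<comment> \<open>The representative \<open>Y\<close> may be negative on a set of capacity zero;
    removing that set too leaves \<open>Y\<close> strictly positive where \<open>P\<close>
    is.\<close>
  moreover have "{x\<in>X. Y x \<le> 0 \<and> 0 < P x} \<subseteq> {x\<in>X. 0 < - Y x} \<union> {x\<in>X. Y x = 0 \<and> 0 < P x}"
    by auto
  ultimately have null': "cap_null {x\<in>X. Y x \<le> 0 \<and> 0 < P x}"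
    using cap_null_Un[OF _ null] cap_null_mono by blast
  have step: "\<exists>w. 0 \<preceq> w \<and> norm w < 3 * e \<and> pos (p - (e *\<^sub>R \<zeta> + M *\<^sub>R w)) \<in> below_multiple y p"
    if "e > 0" for e
  proof -
    obtain G1 where G1: "openin (top_of_set X) G1" "cap_small G1 e" "continuous_on (X - G1) Y"
      using Y(1)[unfolded quasi_iff, rule_format, OF \<open>e > 0\<close>] by blast
    obtain G2 where G2: "openin (top_of_set X) G2" "cap_small G2 e" "continuous_on (X - G2) P"
      using P(1)[unfolded quasi_iff, rule_format, OF \<open>e > 0\<close>] by blast
    \<comment> \<open>One open set absorbs both discontinuity sets and the bad points, at a cost of
      \<open>e\<close> each.\<close>
    have "cap_small ((G1 \<union> G2) \<union> {x\<in>X. Y x \<le> 0 \<and> 0 < P x}) ((e + e) + e)"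
      using null' that G1 G2 unfolding cap_null_iff by (intro cap_small_Un) auto
    then obtain G w where G: "openin (top_of_set X) G" "G1 \<union> G2 \<union> {x\<in>X. Y x \<le> 0 \<and> 0 < P x} \<subseteq> G"
      and w: "AE x in \<xi>. x \<in> G \<longrightarrow> 1 \<le> rep w x" "0 \<preceq> w" "norm w < 3 * e"
      unfolding cap_small_def by auto
    obtain O' where O': "open O'" "G = X \<inter> O'" using G(1) by (meson openin_open)
    have KG: "compact (K - G)"
    proof -
      have "K - G = K - O'" using O' K by blast
      then show ?thesis using compact_diff[OF K(1) O'(1)] by simp
    qed
    define F where "F = {x\<in>K - G. e \<le> P x}"
    have contP: "continuous_on (K - G) P" using G2(3) G K by (auto elim!: continuous_on_subset)
    have "closedin (top_of_set (K - G)) ((K - G) \<inter> P -` {e..})"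
      using contP by (rule continuous_closedin_preimage) auto
    moreover have "(K - G) \<inter> P -` {e..} = F" unfolding F_def by auto
    ultimately have F: "compact F" using closedin_compact[OF KG] by metis
    have contY: "continuous_on F Y" using G1(3) G K by (auto elim!: continuous_on_subset simp: F_def)
    have posY: "Y x > 0" if "x \<in> F" for x
    proof (rule ccontr)
      assume "\<not> Y x > 0"
      then have "x \<in> G" using G(2) that \<open>e > 0\<close> K unfolding F_def by auto
      then show False using that unfolding F_def by auto
    qed
    have "\<exists>c>0. \<forall>x\<in>F. c \<le> Y x"
    proof (cases "F = {}")
      case False
      then show ?thesis using continuous_attains_inf[OF F False contY] posY by blast
    qed (auto intro: exI[of _ 1])
    then obtain c where c: "c > 0" "\<And>x. x \<in> F \<Longrightarrow> c \<le> Y x" by blast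
    obtain n :: nat where n: "M / c \<le> real n" using real_arch_simple by blast
    let ?z = "e *\<^sub>R \<zeta> + M *\<^sub>R w"
    have "AE x in \<xi>. rep (pos (p - ?z)) x \<le> rep p x \<and> rep (pos (p - ?z)) x \<le> rep (real n *\<^sub>R y) x"
      using rep_pos[of "p - ?z"] rep_diff[of p ?z] rep_linear[of e \<zeta> M w] rep_scale[of "real n" y]
        \<zeta>(1)[unfolded nonneg_AE] \<zeta>(2) Y(2) P(2) off M(2) w(1)
        w(2)[unfolded nonneg_AE]
        p[unfolded nonneg_AE] y[unfolded nonneg_AE]
    proof eventually_elim
      case (elim x)
      have z: "rep (pos (p - ?z)) x = max (rep p x - (e * rep \<zeta> x + M * rep w x)) 0"
        using elim by simp
      have nn: "0 \<le> e * rep \<zeta> x" "0 \<le> M * rep w x" "0 \<le> real n * rep y x"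
        using elim \<open>e > 0\<close> M by auto
      have 1: "max (rep p x - (e * rep \<zeta> x + M * rep w x)) 0 \<le> rep p x"
        using nn \<open>0 \<le> rep p x\<close> by (intro max.boundedI) linarith+
      have "rep p x - (e * rep \<zeta> x + M * rep w x) \<le> real n * rep y x"
      proof -
        \<comment> \<open>Each region has its own reason: no mass outside \<open>K\<close>, the term
          with \<open>w\<close> on \<open>G\<close>, the term with \<zeta> where \<open>P\<close> is
          small, and the multiple of \<open>y\<close> on \<open>F\<close>.\<close>
        consider "x \<notin> K" | "x \<in> G" | "x \<in> K - G" "P x < e" | "x \<in> F" unfolding F_def by force
        then show ?thesis
        proof cases
          case 1
          then have "rep p x \<le> 0" using elim by blast
          then show ?thesis using nn by linarith
        next
          case 2
          then have "M * 1 \<le> M * rep w x" using elim M by (intro mult_left_mono) auto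
          then show ?thesis using nn \<open>rep p x \<le> M\<close> by linarith
        next
          case 3
          then have "e * 1 \<le> e * rep \<zeta> x" using elim \<open>e > 0\<close> by (intro mult_left_mono) auto
          then show ?thesis using nn 3 \<open>P x = rep p x\<close> by linarith
        next
          case 4
          then have "M / c * c \<le> real n * rep y x"
            using c(1) c(2)[OF 4] n \<open>Y x = rep y x\<close> M by (intro mult_mono) auto
          then show ?thesis using nn c(1) \<open>rep p x \<le> M\<close> by simp
        qed
      qed
      then show ?case unfolding z using 1 nn elim(4) by auto
    qed
    then have "pos (p - ?z) \<in> below_multiple y p"
      unfolding below_multiple_def le_def[symmetric] using pos_nonneg by (auto simp: le_def)
    then show ?thesis using w by blast
  qed
  have "\<exists>w. \<forall>n. 0 \<preceq> w n \<and> norm (w n) < 3 * (1 / real (Suc n)) \<and>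
      pos (p - ((1 / real (Suc n)) *\<^sub>R \<zeta> + M *\<^sub>R w n)) \<in> below_multiple y p"
    by (intro choice allI step) simp
  then obtain w where w: "\<And>n. 0 \<preceq> w n" "\<And>n. norm (w n) < 3 * (1 / real (Suc n))"
    "\<And>n. pos (p - ((1 / real (Suc n)) *\<^sub>R \<zeta> + M *\<^sub>R w n)) \<in> below_multiple y p" by blast
  define z where "z n = (1 / real (Suc n)) *\<^sub>R \<zeta> + M *\<^sub>R w n" for n
  have l0: "(\<lambda>n. 1 / real (Suc n)) \<longlonglongrightarrow> 0" by (rule LIMSEQ_Suc[OF lim_1_over_n])
  have "w \<longlonglongrightarrow> 0"
  proof (rule Lim_null_comparison)
    show "\<forall>\<^sub>F n in sequentially. norm (w n) \<le> 3 * (1 / real (Suc n))"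
      using w(2) less_imp_le by (intro always_eventually) blast
    show "(\<lambda>n. 3 * (1 / real (Suc n))) \<longlonglongrightarrow> 0" using tendsto_mult_left[OF l0, of 3] by simp
  qed
  then have "z \<longlonglongrightarrow> 0 *\<^sub>R \<zeta> + M *\<^sub>R 0" unfolding z_def by (intro tendsto_intros l0)
  then have z0: "z \<longlonglongrightarrow> 0" by simp
  have "p \<in> closure (convex hull (range (\<lambda>n. pos (p - z n))))"
  proof (rule closure_hull_of_squeeze[OF _ z0])
    obtain B where B: "\<And>n. norm (z n) \<le> B"
      using convergent_imp_bounded[OF z0] unfolding bounded_iff by auto
    have "norm (pos (p - z n)) \<le> \<kappa> * (norm p + B)" for n
      using norm_pos[of "p - z n"] norm_triangle_ineq4[of p "z n"] B[of n] kappa_pos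
      by (meson add_left_mono mult_left_mono less_imp_le order_trans)
    then show "bounded (range (\<lambda>n. pos (p - z n)))" unfolding bounded_iff by blast
    fix n
    have "0 \<preceq> z n" unfolding z_def using w(1) \<zeta>(1) M by (intro nonneg_add nonneg_scale) auto
    \<comment> \<open>As both functions are non-negative, the left side is their minimum.\<close>
    then show "AE x in \<xi>. \<bar>rep (pos (p - z n) - p) x\<bar> \<le> \<bar>rep (z n) x\<bar>"
      using p unfolding nonneg_AE
      using rep_pos[of "p - z n"] rep_diff[of p "z n"] rep_diff[of "pos (p - z n)" p]
      by eventually_elim auto
  qed
  moreover have "convex hull (range (\<lambda>n. pos (p - z n))) \<subseteq> below_multiple y p"
    using w(3) convex_below_multiple[OF y] unfolding z_def by (intro hull_minimal) auto
  ultimately show ?thesis using closure_mono by blast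
qed

text \<open>Cutting \<open>p\<close> by the positive part of a compactly supported approximant gives
  \<open>q n\<close>, which is bounded and vanishes off a compact set. Its distance to
  \<open>p\<close> is pointwise at most that of the approximant.\<close>

lemma approx_by_multiples:
  assumes y: "0 \<preceq> y" and Y: "quasi Y" "AE x in \<xi>. Y x = rep y x"
    and p: "0 \<preceq> p" and P: "quasi P" "AE x in \<xi>. P x = rep p x"
    and null: "cap_null {x\<in>X. Y x = 0 \<and> 0 < P x}"
  shows "p \<in> closure (below_multiple y p)"
proof -
  have "\<exists>w h. h \<in> Cc X \<and> (AE x in \<xi>. rep w x = h x) \<and> norm (w - p) < 1 / real (Suc n)" for n :: nat
  proof -
    have "p \<in> closure {v. \<exists>h\<in>Cc X. AE x in \<xi>. rep v x = h x}" using Cc_dense_V by simp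
    then obtain w where "w \<in> {v. \<exists>h\<in>Cc X. AE x in \<xi>. rep v x = h x}" "dist w p < 1 / real (Suc n)"
      unfolding closure_approachable by (meson of_nat_0_less_iff zero_less_Suc zero_less_divide_1_iff)
    then show ?thesis by (auto simp: dist_norm)
  qed
  then obtain w h where w: "\<And>n. h n \<in> Cc X" "\<And>n. AE x in \<xi>. rep (w n) x = h n x"
    "\<And>n::nat. norm (w n - p) < 1 / real (Suc n)"
    by metis
  define q where "q n = p - pos (p - pos (w n))" for n
  have rep_q: "AE x in \<xi>. rep (q n) x = min (rep p x) (max (rep (w n) x) 0)" for n
    unfolding q_def using rep_diff[of p "pos (p - pos (w n))"] rep_pos[of "p - pos (w n)"]
      rep_diff[of p "pos (w n)"] rep_pos[of "w n"] by eventually_elim (auto simp: max_def min_def)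
  have q_nonneg: "0 \<preceq> q n" for n
    using rep_q[of n] p unfolding nonneg_AE by eventually_elim auto
  have q_le: "q n \<preceq> p" for n
    using rep_q[of n] unfolding le_def by eventually_elim auto
  have q_mem: "q n \<in> closure (below_multiple y p)" for n
  proof -
    obtain Q where Q: "quasi Q" "AE x in \<xi>. Q x = rep (q n) x"
      using exists_quasi_continuous_rep by blast
    obtain K where K: "compact K" "K \<subseteq> X" "\<forall>x\<in>X - K. h n x = 0" and hc: "continuous_on X (h n)"
      using w(1)[of n] unfolding Cc_def by blast
    obtain B where B: "\<And>x. x \<in> K \<Longrightarrow> h n x \<le> B"
      using compact_continuous_image[OF continuous_on_subset[OF hc K(2)] K(1), THEN compact_imp_bounded]
      unfolding bounded_iff by (metis abs_le_D1 imageI real_norm_def)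
    have "q n \<in> closure (below_multiple y (q n))"
    proof (rule approx_by_multiples_bounded[OF y Y q_nonneg Q _ K(1,2)])
      \<comment> \<open>For quasi-continuous representatives the inequality holds quasi-everywhere,
        so the null condition passes from \<open>P\<close> to \<open>Q\<close>.\<close>
      have "AE x in \<xi>. Q x - P x \<le> 0"
        using q_le[of n, unfolded le_def] Q(2) P(2) by eventually_elim auto
      then have "cap_null {x\<in>X. 0 < Q x - P x}"
        by (rule quasi_le_zero[OF quasi_diff[OF Q(1) P(1)]])
      moreover have "{x\<in>X. Y x = 0 \<and> 0 < Q x} \<subseteq> {x\<in>X. 0 < Q x - P x} \<union> {x\<in>X. Y x = 0 \<and> 0 < P x}"
        by auto
      ultimately show "cap_null {x\<in>X. Y x = 0 \<and> 0 < Q x}"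
        using cap_null_Un[OF _ null] cap_null_mono by blast
      show "AE x in \<xi>. x \<notin> K \<longrightarrow> rep (q n) x \<le> 0"
        using rep_q[of n] w(2)[of n] AE_in_X by eventually_elim (use K(3) in auto)
      show "max B 1 > 0" by auto
      show "AE x in \<xi>. rep (q n) x \<le> max B 1"
        using rep_q[of n] w(2)[of n] AE_in_X
      proof eventually_elim
        case (elim x)
        have "h n x \<le> max B 1" using B[of x] K(3) elim(3) by (cases "x \<in> K") auto
        then show ?case using elim by auto
      qed
    qed
    moreover have "below_multiple y (q n) \<subseteq> below_multiple y p"
      unfolding below_multiple_def using q_le le_trans by blast
    ultimately show ?thesis using closure_mono by blast
  qed
  have z0: "(\<lambda>n. w n - p) \<longlonglongrightarrow> 0"
  proof (rule Lim_null_comparison)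
    show "\<forall>\<^sub>F n in sequentially. norm (w n - p) \<le> 1 / real (Suc n)"
      using w(3) less_imp_le by (intro always_eventually) blast
  qed (rule LIMSEQ_Suc[OF lim_1_over_n])
  have "p \<in> closure (convex hull (range q))"
  proof (rule closure_hull_of_squeeze[OF _ z0])
    have "norm (q n) \<le> norm p + \<kappa> * (norm p + \<kappa> * (norm p + 1))" for n
    proof -
      have "norm (w n) \<le> norm p + 1"
        using norm_triangle_ineq2[of "w n" p] order_less_le_trans[OF w(3)[of n], of 1]
        by simp
      then have "norm (pos (w n)) \<le> \<kappa> * (norm p + 1)"
        using norm_pos[of "w n"] kappa_pos by (meson mult_left_mono less_imp_le order_trans)
      then have "norm (p - pos (w n)) \<le> norm p + \<kappa> * (norm p + 1)"
        using norm_triangle_ineq4[of p "pos (w n)"] by linarith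
      then have "norm (pos (p - pos (w n))) \<le> \<kappa> * (norm p + \<kappa> * (norm p + 1))"
        using norm_pos[of "p - pos (w n)"] kappa_pos by (meson mult_left_mono less_imp_le order_trans)
      then show ?thesis unfolding q_def using norm_triangle_ineq4[of p "pos (p - pos (w n))"] by linarith
    qed
    then show "bounded (range q)" unfolding bounded_iff by blast
    show "AE x in \<xi>. \<bar>rep (q n - p) x\<bar> \<le> \<bar>rep (w n - p) x\<bar>" for n
      using rep_q[of n] rep_diff[of "q n" p] rep_diff[of "w n" p]
        p[unfolded nonneg_AE] by eventually_elim auto
  qed
  moreover have "convex hull (range q) \<subseteq> closure (below_multiple y p)"
    using q_mem convex_below_multiple[OF y] by (intro hull_minimal convex_closure) auto
  ultimately show ?thesis using closure_mono closure_closure by blast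
qed

text \<open>If \<open>\<psi> \<le> n y\<close> is close to \<open>\<phi>\<close>, then \<open>P - n Y\<close>, which equals \<open>P\<close> where \<open>Y\<close> vanishes, is
  dominated by \<open>\<bar>\<phi> - \<psi>\<bar>\<close>, and Chebyshev's inequality applies.\<close>

lemma tangent_imp_quasi_everywhere:
  assumes Y: "quasi Y" "AE x in \<xi>. Y x = rep y x"
    and P: "quasi P" "AE x in \<xi>. P x = rep \<phi> x"
    and \<phi>: "\<phi> \<in> closure (radial_cone y)"
  shows "cap_null {x\<in>X. Y x = 0 \<and> 0 < P x}"
proof -
  have null: "cap_null {x\<in>X. Y x = 0 \<and> s < P x}" if "s > 0" for s
    unfolding cap_null_iff
  proof (intro allI impI)
    fix e :: real assume "e > 0"
    \<comment> \<open>Chebyshev divides by the level \<open>s\<close>, and the absolute value costs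
      the factor \<open>2 * \<kappa>\<close>.\<close>
    define r where "r = e * s / (2 * \<kappa>)"
    have "r > 0" using \<open>e > 0\<close> \<open>s > 0\<close> kappa_pos by (simp add: r_def)
    then obtain \<psi> where "\<psi> \<in> radial_cone y" "dist \<psi> \<phi> < r"
      using \<phi> unfolding closure_approachable by blast
    then obtain n :: nat where n: "\<psi> \<preceq> real n *\<^sub>R y" and d: "norm (\<phi> - \<psi>) < r"
      unfolding radial_cone_def by (auto simp: dist_norm norm_minus_commute)
    have "cap_small {x\<in>X. s < P x - real n * Y x} e"
    proof (rule quasi_Chebyshev)
      show "quasi (\<lambda>x. P x - real n * Y x)" using P(1) Y(1) by (rule quasi_diff_scaled)
      show "AE x in \<xi>. P x - real n * Y x \<le> rep (vabs (\<phi> - \<psi>)) x"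
        using rep_vabs[of "\<phi> - \<psi>"] rep_diff[of \<phi> \<psi>] n[unfolded le_def] rep_scale[of "real n" y] P(2) Y(2)
        by eventually_elim auto
      show "0 \<preceq> vabs (\<phi> - \<psi>)" unfolding vabs_def by (intro nonneg_add pos_nonneg)
      have "2 * \<kappa> * norm (\<phi> - \<psi>) < 2 * \<kappa> * r" using d kappa_pos by simp
      also have "\<dots> = e * s" using kappa_pos by (simp add: r_def)
      finally show "norm (vabs (\<phi> - \<psi>)) / s < e"
        using norm_vabs[of "\<phi> - \<psi>"] \<open>s > 0\<close> by (simp add: pos_divide_less_eq)
    qed fact
    then show "cap_small {x\<in>X. Y x = 0 \<and> s < P x} e" by (rule cap_small_mono) auto
  qed
  have "cap_null (\<Union>n::nat. {x\<in>X. Y x = 0 \<and> 1 / real (Suc n) < P x})"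
    by (intro cap_null_UN null) simp
  moreover have "{x\<in>X. Y x = 0 \<and> 0 < P x} \<subseteq> (\<Union>n::nat. {x\<in>X. Y x = 0 \<and> 1 / real (Suc n) < P x})"
    using nat_approx_posE by blast
  ultimately show ?thesis by (rule cap_null_mono)
qed

lemma quasi_everywhere_imp_approx:
  assumes y: "0 \<preceq> y" and Y: "quasi Y" "AE x in \<xi>. Y x = rep y x"
    and P: "quasi P" "AE x in \<xi>. P x = rep \<phi> x"
    and null: "cap_null {x\<in>X. Y x = 0 \<and> 0 < P x}"
  shows "pos \<phi> \<in> closure (below_multiple y (pos \<phi>))"
proof (rule approx_by_multiples[OF y Y pos_nonneg])
  show "quasi (\<lambda>x. max (P x) 0)" using P(1) by (rule quasi_max_zero)
  show "AE x in \<xi>. max (P x) 0 = rep (pos \<phi>) x"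
    using rep_pos[of \<phi>] P(2) by eventually_elim auto
  show "cap_null {x\<in>X. Y x = 0 \<and> 0 < max (P x) 0}"
    using null by (rule cap_null_mono) auto
qed

text \<open>Only the positive part of a direction has to be approximated: subtracting a non-negative
  function keeps the radial cone, and by \<open>dist_minus_pos\<close> it does not change the
  error.\<close>

lemma minus_pos_in_radial_cone:
  assumes "\<psi> \<in> below_multiple y p"
  shows "\<psi> - pos (- \<phi>) \<in> radial_cone y"
proof -
  obtain n :: nat where "\<psi> \<preceq> real n *\<^sub>R y" using assms unfolding below_multiple_def by blast
  from le_add_mono[OF this, of "- pos (- \<phi>)" 0] have "\<psi> - pos (- \<phi>) \<preceq> real n *\<^sub>R y"
    by (simp add: neg_le_zero_iff pos_nonneg)
  then show ?thesis unfolding radial_cone_def by blast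
qed

lemma dist_minus_pos: "dist (\<psi> - pos (- \<phi>)) \<phi> = dist \<psi> (pos \<phi>)"
  by (subst (2) pos_minus_pos[of \<phi>, symmetric]) (simp add: dist_norm)

lemma tangent_iff_quasi_everywhere:
  assumes y: "0 \<preceq> y" and Y: "quasi Y" "AE x in \<xi>. Y x = rep y x"
    and P: "quasi P" "AE x in \<xi>. P x = rep \<phi> x"
  shows "\<phi> \<in> closure (radial_cone y) \<longleftrightarrow> cap_null {x\<in>X. Y x = 0 \<and> 0 < P x}"
proof
  assume null: "cap_null {x\<in>X. Y x = 0 \<and> 0 < P x}"
  show "\<phi> \<in> closure (radial_cone y)"
    unfolding closure_approachable
  proof (intro allI impI)
    fix e :: real assume "e > 0"
    then obtain \<psi> where \<psi>: "\<psi> \<in> below_multiple y (pos \<phi>)" "dist \<psi> (pos \<phi>) < e"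
      using quasi_everywhere_imp_approx[OF assms null] unfolding closure_approachable by blast
    then show "\<exists>\<psi>\<in>radial_cone y. dist \<psi> \<phi> < e"
      using minus_pos_in_radial_cone[OF \<psi>(1)] dist_minus_pos[of \<psi> \<phi>] by metis
  qed
qed (rule tangent_imp_quasi_everywhere[OF Y P])

text \<open>The approximants of the positive part lie between 0 and multiples of \<open>y\<close>,
  so \<open>l\<close> vanishes on them, hence on the positive part, hence on the negative part.
  Approximants of \<phi> thus stay in the kernel.\<close>

lemma tangent_polyhedric:
  fixes l :: "'v \<Rightarrow>\<^sub>L real"
  assumes y: "0 \<preceq> y" and l: "l \<in> dual_plus \<xi> rep" "l y = 0"
    and \<phi>: "\<phi> \<in> closure (radial_cone y)" "l \<phi> = 0"
  shows "\<phi> \<in> closure (radial_cone y \<inter> {\<psi>. l \<psi> = 0})"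
proof -
  obtain Y where Y: "quasi Y" "AE x in \<xi>. Y x = rep y x" using exists_quasi_continuous_rep by blast
  obtain P where P: "quasi P" "AE x in \<xi>. P x = rep \<phi> x" using exists_quasi_continuous_rep by blast
  have p: "pos \<phi> \<in> closure (below_multiple y (pos \<phi>))"
    using tangent_imp_quasi_everywhere[OF Y P \<phi>(1)] by (rule quasi_everywhere_imp_approx[OF y Y P])
  have l0: "l \<psi> = 0" if \<psi>: "\<psi> \<in> below_multiple y (pos \<phi>)" for \<psi>
  proof -
    obtain n :: nat where n: "0 \<preceq> \<psi>" "\<psi> \<preceq> real n *\<^sub>R y" using \<psi> unfolding below_multiple_def by blast
    have "0 \<le> l (real n *\<^sub>R y - \<psi>)" "0 \<le> l \<psi>"
      using n by (auto intro!: dual_plusD[OF l(1)] simp: le_iff_diff_ge[symmetric])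
    then show ?thesis using l(2) by (simp add: form_simps)
  qed
  have "closed {\<psi>. l \<psi> = 0}" by (intro closed_Collect_eq continuous_intros)
  then have "closure (below_multiple y (pos \<phi>)) \<subseteq> {\<psi>. l \<psi> = 0}"
    using l0 by (intro closure_minimal) auto
  then have "l (pos \<phi>) = 0" using p by auto
  then have lm: "l (pos (- \<phi>)) = 0"
    using \<phi>(2) by (subst (asm) pos_minus_pos[of \<phi>, symmetric]) (simp add: form_simps)
  show ?thesis
    unfolding closure_approachable
  proof (intro allI impI)
    fix e :: real assume "e > 0"
    then obtain \<psi> where \<psi>: "\<psi> \<in> below_multiple y (pos \<phi>)" "dist \<psi> (pos \<phi>) < e"
      using p unfolding closure_approachable by blast
    moreover have "l (\<psi> - pos (- \<phi>)) = 0" using l0[OF \<psi>(1)] lm by (simp add: form_simps)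
    ultimately show "\<exists>\<psi>\<in>radial_cone y \<inter> {\<psi>. l \<psi> = 0}. dist \<psi> \<phi> < e"
      using minus_pos_in_radial_cone[OF \<psi>(1)] \<psi>(2) dist_minus_pos[of \<psi> \<phi>]
      by (intro bexI[of _ "\<psi> - pos (- \<phi>)"]) auto
  qed
qed

end

section \<open>Differentiability of solutions of variational inequalities\<close>

lemma convex_blinfun_vimage: "convex S \<Longrightarrow> convex (blinfun_apply l -` S)"
  by (rule convex_linear_vimage[OF bounded_linear.linear[OF blinfun.bounded_linear_right]])

lemma closed_blinfun_vimage: "closed S \<Longrightarrow> closed (blinfun_apply l -` S)"
  by (intro closed_vimage continuous_intros)

context coercive_form
begin

text \<open>The theorem of Haraux and Mignot on polyhedric sets, with the obstacle perturbed as well. The difference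
  quotients lie in bounded closed convex sets that shrink into the critical cone \<open>C\<close>; their
  common points replace weak limits.\<close>

lemma vi_directional_derivative:
  assumes K: "convex K" and w0: "vi_solves K f \<psi> w0"
    and w: "\<And>t. t > 0 \<Longrightarrow> vi_solves K (f + t *\<^sub>R d) (\<psi> + t *\<^sub>R \<eta>) (w t)"
    and T: "closed T" "convex T" "\<And>k s. k \<in> K \<Longrightarrow> s > 0 \<Longrightarrow> s *\<^sub>R (k - (w0 - \<psi>)) \<in> T"
    and C: "C = T \<inter> {\<phi>. (A w0 - f) \<phi> = 0}"
    and dense: "C \<subseteq> closure {\<phi>. (A w0 - f) \<phi> = 0 \<and> (\<exists>s>0. (w0 - \<psi>) + s *\<^sub>R \<phi> \<in> K)}"
    and \<delta>: "vi_solves C d \<eta> \<delta>"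
  shows "((\<lambda>t. (1 / t) *\<^sub>R (w t - w0)) \<longlongrightarrow> \<delta>) (at_right 0)"
proof -
  \<comment> \<open>The multiplier at the base point is non-negative on feasible directions;
    critical directions are those on which it vanishes.\<close>
  define \<mu> where "\<mu> = A w0 - f"
  define y0 where "y0 = w0 - \<psi>"
  define D where "D t = (1 / t) *\<^sub>R (w t - w0)" for t
  define \<beta> where "\<beta> t = D t - \<eta>" for t
  define \<beta>0 where "\<beta>0 = \<delta> - \<eta>"
  have y0: "y0 \<in> K" and \<mu>_K: "\<And>k. k \<in> K \<Longrightarrow> 0 \<le> \<mu> (k - y0)"
    using w0 by (auto simp: vi_solves_def y0_def \<mu>_def form_simps)
  have wD: "w t = w0 + t *\<^sub>R D t" if "t > 0" for t using that by (simp add: D_def)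
  have in_K: "y0 + t *\<^sub>R \<beta> t \<in> K" if "t > 0" for t
    using w[OF that] wD[OF that] by (simp add: vi_solves_def y0_def \<beta>_def algebra_simps)
  have \<beta>_T: "\<beta> t \<in> T" if "t > 0" for t
    using T(3)[OF in_K[OF that], of "1 / t"] that by (simp add: y0_def)
  have \<mu>\<beta>: "0 \<le> \<mu> (\<beta> t)" if "t > 0" for t
    using \<mu>_K[OF in_K[OF that]] that by (simp add: form_simps zero_le_mult_iff)
  \<comment> \<open>The multiplier term carries no factor \<open>t\<close>, which forces
    \<open>\<mu> (\<beta> t)\<close> to be of order \<open>t\<close>. Testing with
    \<open>\<mu> \<phi> = 0\<close> leaves the linearised inequality.\<close>
  have vi: "\<mu> (\<beta> t - \<phi>) + t * (A (D t) - d) (\<beta> t - \<phi>) \<le> 0" if "t > 0" "y0 + t *\<^sub>R \<phi> \<in> K" for t \<phi>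
  proof -
    have "(A (w t) - (f + t *\<^sub>R d)) (w t - (\<psi> + t *\<^sub>R \<eta>) - (y0 + t *\<^sub>R \<phi>)) \<le> 0"
      using w[OF that(1)] that(2) unfolding vi_solves_def by blast
    moreover have "w t - (\<psi> + t *\<^sub>R \<eta>) - (y0 + t *\<^sub>R \<phi>) = t *\<^sub>R (\<beta> t - \<phi>)"
      using wD[OF that(1)] by (simp add: y0_def \<beta>_def algebra_simps)
    moreover have "A (w t) - (f + t *\<^sub>R d) = \<mu> + t *\<^sub>R (A (D t) - d)"
      unfolding wD[OF that(1)] by (simp add: A_add A_scale \<mu>_def algebra_simps)
    ultimately have "t * (\<mu> (\<beta> t - \<phi>) + t * (A (D t) - d) (\<beta> t - \<phi>)) \<le> 0"
      by (simp add: blinfun.scaleR_right blinfun.add_left blinfun.scaleR_left)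
    then show ?thesis using that(1) by (simp add: mult_le_0_iff)
  qed
  have vi0: "\<mu> (\<beta> t) + t * (A (D t) - d) (\<beta> t) \<le> 0" if "t > 0" for t
    using vi[OF that, of 0] y0 by simp
  define a where "a = M * norm \<eta> + norm d"
  define b where "b = norm d * norm \<eta>"
  \<comment> \<open>For quotients of norm above 1 coercivity gives the bound
    \<open>(a + b) / c\<close>; the summand 1 covers the others.\<close>
  define B where "B = 1 + (a + b) / c"
  have ab: "0 \<le> a" "0 \<le> b" using M_nonneg by (auto simp: a_def b_def)
  have D_bound: "norm (D t) \<le> B" if "t > 0" for t
  proof (cases "norm (D t) \<le> 1")
    case True
    then show ?thesis using ab c_pos by (simp add: B_def add_increasing2)
  next
    case False
    have "t * (A (D t) - d) (\<beta> t) \<le> 0" using vi0[OF that] \<mu>\<beta>[OF that] by linarith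
    then have "(A (D t) - d) (\<beta> t) \<le> 0" using that by (simp add: mult_le_0_iff)
    then have "A (D t) (D t) \<le> A (D t) \<eta> + d (D t) - d \<eta>" by (simp add: \<beta>_def form_simps)
    moreover have "A (D t) \<eta> \<le> M * norm (D t) * norm \<eta>" using form_bounded[of "D t" \<eta>] by linarith
    moreover have "d (D t) \<le> norm d * norm (D t)" "- d \<eta> \<le> norm d * norm \<eta>"
      using norm_blinfun[of d "D t"] norm_blinfun[of d \<eta>] by auto
    ultimately have "c * (norm (D t))\<^sup>2 \<le> a * norm (D t) + b"
      using form_coercive[of "D t"] by (simp add: a_def b_def algebra_simps)
    also have "\<dots> \<le> a * norm (D t) + b * norm (D t)"
      using False ab mult_left_mono[of 1 "norm (D t)" b] by simp
    finally have "(c * norm (D t)) * norm (D t) \<le> (a + b) * norm (D t)"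
      by (simp add: power2_eq_square algebra_simps)
    then have "c * norm (D t) \<le> a + b" using False by (metis mult_right_le_imp_le not_le zero_less_one less_trans)
    then show ?thesis using c_pos by (simp add: B_def field_simps)
  qed
  have B0: "B \<ge> 0" using ab c_pos by (simp add: B_def)
  define R where "R = B + norm \<eta>"
  define L where "L = M * B + norm d + 1"
  have L: "L > 0" using M_nonneg B0 by (simp add: L_def add_nonneg_pos)
  have \<beta>_bound: "norm (\<beta> t) \<le> R" if "t > 0" for t
    using D_bound[OF that] norm_triangle_ineq4[of "D t" \<eta>] by (simp add: \<beta>_def R_def)
  have AD: "\<bar>(A (D t) - d) z\<bar> \<le> L * norm z" if "t > 0" for t z
  proof -
    have "norm (A (D t)) \<le> M * B"
      using norm_A_le[of "D t"] mult_left_mono[OF D_bound[OF that] M_nonneg] by linarith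
    then have "norm (A (D t) - d) \<le> L" using norm_triangle_ineq4[of "A (D t)" d] by (simp add: L_def)
    then show ?thesis using norm_blinfun[of "A (D t) - d" z]
      by (metis mult_right_mono norm_ge_zero order_trans real_norm_def)
  qed
  have R0: "0 \<le> R" using B0 by (simp add: R_def)
  have \<mu>\<beta>_small: "\<mu> (\<beta> t) \<le> t * (L * R)" if "t > 0" for t
  proof -
    have "- (A (D t) - d) (\<beta> t) \<le> L * norm (\<beta> t)" using AD[OF that, of "\<beta> t"] by linarith
    also have "\<dots> \<le> L * R" using \<beta>_bound[OF that] L by (intro mult_left_mono) auto
    finally have "t * (- (A (D t) - d) (\<beta> t)) \<le> t * (L * R)" using that by (intro mult_left_mono) auto
    then show ?thesis using vi0[OF that] by linarith
  qed
  have \<beta>0: "\<beta>0 \<in> C" using \<delta> by (simp add: vi_solves_def \<beta>0_def)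
  define l where "l = A \<delta> - d"
  have l_C: "l (\<beta>0 - \<phi>) \<le> 0" if "\<phi> \<in> C" for \<phi>
    using \<delta> that unfolding vi_solves_def \<beta>0_def l_def by blast
  \<comment> \<open>Otherwise offending quotients make the nested sets \<open>E n\<close> non-empty.
    A common point has zero multiplier, hence is critical, and contradicts the optimality of
    \<delta>.\<close>
  have limsup: "\<exists>\<tau>>0. \<forall>t>0. t < \<tau> \<longrightarrow> l (\<beta>0 - \<beta> t) < e" if "e > 0" for e
  proof (rule ccontr)
    assume not: "\<not> ?thesis"
    define a' where "a' n = (L * R) * (1 / real (Suc n))" for n
    define E where "E n = T \<inter> cball 0 R \<inter> \<mu> -` {0..a' n} \<inter> l -` {..l \<beta>0 - e}" for n
    have "\<exists>\<phi>. \<forall>n. \<phi> \<in> E n"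
    proof (rule Cantor_convex_intersection)
      show "closed (E n)" "convex (E n)" for n
        unfolding E_def using T(1,2)
        by (intro closed_Int convex_Int closed_blinfun_vimage convex_blinfun_vimage; simp)+
      show "bounded (E 0)" unfolding E_def by (simp add: bounded_Int)
      have "a' (Suc n) \<le> a' n" for n
        unfolding a'_def using L R0 by (intro mult_left_mono) (auto simp: frac_le)
      then show "E (Suc n) \<subseteq> E n" for n
        unfolding E_def by (intro Int_mono vimage_mono order_refl) simp
      show "E n \<noteq> {}" for n
      proof -
        obtain t where t: "t > 0" "t < 1 / real (Suc n)" "e \<le> l (\<beta>0 - \<beta> t)"
          using not[simplified, rule_format, of "1 / real (Suc n)"] by (auto simp: not_less)
        have "\<mu> (\<beta> t) \<le> a' n"
          unfolding a'_def using \<mu>\<beta>_small[OF t(1)] mult_right_mono[of t "1 / real (Suc n)" "L * R"] t L R0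
          by (simp add: mult.commute)
        then have "\<beta> t \<in> E n"
          using \<beta>_T[OF t(1)] \<beta>_bound[OF t(1)] \<mu>\<beta>[OF t(1)] t(3) by (simp add: E_def blinfun.diff_right)
        then show ?thesis by blast
      qed
    qed
    then obtain \<phi> where \<phi>: "\<And>n. \<phi> \<in> E n" by blast
    have "a' \<longlonglongrightarrow> (L * R) * 0"
      unfolding a'_def by (intro tendsto_intros LIMSEQ_Suc[OF lim_1_over_n])
    then have "\<mu> \<phi> \<le> (L * R) * 0"
      using \<phi> by (intro LIMSEQ_le_const) (auto simp: E_def)
    then have "\<phi> \<in> C" using \<phi>[of 0] by (auto simp: E_def C \<mu>_def)
    then show False using l_C[of \<phi>] \<phi>[of 0] \<open>e > 0\<close> by (simp add: E_def blinfun.diff_right)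
  qed
  have "((\<lambda>t. D t) \<longlongrightarrow> \<delta>) (at_right 0)"
  proof (rule tendstoI)
    fix r :: real assume "r > 0"
    \<comment> \<open>Two errors of size \<open>e\<close> occur, from density and from
      \<open>limsup\<close>; coercivity converts their sum into a distance below
      \<open>r\<close>.\<close>
    define e where "e = c * r\<^sup>2 / 4"
    have e: "e > 0" using \<open>r > 0\<close> c_pos by (simp add: e_def)
    obtain \<tau> where \<tau>: "\<tau> > 0" "\<And>t. t > 0 \<Longrightarrow> t < \<tau> \<Longrightarrow> l (\<beta>0 - \<beta> t) < e" using limsup[OF e] by blast
    have "e / L > 0" using e L by simp
    then obtain \<phi> where "\<phi> \<in> {\<phi>. (A w0 - f) \<phi> = 0 \<and> (\<exists>s>0. (w0 - \<psi>) + s *\<^sub>R \<phi> \<in> K)}" "dist \<phi> \<beta>0 < e / L"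
      using subsetD[OF dense \<beta>0] unfolding closure_approachable by blast
    then obtain s where \<phi>: "\<mu> \<phi> = 0" "s > 0" "y0 + s *\<^sub>R \<phi> \<in> K" "norm (\<phi> - \<beta>0) < e / L"
      by (auto simp: \<mu>_def y0_def dist_norm)
    have "dist (D t) \<delta> < r" if t: "t > 0" "t < min \<tau> s" for t
    proof -
      \<comment> \<open>By convexity a direction feasible at step \<open>s\<close> is feasible at
        every smaller step, so \<phi> can stay fixed while \<open>t\<close> tends to 0.\<close>
      have "(1 - t / s) *\<^sub>R y0 + (t / s) *\<^sub>R (y0 + s *\<^sub>R \<phi>) \<in> K"
        using K y0 \<phi> t by (intro convexD) auto
      then have "y0 + t *\<^sub>R \<phi> \<in> K" using \<phi>(2) by (simp add: algebra_simps)
      from vi[OF t(1) this] have "t * (A (D t) - d) (\<beta> t - \<phi>) \<le> 0"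
        using \<mu>\<beta>[OF t(1)] \<phi>(1) by (simp add: blinfun.diff_right)
      then have 1: "(A (D t) - d) (\<beta> t - \<phi>) \<le> 0" using t by (simp add: mult_le_0_iff)
      have "(A (D t) - d) (\<phi> - \<beta>0) \<le> L * norm (\<phi> - \<beta>0)" using AD[OF t(1)] by (metis abs_le_D1)
      also have "\<dots> \<le> L * (e / L)" using \<phi>(4) L by (intro mult_left_mono) auto
      finally have 2: "(A (D t) - d) (\<phi> - \<beta>0) \<le> e" using L by simp
      have 3: "l (\<beta>0 - \<beta> t) < e" using \<tau>(2) t by simp
      have "A (D t - \<delta>) (D t - \<delta>) = A (D t - \<delta>) (\<beta> t - \<beta>0)" by (simp add: \<beta>_def \<beta>0_def)
      also have "\<dots> = (A (D t) - d) (\<beta> t - \<phi>) + (A (D t) - d) (\<phi> - \<beta>0) + l (\<beta>0 - \<beta> t)"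
        by (simp add: l_def form_simps algebra_simps)
      finally have "c * (norm (D t - \<delta>))\<^sup>2 < 2 * e"
        using form_coercive[of "D t - \<delta>"] 1 2 3 by linarith
      also have "\<dots> \<le> c * r\<^sup>2" using c_pos by (simp add: e_def)
      finally have "(norm (D t - \<delta>))\<^sup>2 < r\<^sup>2" using c_pos by simp
      then show ?thesis
        unfolding dist_norm by (rule power_less_imp_less_base) (use \<open>r > 0\<close> in auto)
    qed
    then show "\<forall>\<^sub>F t in at_right 0. dist (D t) \<delta> < r"
      unfolding eventually_at_right_field using \<tau>(1) \<phi>(2) by (intro exI[of _ "min \<tau> s"]) auto
  qed
  then show ?thesis unfolding D_def .
qed

end

section \<open>Hadamard differentiable maps\<close>

lemma hadamard_quotient:
  assumes "has_hadamard_derivative F v h L"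
  shows "((\<lambda>t. (1 / t) *\<^sub>R (F (v + t *\<^sub>R h) - F v)) \<longlongrightarrow> L) (at_right 0)"
proof -
  have "filterlim (\<lambda>t. (t, h)) (at_right (0::real) \<times>\<^sub>F nhds h) (at_right 0)"
    by (intro filterlim_Pair filterlim_ident tendsto_const)
  from filterlim_compose[OF assms[unfolded has_hadamard_derivative_def] this] show ?thesis by simp
qed

lemma hadamard_quotient_bound:
  assumes "has_hadamard_derivative F v h L" "norm L < m"
  shows "\<exists>\<tau>>0. \<forall>t\<ge>0. t < \<tau> \<longrightarrow> norm (F (v + t *\<^sub>R h) - F v) \<le> m * t"
proof -
  have "\<forall>\<^sub>F t in at_right 0. norm ((1 / t) *\<^sub>R (F (v + t *\<^sub>R h) - F v)) < m"
    using tendsto_norm[OF hadamard_quotient[OF assms(1)]] assms(2) by (rule order_tendstoD(2))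
  then obtain \<tau> where \<tau>: "\<tau> > 0" "\<And>t. t > 0 \<Longrightarrow> t < \<tau> \<Longrightarrow> norm ((1 / t) *\<^sub>R (F (v + t *\<^sub>R h) - F v)) < m"
    unfolding eventually_at_right_field by blast
  have "norm (F (v + t *\<^sub>R h) - F v) \<le> m * t" if "t \<ge> 0" "t < \<tau>" for t
  proof (cases "t = 0")
    case False
    then have "norm (F (v + t *\<^sub>R h) - F v) / t < m"
      using \<tau>(2)[of t] that unfolding norm_scaleR by simp
    then show ?thesis using False that by (simp add: field_simps)
  qed simp
  then show ?thesis using \<tau>(1) by blast
qed

text \<open>A mean value inequality from one-sided derivatives: the estimate with slack \<epsilon>
  adds up over adjacent intervals and holds on short intervals around each point, so bisection
  extends it to the segment.\<close>

lemma lipschitz_of_hadamard_derivative_bound: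
  fixes F :: "'v::real_normed_vector \<Rightarrow> 'w::real_normed_vector"
  assumes F: "\<And>v h. has_hadamard_derivative F v h (F' v h)"
    and C: "\<And>z v. z \<in> S \<Longrightarrow> norm (F' z v) \<le> C * norm v"
    and S: "convex S" "a \<in> S" "b \<in> S"
  shows "norm (F b - F a) \<le> C * norm (b - a)"
proof (rule field_le_epsilon)
  fix \<epsilon> :: real assume "\<epsilon> > 0"
  define m where "m = C * norm (b - a) + \<epsilon>"
  define p where "p s = a + s *\<^sub>R (b - a)" for s
  have "norm (F (p 1) - F (p 0)) \<le> m * (1 - 0)"
  proof (rule Bolzano[of 0 1 "\<lambda>x y. norm (F (p y) - F (p x)) \<le> m * (y - x)"])
    fix x y z
    assume "norm (F (p y) - F (p x)) \<le> m * (y - x)" "norm (F (p z) - F (p y)) \<le> m * (z - y)"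
    then show "norm (F (p z) - F (p x)) \<le> m * (z - x)"
      using norm_triangle_ineq[of "F (p z) - F (p y)" "F (p y) - F (p x)"] by (simp add: algebra_simps)
  next
    fix x :: real assume x: "0 \<le> x" "x \<le> 1"
    have "p x \<in> S" using convexD[OF S, of "1 - x" x] x by (simp add: p_def algebra_simps)
    \<comment> \<open>The derivative need not be odd, so each side of \<open>x\<close> requires its
      own direction.\<close>
    then have m: "norm (F' (p x) (b - a)) < m" "norm (F' (p x) (a - b)) < m"
      using C[of "p x" "b - a"] C[of "p x" "a - b"] \<open>\<epsilon> > 0\<close> by (auto simp: m_def norm_minus_commute)
    obtain r where r: "r > 0" "\<And>t. t \<ge> 0 \<Longrightarrow> t < r \<Longrightarrow> norm (F (p x + t *\<^sub>R (b - a)) - F (p x)) \<le> m * t"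
      using hadamard_quotient_bound[OF F m(1)] by blast
    obtain s where s: "s > 0" "\<And>t. t \<ge> 0 \<Longrightarrow> t < s \<Longrightarrow> norm (F (p x + t *\<^sub>R (a - b)) - F (p x)) \<le> m * t"
      using hadamard_quotient_bound[OF F m(2)] by blast
    have "norm (F (p z) - F (p y)) \<le> m * (z - y)" if "y \<le> x" "x \<le> z" "z - y < min r s" for y z
    proof -
      have "p z = p x + (z - x) *\<^sub>R (b - a)" "p y = p x + (x - y) *\<^sub>R (a - b)"
        by (simp_all add: p_def algebra_simps)
      then have "norm (F (p z) - F (p x)) \<le> m * (z - x)" "norm (F (p y) - F (p x)) \<le> m * (x - y)"
        using r(2)[of "z - x"] s(2)[of "x - y"] that by auto
      then show ?thesis
        using norm_triangle_ineq4[of "F (p z) - F (p x)" "F (p y) - F (p x)"] by (simp add: algebra_simps)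
    qed
    then show "\<exists>d>0. \<forall>y z. y \<le> x \<and> x \<le> z \<and> z - y < d \<longrightarrow> norm (F (p z) - F (p y)) \<le> m * (z - y)"
      using r(1) s(1) by (intro exI[of _ "min r s"]) auto
  qed simp
  then show "norm (F b - F a) \<le> C * norm (b - a) + \<epsilon>" by (simp add: p_def m_def)
qed

text \<open>Difference quotients inherit the Lipschitz constant of \<open>F\<close>. As the
  derivative may be non-linear in the direction, a bound on its size alone would not give
  this.\<close>

lemma hadamard_derivative_lipschitz:
  fixes F :: "'v::real_normed_vector \<Rightarrow> 'w::real_normed_vector"
  assumes F: "\<And>h. has_hadamard_derivative F u h (F' h)"
    and lip: "\<And>a b. a \<in> cball u e \<Longrightarrow> b \<in> cball u e \<Longrightarrow> norm (F b - F a) \<le> C * norm (b - a)" and "e > 0"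
  shows "norm (F' h - F' k) \<le> C * norm (h - k)"
proof (rule tendsto_upperbound)
  let ?q = "\<lambda>h t. (1 / t) *\<^sub>R (F (u + t *\<^sub>R h) - F u)"
  show "((\<lambda>t. norm (?q h t - ?q k t)) \<longlongrightarrow> norm (F' h - F' k)) (at_right 0)"
    by (intro tendsto_intros hadamard_quotient F)
  have *: "\<forall>\<^sub>F t in at_right 0. u + t *\<^sub>R h \<in> cball u e" for h
  proof -
    have "((\<lambda>t. u + t *\<^sub>R h) \<longlongrightarrow> u + 0 *\<^sub>R h) (at_right 0)" by (intro tendsto_intros)
    then have "\<forall>\<^sub>F t in at_right 0. dist (u + t *\<^sub>R h) (u + 0 *\<^sub>R h) < e" using \<open>e > 0\<close> by (rule tendstoD)
    then show ?thesis by eventually_elim (auto simp: dist_commute less_imp_le)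
  qed
  show "\<forall>\<^sub>F t in at_right 0. norm (?q h t - ?q k t) \<le> C * norm (h - k)"
    using *[of h] *[of k] eventually_at_right_less[of 0]
  proof eventually_elim
    case (elim t)
    have "?q h t - ?q k t = (1 / t) *\<^sub>R (F (u + t *\<^sub>R h) - F (u + t *\<^sub>R k))"
      by (simp add: algebra_simps)
    moreover have "norm (F (u + t *\<^sub>R h) - F (u + t *\<^sub>R k)) \<le> C * norm (t *\<^sub>R (h - k))"
      using lip[OF elim(2,1)] by (simp add: algebra_simps)
    ultimately show ?case
      using elim(3) by (simp only: norm_scaleR) (simp add: pos_divide_le_eq mult_ac)
  qed
qed simp

section \<open>The quasi-variational inequality\<close>

context qvi_setting
begin

text \<open>For \<open>g\<close> near \<open>f\<close>, the contraction principle on a ball around \<open>u\<close> gives a solution close to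
  \<open>u\<close>, which the order argument alone does not.\<close>

lemma exists_QVI_in_order_interval:
  assumes u: "u \<in> QVI \<xi> rep A \<Phi> f" and u0: "0 \<preceq> u" and g: "g - f \<in> dual_plus \<xi> rep"
    and lip: "\<And>a b. a \<in> cball u e \<Longrightarrow> b \<in> cball u e \<Longrightarrow>
      norm (\<Phi> (rep b) - \<Phi> (rep a)) \<le> C * norm (b - a)"
    and C: "C \<ge> 0" "k = max C\<^sub>b 0 / C\<^sub>a * C" "k < 1" and e: "e > 0"
  shows "\<exists>q\<in>QVI \<xi> rep A \<Phi> g. u \<preceq> q \<and> q \<preceq> linear_solution A g \<and>
    (norm (g - f) \<le> C\<^sub>a * ((1 - k) * e) \<longrightarrow> q \<in> cball u e)"
proof -
  have upper: "q \<preceq> linear_solution A g" if "q \<in> QVI \<xi> rep A \<Phi> g" for q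
    using that obst_le_linear_solution unfolding QVI_iff by blast
  show ?thesis
  proof (cases "norm (g - f) \<le> C\<^sub>a * ((1 - k) * e)")
    case False
    then show ?thesis using exists_QVI_above[OF u u0 g] upper by blast
  next
    case True
    have fix_u: "qvi_map f u = u" using u by (simp add: QVI_iff_fixed_point)
    have k0: "0 \<le> k" using C Ca_pos by simp
    have contr: "norm (qvi_map g a - qvi_map g b) \<le> k * norm (a - b)" if "a \<in> cball u e" "b \<in> cball u e" for a b
    proof -
      have "C\<^sub>a * norm (qvi_map g a - qvi_map g b) \<le> max C\<^sub>b 0 * norm (\<Phi> (rep a) - \<Phi> (rep b))"
        by (rule vi_solves_lipschitz_obstacle[OF obst_solves obst_solves])
      also have "\<dots> \<le> max C\<^sub>b 0 * (C * norm (a - b))" using lip[OF that(2,1)] by (intro mult_left_mono) auto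
      finally show ?thesis using Ca_pos unfolding C(2) by (simp add: field_simps)
    qed
    have "C\<^sub>a * norm (qvi_map g u - qvi_map f u) \<le> norm (g - f)"
      by (rule vi_solves_lipschitz_source[OF obst_solves obst_solves])
    then have "C\<^sub>a * norm (qvi_map g u - u) \<le> C\<^sub>a * ((1 - k) * e)" using True fix_u by simp
    \<comment> \<open>Changing the source uses the share \<open>1 - k\<close> of the radius; the
      contraction adds at most \<open>k * e\<close>, so the ball is mapped into itself.\<close>
    then have near: "norm (qvi_map g u - u) \<le> (1 - k) * e" using Ca_pos by simp
    \<comment> \<open>Building the order constraint into the domain makes the fixed point lie above
      \<open>u\<close>.\<close>
    define S where "S = cball u e \<inter> {w. u \<preceq> w}"
    have "\<exists>!q\<in>S. qvi_map g q = q"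
    proof (rule Banach_fix[OF _ _ k0 C(3)])
      show "complete S" unfolding S_def complete_eq_closed by (intro closed_Int closed_cball closed_ge)
      have "u \<in> S" using e by (simp add: S_def)
      then show "S \<noteq> {}" by blast
      show "qvi_map g ` S \<subseteq> S"
      proof
        fix z assume "z \<in> qvi_map g ` S"
        then obtain w where w: "w \<in> cball u e" "u \<preceq> w" "z = qvi_map g w" unfolding S_def by blast
        have "norm (qvi_map g w - qvi_map g u) \<le> k * norm (w - u)" using w e by (intro contr) auto
        also have "\<dots> \<le> k * e" using w k0 by (intro mult_left_mono) (auto simp: dist_norm norm_minus_commute)
        finally have "norm (z - u) \<le> e"
          using near norm_triangle_ineq[of "z - qvi_map g u" "qvi_map g u - u"] w by (simp add: algebra_simps)
        moreover have "u \<preceq> z" using qvi_map_mono[OF w(2) g] fix_u w(3) by simp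
        ultimately show "z \<in> S" by (simp add: S_def dist_norm norm_minus_commute)
      qed
    qed (auto simp: S_def dist_norm intro: contr)
    then obtain q where "q \<in> S" "qvi_map g q = q" by blast
    then have "q \<in> QVI \<xi> rep A \<Phi> g" "u \<preceq> q" "q \<in> cball u e"
      by (simp_all add: S_def QVI_iff_fixed_point)
    then show ?thesis using upper by blast
  qed
qed

text \<open>The coincidence set is the zero set of the quasi-continuous gap \<open>Y\<close> between
  obstacle and solution, so the capacity description of the tangent cone applies.\<close>

lemma critical_set_iff:
  assumes "0 \<preceq> \<Phi> (rep u) - u"
  shows "v \<in> critical_set X \<xi> rep A \<Phi> \<Phi>' f u w \<longleftrightarrow>
    v - \<Phi>' u w \<in> closure (radial_cone (\<Phi> (rep u) - u)) \<inter> {\<phi>. (A u - f) \<phi> = 0}"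
proof -
  define Y where "Y x = qc_rep X \<xi> rep (\<Phi> (rep u)) x - qc_rep X \<xi> rep u x" for x
  define P where "P x = qc_rep X \<xi> rep v x - qc_rep X \<xi> rep (\<Phi>' u w) x" for x
  have Y: "quasi Y" "AE x in \<xi>. Y x = rep (\<Phi> (rep u) - u) x"
    unfolding Y_def
    subgoal by (intro quasi_diff qc_rep(1))
    subgoal using qc_rep(2)[of u] qc_rep(2)[of "\<Phi> (rep u)"] rep_diff[of "\<Phi> (rep u)" u]
      by eventually_elim simp
    done
  have P: "quasi P" "AE x in \<xi>. P x = rep (v - \<Phi>' u w) x"
    unfolding P_def
    subgoal by (intro quasi_diff qc_rep(1))
    subgoal using qc_rep(2)[of v] qc_rep(2)[of "\<Phi>' u w"] rep_diff[of v "\<Phi>' u w"]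
      by eventually_elim simp
    done
  have "{x \<in> coincidence_set X \<xi> rep \<Phi> u. \<not> qc_rep X \<xi> rep v x \<le> qc_rep X \<xi> rep (\<Phi>' u w) x} =
      {x\<in>X. Y x = 0 \<and> 0 < P x}"
    unfolding coincidence_set_def Y_def P_def by auto
  then show ?thesis
    unfolding critical_set_def qe_on_def Int_iff tangent_iff_quasi_everywhere[OF assms Y P] cap_null_def
    by simp
qed

lemma QVI_directional_derivative:
  assumes u: "u \<in> QVI \<xi> rep A \<Phi> f"
    and A1: "\<And>v h. has_hadamard_derivative (\<lambda>w. \<Phi> (rep w)) v h (\<Phi>' v h)"
    and lip: "\<And>a b. a \<in> cball u e \<Longrightarrow> b \<in> cball u e \<Longrightarrow>
      norm (\<Phi> (rep b) - \<Phi> (rep a)) \<le> C * norm (b - a)"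
    and C: "C \<ge> 0" "k = max C\<^sub>b 0 / C\<^sub>a * C" "k < 1" and e: "e > 0"
    and q: "\<And>t. t > 0 \<Longrightarrow> q t \<in> QVI \<xi> rep A \<Phi> (f + t *\<^sub>R d)" "\<And>t. t > 0 \<Longrightarrow> u \<preceq> q t"
      "\<forall>\<^sub>F t in at_right 0. q t \<in> cball u e"
  shows "\<exists>\<alpha>. ((\<lambda>t. (1 / t) *\<^sub>R (q t - (u + t *\<^sub>R \<alpha>))) \<longlongrightarrow> 0) (at_right 0) \<and> 0 \<preceq> \<alpha> \<and>
    \<alpha> \<in> critical_set X \<xi> rep A \<Phi> \<Phi>' f u \<alpha> \<and>
    (\<forall>v\<in>critical_set X \<xi> rep A \<Phi> \<Phi>' f u \<alpha>. (A \<alpha> - d) (\<alpha> - v) \<le> 0)"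
proof -
  define y where "y = \<Phi> (rep u) - u"
  define K where "K = closure (radial_cone y) \<inter> {\<phi>. (A u - f) \<phi> = 0}"
  have vi_u: "vi_solves cone_neg f (\<Phi> (rep u)) u" using u by (simp add: QVI_iff)
  have y: "0 \<preceq> y"
    using vi_u le_iff_diff_le[of u "\<Phi> (rep u)"] le_iff_diff_ge[of u "\<Phi> (rep u)"]
    by (simp add: vi_solves_def cone_neg_def y_def)
  have test: "(A u - f) (- y - k) \<le> 0" if "k \<preceq> 0" for k
    using vi_u that by (simp add: vi_solves_def cone_neg_def y_def)
  \<comment> \<open>Testing with 0 and with twice \<open>- y\<close> gives complementarity; testing
    with \<open>- y - v\<close> below gives the sign of the multiplier.\<close>
  have "(- y) + (- y) \<preceq> 0 + 0" by (intro le_add_mono) (simp_all add: neg_le_zero_iff y)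
  then have "(A u - f) y = 0"
    using test[of 0] test[of "- y + - y"] by (simp add: blinfun.minus_right)
  moreover have "0 \<le> (f - A u) v" if "0 \<preceq> v" for v
  proof -
    have "(- y) + (- v) \<preceq> 0 + 0" by (intro le_add_mono) (simp_all add: neg_le_zero_iff y that)
    then show ?thesis using test[of "- y + - v"] by (simp add: blinfun.diff_left)
  qed
  then have l: "f - A u \<in> dual_plus \<xi> rep" by (simp add: dual_plus_def nonneg_iff)
  ultimately have ly: "(f - A u) y = 0" by (simp add: blinfun.diff_left)
  have neg: "(f - A u) z = 0 \<longleftrightarrow> (A u - f) z = 0" for z by (auto simp: blinfun.diff_left)
  have "closed {\<phi>. (A u - f) \<phi> = 0}" by (intro closed_Collect_eq continuous_intros)
  moreover have "convex {\<phi>. (A u - f) \<phi> = 0}"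
    unfolding convex_def by (auto simp: blinfun.add_right blinfun.scaleR_right)
  moreover have "0 \<in> radial_cone y" using y by (auto simp: radial_cone_def intro: exI[of _ 0])
  then have "0 \<in> K" using closure_subset by (auto simp: K_def)
  ultimately have K: "closed K" "convex K" "K \<noteq> {}"
    unfolding K_def by (auto intro!: closed_Int convex_Int convex_closure convex_radial_cone y)
  have k0: "0 \<le> k" using C Ca_pos by simp
  have \<Phi>'_lip: "norm (\<Phi>' u a - \<Phi>' u b) \<le> C * norm (a - b)" for a b
    by (rule hadamard_derivative_lipschitz[OF A1 lip e])
  have "\<exists>!\<alpha>. vi K d (\<Phi>' u \<alpha>) = \<alpha>"
  proof (rule banach_fix_type[OF k0 C(3)], intro allI)
    fix a b
    have "C\<^sub>a * norm (vi K d (\<Phi>' u a) - vi K d (\<Phi>' u b)) \<le> max C\<^sub>b 0 * norm (\<Phi>' u a - \<Phi>' u b)"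
      by (rule vi_solves_lipschitz_obstacle[OF vi_solves_vi[OF K] vi_solves_vi[OF K]])
    also have "\<dots> \<le> max C\<^sub>b 0 * (C * norm (a - b))" using \<Phi>'_lip by (intro mult_left_mono) auto
    finally show "dist (vi K d (\<Phi>' u a)) (vi K d (\<Phi>' u b)) \<le> k * dist a b"
      using Ca_pos unfolding C(2) dist_norm by (simp add: field_simps)
  qed
  then obtain \<alpha> where "vi K d (\<Phi>' u \<alpha>) = \<alpha>" by blast
  then have \<alpha>: "vi_solves K d (\<Phi>' u \<alpha>) \<alpha>" using vi_solves_vi[OF K, of d "\<Phi>' u \<alpha>"] by simp
  \<comment> \<open>An auxiliary curve whose obstacle is affine in \<open>t\<close>, so that the
    derivative theorem for fixed obstacles with linear perturbation applies to it.\<close>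
  define w where "w t = obst (f + t *\<^sub>R d) (\<Phi> (rep u) + t *\<^sub>R \<Phi>' u \<alpha>)" for t
  have w_lim: "((\<lambda>t. (1 / t) *\<^sub>R (w t - u)) \<longlongrightarrow> \<alpha>) (at_right 0)"
  proof (rule vi_directional_derivative[OF cone_neg_props(2) vi_u _ _ _ _ K_def _ \<alpha>])
    show "vi_solves cone_neg (f + t *\<^sub>R d) (\<Phi> (rep u) + t *\<^sub>R \<Phi>' u \<alpha>) (w t)" for t
      unfolding w_def by (rule obst_solves)
    show "closed (closure (radial_cone y))" "convex (closure (radial_cone y))"
      by (auto intro: convex_closure convex_radial_cone y)
    show "s *\<^sub>R (v - (u - \<Phi> (rep u))) \<in> closure (radial_cone y)" if v: "v \<in> cone_neg" and s: "s > 0" for v s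
    proof -
      obtain n :: nat where n: "s \<le> real n" using real_arch_simple by blast
      have "v + y \<preceq> 0 + y" using v by (intro le_add_mono) (auto simp: cone_neg_def)
      then have "s *\<^sub>R (v + y) \<preceq> s *\<^sub>R y" using s by (auto intro: le_scale_mono)
      then have "s *\<^sub>R (v + y) \<preceq> real n *\<^sub>R y" using multiple_mono[OF y n] by (rule le_trans)
      then have "s *\<^sub>R (v + y) \<in> radial_cone y" unfolding radial_cone_def by blast
      moreover have eq: "v - (u - \<Phi> (rep u)) = v + y" by (simp add: y_def)
      ultimately show ?thesis unfolding eq using closure_subset by blast
    qed
    have sub: "radial_cone y \<inter> {\<psi>. (f - A u) \<psi> = 0} \<subseteq>
        {\<phi>. (A u - f) \<phi> = 0 \<and> (\<exists>s>0. u - \<Phi> (rep u) + s *\<^sub>R \<phi> \<in> cone_neg)}"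
    proof
      fix \<psi> assume "\<psi> \<in> radial_cone y \<inter> {\<psi>. (f - A u) \<psi> = 0}"
      then obtain n :: nat where n: "\<psi> \<preceq> real n *\<^sub>R y" "(A u - f) \<psi> = 0"
        unfolding radial_cone_def neg by blast
      \<comment> \<open>The successor covers the multiple \<open>n = 0\<close>.\<close>
      let ?s = "1 / real (Suc n)"
      have "?s *\<^sub>R \<psi> \<preceq> ?s *\<^sub>R real n *\<^sub>R y" by (rule le_scale_mono[OF n(1)]) simp
      moreover have "(?s * real n) *\<^sub>R y \<preceq> 1 *\<^sub>R y" by (rule multiple_mono[OF y]) simp
      ultimately have "?s *\<^sub>R \<psi> \<preceq> y" by (auto intro: le_trans)
      then have "?s *\<^sub>R \<psi> - y \<preceq> 0" by (simp only: le_iff_diff_le[symmetric])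
      then have "u - \<Phi> (rep u) + ?s *\<^sub>R \<psi> \<in> cone_neg" by (simp add: cone_neg_def y_def algebra_simps)
      then show "\<psi> \<in> {\<phi>. (A u - f) \<phi> = 0 \<and> (\<exists>s>0. u - \<Phi> (rep u) + s *\<^sub>R \<phi> \<in> cone_neg)}"
        using n(2) by (auto intro!: exI[of _ ?s])
    qed
    show "K \<subseteq> closure {\<phi>. (A u - f) \<phi> = 0 \<and> (\<exists>s>0. u - \<Phi> (rep u) + s *\<^sub>R \<phi> \<in> cone_neg)}"
      using tangent_polyhedric[OF y l ly] closure_mono[OF sub] unfolding K_def neg[symmetric] by blast
  qed
  define r1 where "r1 t = norm ((1 / t) *\<^sub>R (\<Phi> (rep (u + t *\<^sub>R \<alpha>)) - \<Phi> (rep u)) - \<Phi>' u \<alpha>)" for t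
  define r2 where "r2 t = norm ((1 / t) *\<^sub>R (w t - u) - \<alpha>)" for t
  define m where "m = max C\<^sub>b 0 / C\<^sub>a"
  have m: "m \<ge> 0" "k = m * C" using Ca_pos C(2) by (auto simp: m_def)
  have r1: "(r1 \<longlongrightarrow> 0) (at_right 0)"
    unfolding r1_def using hadamard_quotient[OF A1[of u \<alpha>]] by (intro tendsto_norm_zero LIM_zero)
  have r2: "(r2 \<longlongrightarrow> 0) (at_right 0)"
    unfolding r2_def using w_lim by (intro tendsto_norm_zero LIM_zero)
  have "((\<lambda>t. u + t *\<^sub>R \<alpha>) \<longlongrightarrow> u + 0 *\<^sub>R \<alpha>) (at_right 0)" by (intro tendsto_intros)
  from tendstoD[OF this e] have ball: "\<forall>\<^sub>F t in at_right 0. u + t *\<^sub>R \<alpha> \<in> cball u e"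
    by eventually_elim (auto simp: dist_commute less_imp_le)
  have q_lim: "((\<lambda>t. (1 / t) *\<^sub>R (q t - (u + t *\<^sub>R \<alpha>))) \<longlongrightarrow> 0) (at_right 0)"
  proof (rule Lim_null_comparison)
    have "((\<lambda>t. (m * r1 t + r2 t) / (1 - k)) \<longlongrightarrow> (m * 0 + 0) / (1 - k)) (at_right 0)"
      using C(3) by (intro tendsto_intros r1 r2) auto
    then show "((\<lambda>t. (m * r1 t + r2 t) / (1 - k)) \<longlongrightarrow> 0) (at_right 0)" by simp
    show "\<forall>\<^sub>F t in at_right 0. norm ((1 / t) *\<^sub>R (q t - (u + t *\<^sub>R \<alpha>))) \<le> (m * r1 t + r2 t) / (1 - k)"
      using q(3) ball eventually_at_right_less[of 0]
    proof eventually_elim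
      case (elim t)
      let ?z = "u + t *\<^sub>R \<alpha>" and ?\<psi> = "\<Phi> (rep u) + t *\<^sub>R \<Phi>' u \<alpha>"
      have t: "t > 0" using elim by simp
      have "C\<^sub>a * norm (q t - w t) \<le> max C\<^sub>b 0 * norm (\<Phi> (rep (q t)) - ?\<psi>)"
        using q(1)[OF t] unfolding QVI_iff w_def by (rule vi_solves_lipschitz_obstacle[OF _ obst_solves])
      then have "norm (q t - w t) \<le> m * norm (\<Phi> (rep (q t)) - ?\<psi>)"
        using Ca_pos unfolding m_def by (simp add: field_simps)
      also have "\<dots> \<le> m * (C * norm (q t - ?z) + t * r1 t)"
      proof (rule mult_left_mono[OF _ m(1)])
        have "\<Phi> (rep ?z) - ?\<psi> = t *\<^sub>R ((1 / t) *\<^sub>R (\<Phi> (rep ?z) - \<Phi> (rep u)) - \<Phi>' u \<alpha>)"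
          using t by (simp add: algebra_simps)
        then have "norm (\<Phi> (rep ?z) - ?\<psi>) = t * r1 t" using t unfolding r1_def by simp
        then show "norm (\<Phi> (rep (q t)) - ?\<psi>) \<le> C * norm (q t - ?z) + t * r1 t"
          using lip[OF elim(2,1)] dist_triangle[of "\<Phi> (rep (q t))" ?\<psi> "\<Phi> (rep ?z)"]
          unfolding dist_norm by linarith
      qed
      \<comment> \<open>The unknown error reappears on the right with factor \<open>k < 1\<close>
        and is absorbed; \<open>r1\<close> is the remainder of the obstacle and \<open>r2\<close>
        that of \<open>w\<close>.\<close>
      finally have 1: "norm (q t - w t) \<le> k * norm (q t - ?z) + m * (t * r1 t)"
        unfolding m(2) by (simp add: algebra_simps)
      have "w t - ?z = t *\<^sub>R ((1 / t) *\<^sub>R (w t - u) - \<alpha>)" using t by (simp add: algebra_simps)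
      then have "norm (w t - ?z) = t * r2 t" using t unfolding r2_def by simp
      then have "norm (q t - ?z) \<le> norm (q t - w t) + t * r2 t"
        using dist_triangle[of "q t" ?z "w t"] unfolding dist_norm by simp
      then have "(1 - k) * norm (q t - ?z) \<le> t * (m * r1 t + r2 t)"
        using 1 by (simp add: algebra_simps)
      then have "norm (q t - ?z) / t \<le> (m * r1 t + r2 t) / (1 - k)"
        using t C(3) by (simp only: pos_divide_le_eq pos_le_divide_eq diff_gt_0_iff_gt times_divide_eq_left)
          (simp only: mult_ac)
      then show ?case unfolding norm_scaleR using t by simp
    qed
  qed
  \<comment> \<open>Adding \<alpha> back gives the quotients of \<open>q t - u\<close>, which are
    non-negative, and the order cone is closed.\<close>
  have "((\<lambda>t. (1 / t) *\<^sub>R (q t - (u + t *\<^sub>R \<alpha>)) + \<alpha>) \<longlongrightarrow> 0 + \<alpha>) (at_right 0)"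
    by (intro tendsto_intros q_lim)
  moreover have "\<forall>\<^sub>F t in at_right 0. (1 / t) *\<^sub>R (q t - (u + t *\<^sub>R \<alpha>)) + \<alpha> \<in> {v. 0 \<preceq> v}"
    using eventually_at_right_less[of 0]
  proof eventually_elim
    case (elim t)
    have "(1 / t) *\<^sub>R (q t - (u + t *\<^sub>R \<alpha>)) + \<alpha> = (1 / t) *\<^sub>R (q t - u)"
      using elim by (simp add: algebra_simps)
    moreover have "0 \<preceq> (1 / t) *\<^sub>R (q t - u)"
      using q(2)[of t] elim by (intro nonneg_scale) (auto simp: le_iff_diff_ge[symmetric])
    ultimately show ?case by simp
  qed
  ultimately have "0 + \<alpha> \<in> {v. 0 \<preceq> v}"
    by (intro Lim_in_closed_set[OF closed_nonneg]) auto
  then have "0 \<preceq> \<alpha>" by simp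
  moreover have crit: "v \<in> critical_set X \<xi> rep A \<Phi> \<Phi>' f u \<alpha> \<longleftrightarrow> v - \<Phi>' u \<alpha> \<in> K" for v
    unfolding K_def y_def using y[unfolded y_def] by (rule critical_set_iff)
  moreover have "(A \<alpha> - d) (\<alpha> - v) \<le> 0" if "v - \<Phi>' u \<alpha> \<in> K" for v
    using \<alpha> that unfolding vi_solves_def by force
  ultimately show ?thesis using q_lim \<alpha> unfolding vi_solves_def by blast
qed

section \<open>Choice of solutions and homogeneity in the direction\<close>

lemma Linf_dual_plus_subset: "Linf_dual_plus \<xi> rep \<subseteq> dual_plus \<xi> rep"
proof
  fix g :: "'v \<Rightarrow>\<^sub>L real" assume "g \<in> Linf_dual_plus \<xi> rep"
  then obtain g0 where g0: "AE x in \<xi>. 0 \<le> g0 x" "\<And>v. g v = (\<integral>x. g0 x * rep v x \<partial>\<xi>)"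
    unfolding Linf_dual_plus_def Linf_plus_def by auto
  have "0 \<le> g v" if "AE x in \<xi>. 0 \<le> rep v x" for v
    unfolding g0(2) using g0(1) that by (intro integral_nonneg_AE) (auto elim: eventually_elim2)
  then show "g \<in> dual_plus \<xi> rep" by (simp add: dual_plus_def V_plus_def)
qed

lemma scale_dual_plus: "d \<in> dual_plus \<xi> rep \<Longrightarrow> 0 \<le> t \<Longrightarrow> t *\<^sub>R d \<in> dual_plus \<xi> rep"
  by (simp add: dual_plus_def blinfun.scaleR_left)

text \<open>Choosing \<open>Q\<close> as a function of the source alone makes the curves in the
  directions \<open>d\<close> and \<open>c *\<^sub>R d\<close> run through the same solutions,
  although solutions need not be unique.\<close>

lemma exists_QVI_selection:
  assumes u: "u \<in> QVI \<xi> rep A \<Phi> f" and u0: "0 \<preceq> u"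
    and A1: "\<And>v h. has_hadamard_derivative (\<lambda>w. \<Phi> (rep w)) v h (\<Phi>' v h)"
    and C': "\<And>z v. z \<in> cball u e \<Longrightarrow> norm (\<Phi>' z v) \<le> C' * norm v"
    and small: "C' < 1 / (1 + inverse C\<^sub>a * C\<^sub>b)" and e: "e > 0"
  shows "\<exists>(Q :: ('v \<Rightarrow>\<^sub>L real) \<Rightarrow> 'v) (\<alpha> :: ('v \<Rightarrow>\<^sub>L real) \<Rightarrow> 'v). \<forall>d\<in>dual_plus \<xi> rep.
    (\<forall>t>0. Q (f + t *\<^sub>R d) \<in> QVI \<xi> rep A \<Phi> (f + t *\<^sub>R d) \<and> u \<preceq> Q (f + t *\<^sub>R d) \<and>
       Q (f + t *\<^sub>R d) \<preceq> linear_solution A (f + t *\<^sub>R d)) \<and>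
    ((\<lambda>t. (1 / t) *\<^sub>R (Q (f + t *\<^sub>R d) - (u + t *\<^sub>R \<alpha> d))) \<longlongrightarrow> 0) (at_right 0) \<and> 0 \<preceq> \<alpha> d \<and>
    \<alpha> d \<in> critical_set X \<xi> rep A \<Phi> \<Phi>' f u (\<alpha> d) \<and>
    (\<forall>v\<in>critical_set X \<xi> rep A \<Phi> \<Phi>' f u (\<alpha> d). (A (\<alpha> d) - d) (\<alpha> d - v) \<le> 0)"
proof -
  \<comment> \<open>On the trivial space the given bound may be negative.\<close>
  define C where "C = max C' 0"
  define k where "k = max C\<^sub>b 0 / C\<^sub>a * C"
  have C_bound: "norm (\<Phi>' z v) \<le> C * norm v" if "z \<in> cball u e" for z v
    using C'[OF that, of v] mult_right_mono[of C' C "norm v"] by (simp add: C_def)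
  have C0: "C \<ge> 0" by (simp add: C_def)
  \<comment> \<open>For positive \<open>C\<^sub>b\<close> the smallness condition reads
    \<open>C * (C\<^sub>a + C\<^sub>b) < C\<^sub>a\<close>, and \<open>C * C\<^sub>a\<close> is
    non-negative; otherwise the left side is 0.\<close>
  have "max C\<^sub>b 0 * C < C\<^sub>a"
  proof (cases "C\<^sub>b > 0")
    case True
    have "C < 1 / (1 + inverse C\<^sub>a * C\<^sub>b)" using small True Ca_pos by (simp add: C_def add_pos_nonneg)
    also have "\<dots> = C\<^sub>a / (C\<^sub>a + C\<^sub>b)" using Ca_pos True by (simp add: field_simps)
    finally have "C * (C\<^sub>a + C\<^sub>b) < C\<^sub>a" using Ca_pos True by (simp add: field_simps)
    moreover have "0 \<le> C * C\<^sub>a" using C0 Ca_pos by simp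
    ultimately show ?thesis using True by (simp add: algebra_simps)
  qed (use Ca_pos in auto)
  then have k1: "k < 1" using Ca_pos by (simp add: k_def field_simps)
  have lip: "norm (\<Phi> (rep b) - \<Phi> (rep a)) \<le> C * norm (b - a)" if "a \<in> cball u e" "b \<in> cball u e" for a b
    using lipschitz_of_hadamard_derivative_bound[OF A1 C_bound convex_cball that] .
  have "\<exists>q. g - f \<in> dual_plus \<xi> rep \<longrightarrow> q \<in> QVI \<xi> rep A \<Phi> g \<and> u \<preceq> q \<and> q \<preceq> linear_solution A g \<and>
    (norm (g - f) \<le> C\<^sub>a * ((1 - k) * e) \<longrightarrow> q \<in> cball u e)" for g
    using exists_QVI_in_order_interval[OF u u0 _ lip C0 k_def k1 e, of g] by blast
  then have "\<forall>g. \<exists>q. g - f \<in> dual_plus \<xi> rep \<longrightarrow> q \<in> QVI \<xi> rep A \<Phi> g \<and> u \<preceq> q \<and> q \<preceq> linear_solution A g \<and>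
    (norm (g - f) \<le> C\<^sub>a * ((1 - k) * e) \<longrightarrow> q \<in> cball u e)" by blast
  from choice[OF this] obtain Q where Q: "\<And>g. g - f \<in> dual_plus \<xi> rep \<Longrightarrow>
    Q g \<in> QVI \<xi> rep A \<Phi> g \<and> u \<preceq> Q g \<and> Q g \<preceq> linear_solution A g \<and>
    (norm (g - f) \<le> C\<^sub>a * ((1 - k) * e) \<longrightarrow> Q g \<in> cball u e)" by blast
  have Qt: "Q (f + t *\<^sub>R d) \<in> QVI \<xi> rep A \<Phi> (f + t *\<^sub>R d) \<and> u \<preceq> Q (f + t *\<^sub>R d) \<and>
       Q (f + t *\<^sub>R d) \<preceq> linear_solution A (f + t *\<^sub>R d) \<and>
       (norm (t *\<^sub>R d) \<le> C\<^sub>a * ((1 - k) * e) \<longrightarrow> Q (f + t *\<^sub>R d) \<in> cball u e)"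
    if "t > 0" "d \<in> dual_plus \<xi> rep" for t d
    using Q[of "f + t *\<^sub>R d"] scale_dual_plus[of d t] that by simp
  have "\<exists>\<alpha>. d \<in> dual_plus \<xi> rep \<longrightarrow>
    ((\<lambda>t. (1 / t) *\<^sub>R (Q (f + t *\<^sub>R d) - (u + t *\<^sub>R \<alpha>))) \<longlongrightarrow> 0) (at_right 0) \<and> 0 \<preceq> \<alpha> \<and>
    \<alpha> \<in> critical_set X \<xi> rep A \<Phi> \<Phi>' f u \<alpha> \<and>
    (\<forall>v\<in>critical_set X \<xi> rep A \<Phi> \<Phi>' f u \<alpha>. (A \<alpha> - d) (\<alpha> - v) \<le> 0)" for d
  proof (cases "d \<in> dual_plus \<xi> rep")
    case True
    have "\<forall>\<^sub>F t in at_right 0. Q (f + t *\<^sub>R d) \<in> cball u e"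
    proof -
      have "((\<lambda>t. norm (t *\<^sub>R d)) \<longlongrightarrow> norm (0 *\<^sub>R d)) (at_right 0)" by (intro tendsto_intros)
      moreover have "norm (0 *\<^sub>R d) < C\<^sub>a * ((1 - k) * e)" using Ca_pos k1 e by simp
      ultimately have "\<forall>\<^sub>F t in at_right 0. norm (t *\<^sub>R d) < C\<^sub>a * ((1 - k) * e)"
        by (rule order_tendstoD(2))
      then show ?thesis
        using eventually_at_right_less[of 0] by eventually_elim (use Qt[OF _ True] less_imp_le in blast)
    qed
    then have "\<exists>\<alpha>. ((\<lambda>t. (1 / t) *\<^sub>R (Q (f + t *\<^sub>R d) - (u + t *\<^sub>R \<alpha>))) \<longlongrightarrow> 0) (at_right 0) \<and> 0 \<preceq> \<alpha> \<and>
      \<alpha> \<in> critical_set X \<xi> rep A \<Phi> \<Phi>' f u \<alpha> \<and>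
      (\<forall>v\<in>critical_set X \<xi> rep A \<Phi> \<Phi>' f u \<alpha>. (A \<alpha> - d) (\<alpha> - v) \<le> 0)"
      using Qt[OF _ True] by (intro QVI_directional_derivative[OF u A1 lip C0 k_def k1 e]) auto
    then show ?thesis by blast
  qed blast
  then have "\<forall>d. \<exists>\<alpha>. d \<in> dual_plus \<xi> rep \<longrightarrow>
    ((\<lambda>t. (1 / t) *\<^sub>R (Q (f + t *\<^sub>R d) - (u + t *\<^sub>R \<alpha>))) \<longlongrightarrow> 0) (at_right 0) \<and> 0 \<preceq> \<alpha> \<and>
    \<alpha> \<in> critical_set X \<xi> rep A \<Phi> \<Phi>' f u \<alpha> \<and>
    (\<forall>v\<in>critical_set X \<xi> rep A \<Phi> \<Phi>' f u \<alpha>. (A \<alpha> - d) (\<alpha> - v) \<le> 0)" by blast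
  from choice[OF this] obtain \<alpha> where "\<And>d. d \<in> dual_plus \<xi> rep \<Longrightarrow>
    ((\<lambda>t. (1 / t) *\<^sub>R (Q (f + t *\<^sub>R d) - (u + t *\<^sub>R \<alpha> d))) \<longlongrightarrow> 0) (at_right 0) \<and> 0 \<preceq> \<alpha> d \<and>
    \<alpha> d \<in> critical_set X \<xi> rep A \<Phi> \<Phi>' f u (\<alpha> d) \<and>
    (\<forall>v\<in>critical_set X \<xi> rep A \<Phi> \<Phi>' f u (\<alpha> d). (A (\<alpha> d) - d) (\<alpha> d - v) \<le> 0)" by blast
  then show ?thesis using Qt by (intro exI[of _ Q] exI[of _ \<alpha>]) blast
qed

end

lemma expansion_imp_quotient:
  fixes q :: "real \<Rightarrow> 'v::real_normed_vector"
  assumes "((\<lambda>t. (1 / t) *\<^sub>R (q t - (u + t *\<^sub>R a))) \<longlongrightarrow> 0) (at_right 0)"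
  shows "((\<lambda>t. (1 / t) *\<^sub>R (q t - u)) \<longlongrightarrow> a) (at_right 0)"
proof -
  have "((\<lambda>t. (1 / t) *\<^sub>R (q t - (u + t *\<^sub>R a)) + a) \<longlongrightarrow> 0 + a) (at_right 0)"
    by (intro tendsto_intros assms)
  moreover have "\<forall>\<^sub>F t in at_right 0. (1 / t) *\<^sub>R (q t - (u + t *\<^sub>R a)) + a = (1 / t) *\<^sub>R (q t - u)"
    using eventually_at_right_less[of 0] by eventually_elim (simp add: algebra_simps)
  ultimately show ?thesis by (simp add: tendsto_cong)
qed

text \<open>Substituting \<open>c * t\<close> for \<open>t\<close> in the first expansion yields the
  quotients of the second multiplied by \<open>1 / c\<close>, and limits are unique.\<close>

lemma directional_derivative_homogeneous:
  fixes Q :: "'w::real_normed_vector \<Rightarrow> 'v::real_normed_vector"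
  assumes a: "((\<lambda>t. (1 / t) *\<^sub>R (Q (f + t *\<^sub>R d) - (u + t *\<^sub>R a))) \<longlongrightarrow> 0) (at_right 0)"
    and b: "((\<lambda>t. (1 / t) *\<^sub>R (Q (f + t *\<^sub>R (c *\<^sub>R d)) - (u + t *\<^sub>R b))) \<longlongrightarrow> 0) (at_right 0)"
    and c: "c > 0"
  shows "b = c *\<^sub>R a"
proof -
  have "filterlim (\<lambda>t. c * t) (at_right 0) (at_right 0)"
  proof (rule filterlim_at_withinI)
    have "((\<lambda>t. c * t) \<longlongrightarrow> c * 0) (at_right 0)" by (intro tendsto_intros)
    then show "((\<lambda>t. c * t) \<longlongrightarrow> 0) (at_right 0)" by simp
    show "\<forall>\<^sub>F t in at_right 0. c * t \<in> {0<..} - {0}"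
      using eventually_at_right_less[of 0] by eventually_elim (use c in auto)
  qed
  from filterlim_compose[OF expansion_imp_quotient[OF a] this]
  have "((\<lambda>t. c *\<^sub>R ((1 / (c * t)) *\<^sub>R (Q (f + (c * t) *\<^sub>R d) - u))) \<longlongrightarrow> c *\<^sub>R a) (at_right 0)"
    by (intro tendsto_intros)
  moreover have "(\<lambda>t. c *\<^sub>R ((1 / (c * t)) *\<^sub>R (Q (f + (c * t) *\<^sub>R d) - u))) =
      (\<lambda>t. (1 / t) *\<^sub>R (Q (f + t *\<^sub>R (c *\<^sub>R d)) - u))"
    using c by (simp add: mult.commute)
  ultimately have "((\<lambda>t. (1 / t) *\<^sub>R (Q (f + t *\<^sub>R (c *\<^sub>R d)) - u)) \<longlongrightarrow> c *\<^sub>R a) (at_right 0)"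
    by simp
  from tendsto_unique[OF _ expansion_imp_quotient[OF b] this] show ?thesis by simp
qed

theorem theorem1p6:
  fixes X :: "'x::t2_space set"
    and \<xi> :: "'x measure"
    and rep :: "'v::{real_inner, banach} \<Rightarrow> 'x \<Rightarrow> real"
    and \<kappa> C\<^sub>a C\<^sub>b :: real
    and A :: "'v \<Rightarrow> 'v \<Rightarrow>\<^sub>L real"
    and \<Phi> :: "('x \<Rightarrow> real) \<Rightarrow> 'v"
    and \<Phi>' :: "'v \<Rightarrow> 'v \<Rightarrow> 'v"
    and f :: "'v \<Rightarrow>\<^sub>L real"
    and u :: 'v
    and D :: "('v \<Rightarrow>\<^sub>L real) set"
    and \<Omega> :: "'n::euclidean_space set"
    and \<iota> :: "'n \<Rightarrow> 'x"
  assumes setting: "qvi_setting X \<xi> rep \<kappa> C\<^sub>a C\<^sub>b A \<Phi>"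
    and f: "f \<in> dual_plus \<xi> rep"
    and u: "u \<in> QVI \<xi> rep A \<Phi> f"
    and u_nonneg: "AE x in \<xi>. 0 \<le> rep u x"
    and u_upper: "AE x in \<xi>. rep u x \<le> rep (linear_solution A f) x"
    and A1: "\<And>v h. has_hadamard_derivative (\<lambda>w. \<Phi> (rep w)) v h (\<Phi>' v h)"
    and A3: "\<And>v. completely_continuous (\<Phi>' v)"
    and A4: "\<And>(b::'v) (h :: real \<Rightarrow> 'v) (l::real).
               0 \<le> l \<Longrightarrow> l \<le> 1 \<Longrightarrow> ((\<lambda>t. (1 / t) *\<^sub>R h t) \<longlongrightarrow> 0) (at_right 0) \<Longrightarrow>
               ((\<lambda>t. norm (\<Phi>' (u + t *\<^sub>R b + l *\<^sub>R h t) (h t)) / t) \<longlongrightarrow> 0) (at_right 0)"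
    and A5: "\<exists>e>0. \<exists>C. C < 1 / (1 + inverse C\<^sub>a * C\<^sub>b) \<and>
               (\<forall>z\<in>cball u e. \<forall>v. norm (\<Phi>' z v) \<le> C * norm v)"
    and A2: "(completely_continuous (\<lambda>w. \<Phi> (rep w)) \<and>
                D = dual_plus \<xi> rep) \<or>
             (is_H1_setting \<Omega> \<iota> X \<xi> rep \<and> concave_obstacle_map \<xi> rep \<Phi> \<and>
                f \<in> Linf_dual_plus \<xi> rep \<and> D = Linf_dual_plus \<xi> rep)"
  shows "\<exists>(q :: ('v \<Rightarrow>\<^sub>L real) \<Rightarrow> real \<Rightarrow> 'v) (\<alpha> :: ('v \<Rightarrow>\<^sub>L real) \<Rightarrow> 'v).
    (\<forall>d\<in>D.
       (\<forall>t>0. q d t \<in> QVI \<xi> rep A \<Phi> (f + t *\<^sub>R d) \<and>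
              (AE x in \<xi>. rep u x \<le> rep (q d t) x) \<and>
              (AE x in \<xi>. rep (q d t) x \<le> rep (linear_solution A (f + t *\<^sub>R d)) x)) \<and>
       \<alpha> d \<in> V_plus \<xi> rep \<and>
       ((\<lambda>t. (1 / t) *\<^sub>R (q d t - (u + t *\<^sub>R \<alpha> d))) \<longlongrightarrow> 0) (at_right 0) \<and>
       \<alpha> d \<in> critical_set X \<xi> rep A \<Phi> \<Phi>' f u (\<alpha> d) \<and>
       (\<forall>v\<in>critical_set X \<xi> rep A \<Phi> \<Phi>' f u (\<alpha> d). (A (\<alpha> d) - d) (\<alpha> d - v) \<le> 0)) \<and>
    (\<forall>d\<in>D. \<forall>c>0. \<alpha> (c *\<^sub>R d) = c *\<^sub>R \<alpha> d)"
proof -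
  interpret qvi_setting X \<xi> rep \<kappa> C\<^sub>a C\<^sub>b A \<Phi> by (rule setting)
  have D: "D \<subseteq> dual_plus \<xi> rep" using A2 Linf_dual_plus_subset by auto
  obtain e C where e: "e > 0" "C < 1 / (1 + inverse C\<^sub>a * C\<^sub>b)"
    "\<And>z v. z \<in> cball u e \<Longrightarrow> norm (\<Phi>' z v) \<le> C * norm v"
    using A5 by blast
  have "0 \<preceq> u" using u_nonneg by (simp add: nonneg_AE)
  from exists_QVI_selection[OF u this A1 e(3,2,1)]
  obtain Q :: "('v \<Rightarrow>\<^sub>L real) \<Rightarrow> 'v" and \<alpha> :: "('v \<Rightarrow>\<^sub>L real) \<Rightarrow> 'v"
    where Q: "\<forall>d\<in>dual_plus \<xi> rep.
    (\<forall>t>0. Q (f + t *\<^sub>R d) \<in> QVI \<xi> rep A \<Phi> (f + t *\<^sub>R d) \<and> u \<preceq> Q (f + t *\<^sub>R d) \<and>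
       Q (f + t *\<^sub>R d) \<preceq> linear_solution A (f + t *\<^sub>R d)) \<and>
    ((\<lambda>t. (1 / t) *\<^sub>R (Q (f + t *\<^sub>R d) - (u + t *\<^sub>R \<alpha> d))) \<longlongrightarrow> 0) (at_right 0) \<and> 0 \<preceq> \<alpha> d \<and>
    \<alpha> d \<in> critical_set X \<xi> rep A \<Phi> \<Phi>' f u (\<alpha> d) \<and>
    (\<forall>v\<in>critical_set X \<xi> rep A \<Phi> \<Phi>' f u (\<alpha> d). (A (\<alpha> d) - d) (\<alpha> d - v) \<le> 0)"
    by blast
  have "\<alpha> (c *\<^sub>R d) = c *\<^sub>R \<alpha> d" if "d \<in> D" "c > 0" for d c
  proof -
    have "d \<in> dual_plus \<xi> rep" "c *\<^sub>R d \<in> dual_plus \<xi> rep"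
      using D that scale_dual_plus[of d c] by auto
    then show ?thesis
      using Q \<open>c > 0\<close> by (intro directional_derivative_homogeneous[of Q f d u "\<alpha> d" c "\<alpha> (c *\<^sub>R d)"]) blast+
  qed
  then show ?thesis
    using Q[unfolded nonneg_iff, unfolded le_def] D
    by (intro exI[of _ "\<lambda>d t. Q (f + t *\<^sub>R d)"] exI[of _ \<alpha>]) blast
qed

end
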